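(* Let $m,n,k,l$ be positive integers, let $G=\operatorname{SL}(m+1)\times\operatorname{SL}(n+1)$ and let $X_{k,l}$ be a divisor of bidegree $(k,l)$ in $\mathbb{P}^m\times\mathbb{P}^n$. Then $X_{k,l}$ is not stable (respectively unstable) if and only if there exists $g\in G$ such that the associated set of monomials $\operatorname{Supp}(g\cdot X_{k,l})$ is contained in $N^{\oplus}(\lambda)$ (respectively $N^{+}(\lambda)$) for some $\lambda\in S_{m,n}^{k,l}$.
   Context: We work over $\mathbb{C}$. Let $x_0,\dots,x_m$ and $y_0,\dots,y_n$ be coordinates on $\mathbb{P}^m$ and $\mathbb{P}^n$, and let $T\subset G$ be the diagonal maximal torus. A divisor $X_{k,l}$ of bidegree $(k,l)$ is given by a nonzero bihomogeneous polynomial $F=\sum_I c_I x^I$, where $x^I=x_0^{k_0}\cdots x_m^{k_m}y_0^{l_0}\cdots y_n^{l_n}$, $I=(k_0,\dots,k_m,l_0,\dots,l_n)$, $\sum k_i=k$, $\sum l_j=l$. Let $\Xi_{k,l}$ be the set of all monomials of bidegree $(k,l)$ and $\operatorname{Supp}(X_{k,l})=\{x^I\in\Xi_{k,l}: c_I\ne0\}$. Stability (stable, semistable, unstable = not semistable) is GIT stability for the natural linearised action of $G$ on the projective space of such polynomials. A one-parameter subgroup of $T$ is $\lambda(t)=(\operatorname{Diag}(t^{r_0},\dots,t^{r_m}),\operatorname{Diag}(t^{s_0},\dots,t^{s_n}))$ with $r_i,s_j\in\mathbb{Z}$, $\sum r_i=\sum s_j=0$. Set $\langle I,\lambda\rangle=\sum_i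 r_ik_i+\sum_j s_jl_j$, $N^+(\lambda)=\{x^I\in\Xi_{k,l}:\langle I,\lambda\rangle>0\}$ and $N^{\oplus}(\lambda)=\{x^I\in\Xi_{k,l}:\langle I,\lambda\rangle\ge0\}$. The fundamental set $S_{m,n}^{k,l}$ consists of all $\lambda(t)=(\operatorname{Diag}(t^{r_0},\dots,t^{r_m}),\operatorname{Diag}(t^{s_0},\dots,t^{s_n}))\in T$ with $(r_0,\dots,r_m,s_0,\dots,s_n)=c(\rho_0,\dots,\rho_m,\sigma_0,\dots,\sigma_n)\in\mathbb{Z}^{m+n+2}$ such that: (1) $\rho_i=a_i/b_i$ and $\sigma_j=c_j/d_j$ are rational numbers in lowest terms; (2) $c=\operatorname{lcm}(b_0,\dots,b_m,d_0,\dots,d_n)$; (3) $\rho_0\ge\cdots\ge\rho_m$, $\sigma_0\ge\cdots\ge\sigma_n$, $\sum_i\rho_i=0$, $\sum_j\sigma_j=0$; (4) after fixing $\rho_0=1$ or $\sigma_0=1$, $(\rho_0,\dots,\rho_m,\sigma_0,\dots,\sigma_n)$ is the unique non-trivial solution of a consistent linear system (together with the two sum conditions in (3)) of $m+n-1$ equations chosen from $$\operatorname{Eq}_{m,n}^{k,l}=\Big\{\sum_{i=0}^m w_i\rho_i+\sum_{j=0}^n v_j\sigma_j=0 \ \Big|\ w_i\in[-k,k]\cap\mathbb{Z},\ \sum_i w_i=0,\ v_j\in[-l,l]\cap\mathbb{Z},\ \sum_j v_j=0\Big\}.$$ *)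

theory Defs
  imports
    "HOL-Library.Poly_Mapping"
    "Jordan_Normal_Form.Determinant"
    "Jordan_Normal_Form.Gauss_Jordan_Elimination"
begin

section \<open>Polynomials\<close>

text \<open>
  A polynomial over the complex numbers in variables of type \<open>'v\<close> is a finitely supported map from
  exponent vectors \<open>'v \<Rightarrow>\<^sub>0 nat\<close> to coefficients; the ring structure is the convolution
  product of the library.
\<close>

type_synonym 'v monom = "'v \<Rightarrow>\<^sub>0 nat"
type_synonym 'v cpoly = "'v monom \<Rightarrow>\<^sub>0 complex"

definition const :: "complex \<Rightarrow> 'v cpoly" where
  "const c = Poly_Mapping.single 0 c"

definition var :: "'v \<Rightarrow> 'v cpoly" where
  "var v = Poly_Mapping.single (Poly_Mapping.single v 1) 1"

definition poly_eval :: "('v \<Rightarrow> complex) \<Rightarrow> 'v cpoly \<Rightarrow> complex" where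
  "poly_eval a p =
     (\<Sum>M\<in>Poly_Mapping.keys p. Poly_Mapping.lookup p M *
        (\<Prod>v\<in>Poly_Mapping.keys M. a v ^ Poly_Mapping.lookup M v))"

definition poly_subst :: "('v \<Rightarrow> 'w cpoly) \<Rightarrow> 'v cpoly \<Rightarrow> 'w cpoly" where
  "poly_subst h p =
     (\<Sum>M\<in>Poly_Mapping.keys p. const (Poly_Mapping.lookup p M) *
        (\<Prod>v\<in>Poly_Mapping.keys M. h v ^ Poly_Mapping.lookup M v))"


section \<open>Bihomogeneous forms and the group action\<close>

text \<open>The coordinates: \<open>Inl i\<close> is $x_i$ and \<open>Inr j\<close> is $y_j$.\<close>

type_synonym coord = "nat + nat"
type_synonym form = "coord cpoly"

definition Xi :: "nat \<Rightarrow> nat \<Rightarrow> nat \<Rightarrow> nat \<Rightarrow> coord monom set" where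
  "Xi m n k l = {I. Poly_Mapping.keys I \<subseteq> Inl ` {..m} \<union> Inr ` {..n} \<and>
     (\<Sum>i\<le>m. Poly_Mapping.lookup I (Inl i)) = k \<and>
     (\<Sum>j\<le>n. Poly_Mapping.lookup I (Inr j)) = l}"

text \<open>The vector space of forms of bidegree \<open>(k, l)\<close>, zero included.\<close>

definition bihom_forms :: "nat \<Rightarrow> nat \<Rightarrow> nat \<Rightarrow> nat \<Rightarrow> form set" where
  "bihom_forms m n k l = {F. Poly_Mapping.keys F \<subseteq> Xi m n k l}"

definition Supp :: "form \<Rightarrow> coord monom set" where
  "Supp F = {I. Poly_Mapping.lookup F I \<noteq> 0}"

definition SL :: "nat \<Rightarrow> complex mat set" where
  "SL N = {A \<in> carrier_mat N N. det A = 1}"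

definition grp :: "nat \<Rightarrow> nat \<Rightarrow> (complex mat \<times> complex mat) set" where
  "grp m n = SL (m + 1) \<times> SL (n + 1)"

text \<open>The images of the coordinates under $(x, y) \mapsto (A x, B y)$, with \<open>x\<close>, \<open>y\<close> column vectors.\<close>

fun lin_change :: "complex mat \<Rightarrow> complex mat \<Rightarrow> coord \<Rightarrow> form" where
  "lin_change A B (Inl i) = (\<Sum>j<dim_col A. const (A $$ (i, j)) * var (Inl j))"
| "lin_change A B (Inr i) = (\<Sum>j<dim_col B. const (B $$ (i, j)) * var (Inr j))"

text \<open>
  The natural left action $(g \cdot F)(x, y) = F(g^{-1}(x, y))$, so that \<open>act g F\<close> is an equation of
  the translated divisor $g \cdot X$.
\<close>

fun act :: "complex mat \<times> complex mat \<Rightarrow> form \<Rightarrow> form" where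
  "act (A, B) F = poly_subst (lin_change (the (mat_inverse A)) (the (mat_inverse B))) F"


section \<open>GIT stability\<close>

text \<open>
  Polynomial functions on the space of forms have one variable for each monomial of bidegree
  \<open>(k, l)\<close>, standing for the coefficient of that monomial.  Those that are homogeneous of degree
  \<open>d\<close> are the global sections of $\mathcal{O}(d)$ on the projective space of forms.
\<close>

definition sections :: "nat \<Rightarrow> nat \<Rightarrow> nat \<Rightarrow> nat \<Rightarrow> nat \<Rightarrow> coord monom cpoly set" where
  "sections m n k l d = {f. \<forall>M\<in>Poly_Mapping.keys f. Poly_Mapping.keys M \<subseteq> Xi m n k l \<and>
     (\<Sum>I\<in>Poly_Mapping.keys M. Poly_Mapping.lookup M I) = d}"

definition value_at :: "coord monom cpoly \<Rightarrow> form \<Rightarrow> complex" where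
  "value_at f F = poly_eval (Poly_Mapping.lookup F) f"

definition invariant_section :: "nat \<Rightarrow> nat \<Rightarrow> nat \<Rightarrow> nat \<Rightarrow> nat \<Rightarrow> coord monom cpoly \<Rightarrow> bool" where
  "invariant_section m n k l d f \<longleftrightarrow> f \<in> sections m n k l d \<and>
     (\<forall>g\<in>grp m n. \<forall>F\<in>bihom_forms m n k l. value_at f (act g F) = value_at f F)"

text \<open>
  In what follows a nonzero form \<open>F\<close> represents a point \<open>[F]\<close> of the projective space of forms.
  The definitions are those of Mumford, in the form of Huybrechts--Lehn, \<^emph>\<open>The Geometry of Moduli
  Spaces of Sheaves\<close>, Def. 4.2.9: \<open>[F]\<close> is semistable if some invariant section of a positive power of
  the linearised bundle does not vanish at \<open>[F]\<close>, and it is stable if moreover its stabilizer in \<open>G\<close>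
  is finite and its orbit is closed in the (Zariski) open set of semistable points.
\<close>

definition git_semistable :: "nat \<Rightarrow> nat \<Rightarrow> nat \<Rightarrow> nat \<Rightarrow> form \<Rightarrow> bool" where
  "git_semistable m n k l F \<longleftrightarrow> F \<in> bihom_forms m n k l \<and> F \<noteq> 0 \<and>
     (\<exists>d f. d \<ge> 1 \<and> invariant_section m n k l d f \<and> value_at f F \<noteq> 0)"

definition git_unstable :: "nat \<Rightarrow> nat \<Rightarrow> nat \<Rightarrow> nat \<Rightarrow> form \<Rightarrow> bool" where
  "git_unstable m n k l F \<longleftrightarrow> \<not> git_semistable m n k l F"

definition proj_stabilizer :: "nat \<Rightarrow> nat \<Rightarrow> form \<Rightarrow> (complex mat \<times> complex mat) set" where
  "proj_stabilizer m n F = {g \<in> grp m n. \<exists>c. c \<noteq> 0 \<and> act g F = const c * F}"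

text \<open>All nonzero representatives of the points of the orbit of \<open>[F]\<close>.\<close>

definition proj_orbit :: "nat \<Rightarrow> nat \<Rightarrow> form \<Rightarrow> form set" where
  "proj_orbit m n F = {const c * act g F | c g. c \<noteq> 0 \<and> g \<in> grp m n}"

text \<open>
  The Zariski closed subsets of projective space are the zero loci of sets of homogeneous polynomials.
\<close>

definition orbit_closed_in_semistable :: "nat \<Rightarrow> nat \<Rightarrow> nat \<Rightarrow> nat \<Rightarrow> form \<Rightarrow> bool" where
  "orbit_closed_in_semistable m n k l F \<longleftrightarrow>
     (\<exists>P. P \<subseteq> (\<Union>d. sections m n k l d) \<and>
        (\<forall>H. git_semistable m n k l H \<longrightarrow>
           (H \<in> proj_orbit m n F \<longleftrightarrow> (\<forall>p\<in>P. value_at p H = 0))))"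

definition git_stable :: "nat \<Rightarrow> nat \<Rightarrow> nat \<Rightarrow> nat \<Rightarrow> form \<Rightarrow> bool" where
  "git_stable m n k l F \<longleftrightarrow> git_semistable m n k l F \<and>
     finite (proj_stabilizer m n F) \<and> orbit_closed_in_semistable m n k l F"


section \<open>One-parameter subgroups and the fundamental set\<close>

text \<open>
  The one-parameter subgroup $\lambda(t) = (\mathrm{Diag}(t^{r_0}, \dots, t^{r_m}),
  \mathrm{Diag}(t^{s_0}, \dots, t^{s_n}))$ is given by its pair of weight vectors \<open>(r, s)\<close>.
\<close>

type_synonym one_ps = "int vec \<times> int vec"

fun pairing :: "nat \<Rightarrow> nat \<Rightarrow> coord monom \<Rightarrow> one_ps \<Rightarrow> int" where
  "pairing m n I (r, s) =
     (\<Sum>i\<le>m. r $ i * int (Poly_Mapping.lookup I (Inl i))) +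
     (\<Sum>j\<le>n. s $ j * int (Poly_Mapping.lookup I (Inr j)))"

definition N_plus :: "nat \<Rightarrow> nat \<Rightarrow> nat \<Rightarrow> nat \<Rightarrow> one_ps \<Rightarrow> coord monom set" where
  "N_plus m n k l u = {I \<in> Xi m n k l. pairing m n I u > 0}"

definition N_oplus :: "nat \<Rightarrow> nat \<Rightarrow> nat \<Rightarrow> nat \<Rightarrow> one_ps \<Rightarrow> coord monom set" where
  "N_oplus m n k l u = {I \<in> Xi m n k l. pairing m n I u \<ge> 0}"

text \<open>An equation of $\mathrm{Eq}_{m,n}^{k,l}$ is given by its coefficient vectors \<open>(w, v)\<close>.\<close>

definition Eqs :: "nat \<Rightarrow> nat \<Rightarrow> nat \<Rightarrow> nat \<Rightarrow> (int vec \<times> int vec) set" where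
  "Eqs m n k l = {(w, v). w \<in> carrier_vec (m + 1) \<and> v \<in> carrier_vec (n + 1) \<and>
     (\<forall>i\<le>m. w $ i \<in> {- int k..int k}) \<and> (\<Sum>i\<le>m. w $ i) = 0 \<and>
     (\<forall>j\<le>n. v $ j \<in> {- int l..int l}) \<and> (\<Sum>j\<le>n. v $ j) = 0}"

text \<open>The solutions of a system of such equations together with the two sum conditions.\<close>

definition solutions ::
    "nat \<Rightarrow> nat \<Rightarrow> (int vec \<times> int vec) set \<Rightarrow> (rat vec \<times> rat vec) set" where
  "solutions m n E = {(\<rho>, \<sigma>). \<rho> \<in> carrier_vec (m + 1) \<and> \<sigma> \<in> carrier_vec (n + 1) \<and>
     (\<Sum>i\<le>m. \<rho> $ i) = 0 \<and> (\<Sum>j\<le>n. \<sigma> $ j) = 0 \<and>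
     (\<forall>(w, v)\<in>E. (\<Sum>i\<le>m. of_int (w $ i) * \<rho> $ i) + (\<Sum>j\<le>n. of_int (v $ j) * \<sigma> $ j) = 0)}"

text \<open>
  The normalised rational weights: uniqueness refers to the linear system with the additional
  equation \<open>\<rho> $ 0 = 1\<close> (or \<open>\<sigma> $ 0 = 1\<close>), which makes any solution non-trivial; the monotonicity
  conditions are not part of that system.
\<close>

definition normalised_weights :: "nat \<Rightarrow> nat \<Rightarrow> nat \<Rightarrow> nat \<Rightarrow> (rat vec \<times> rat vec) set" where
  "normalised_weights m n k l = {(\<rho>, \<sigma>).
     \<rho> \<in> carrier_vec (m + 1) \<and> \<sigma> \<in> carrier_vec (n + 1) \<and>
     (\<forall>i<m. \<rho> $ i \<ge> \<rho> $ (i + 1)) \<and> (\<forall>j<n. \<sigma> $ j \<ge> \<sigma> $ (j + 1)) \<and>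
     (\<Sum>i\<le>m. \<rho> $ i) = 0 \<and> (\<Sum>j\<le>n. \<sigma> $ j) = 0 \<and>
     (\<exists>E. E \<subseteq> Eqs m n k l \<and> finite E \<and> card E = m + n - 1 \<and>
        ({(\<rho>', \<sigma>') \<in> solutions m n E. \<rho>' $ 0 = 1} = {(\<rho>, \<sigma>)} \<or>
         {(\<rho>', \<sigma>') \<in> solutions m n E. \<sigma>' $ 0 = 1} = {(\<rho>, \<sigma>)}))}"

text \<open>\<open>quotient_of\<close> returns numerator and (positive) denominator in lowest terms.\<close>

definition common_denominator :: "nat \<Rightarrow> nat \<Rightarrow> rat vec \<times> rat vec \<Rightarrow> int" where
  "common_denominator m n = (\<lambda>(\<rho>, \<sigma>).
     Lcm ((\<lambda>i. snd (quotient_of (\<rho> $ i))) ` {..m} \<union> (\<lambda>j. snd (quotient_of (\<sigma> $ j))) ` {..n}))"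

definition fundamental_set :: "nat \<Rightarrow> nat \<Rightarrow> nat \<Rightarrow> nat \<Rightarrow> one_ps set" where
  "fundamental_set m n k l = {(r, s). r \<in> carrier_vec (m + 1) \<and> s \<in> carrier_vec (n + 1) \<and>
     (\<exists>(\<rho>, \<sigma>) \<in> normalised_weights m n k l.
        (\<forall>i\<le>m. of_int (r $ i) = of_int (common_denominator m n (\<rho>, \<sigma>)) * \<rho> $ i) \<and>
        (\<forall>j\<le>n. of_int (s $ j) = of_int (common_denominator m n (\<rho>, \<sigma>)) * \<sigma> $ j))}"

end

theory Submission
  imports Defs "HOL-Computational_Algebra.Fundamental_Theorem_Algebra"
begin

text \<open>
  The existence of destabilising subgroups is proved algebraically.  Averaging over the group is
  replaced by an orthogonal projection for the apolar inner product, for which the adjoint of a group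
  element is again a group element; hence the origin lies in the Zariski closure of the orbit of an
  unstable form.  A point of such a closure is the specialisation of a generic point of the orbit at a
  place with values in the complex numbers, in general of higher rank.
  Diagonalising the generic group element over the valuation ring gives weights in an ordered group,
  and Fourier--Motzkin elimination replaces them by rational weights.  The same works for an orbit
  that is not closed and for an infinite stabilizer, because an infinite affine variety has a point
  at infinity.  Finally, the minimum of the weights of the monomials is linear on each of the cones cut
  out by the differences of monomials in a Weyl chamber, so that its sign is detected on extreme rays;
  these are the elements of the fundamental set.
\<close>

section \<open>Polynomials as finitely supported maps\<close>

text \<open>The usual Hilbert-Mumford argument restricts to a curve through a boundary point. A
  place takes the role of the curve: it exists by Zorn's lemma for any family of matrices
  parametrised by a set and asks for no dimension theory. The price is a value group of arbitrary
  rank. This is harmless, because only finitely many Laurent monomials in the elementary divisors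
  matter. The three ways of failing stability (no invariant, orbit not closed, infinite stabilizer)
  differ only in the family that is specialised; all end in \<open>destabilizing_subgroup\<close>.
  Its input is a family of group elements whose translates of \<open>F\<close> have values at the
  place, and \<open>N_plus\<close> or \<open>N_oplus\<close> results according to whether these
  values all vanish. In the second case the family itself must have a pole, since otherwise the
  weights found could all be 0. The bounds \<open>k\<close> and \<open>l\<close> on the equations
  are the bounds on the difference of the exponents of two monomials of bidegree
  \<open>(k, l)\<close>; the simple roots obey them because \<open>k\<close> and \<open>l\<close>
  are positive.\<close>

abbreviation lk :: "('a \<Rightarrow>\<^sub>0 'b::zero) \<Rightarrow> 'a \<Rightarrow> 'b" where "lk \<equiv> Poly_Mapping.lookup"
abbreviation sg :: "'a \<Rightarrow> 'b \<Rightarrow> ('a \<Rightarrow>\<^sub>0 'b::zero)" where "sg \<equiv> Poly_Mapping.single"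
abbreviation ks :: "('a \<Rightarrow>\<^sub>0 'b::zero) \<Rightarrow> 'a set" where "ks \<equiv> Poly_Mapping.keys"

lemma poly_mapping_as_sum: "(p :: 'a \<Rightarrow>\<^sub>0 'b::comm_monoid_add) = (\<Sum>M\<in>ks p. sg M (lk p M))"
proof (rule poly_mapping_eqI)
  fix K
  have "lk (\<Sum>M\<in>ks p. sg M (lk p M)) K = (\<Sum>M\<in>ks p. if M = K then lk p M else 0)"
    unfolding lookup_sum by (rule sum.cong) (auto simp: lookup_single when_def)
  also have "\<dots> = lk p K" by (simp add: in_keys_iff)
  finally show "lk p K = lk (\<Sum>M\<in>ks p. sg M (lk p M)) K" by simp
qed

lemma poly_mapping_induct [case_names single add]:
  fixes p :: "'a \<Rightarrow>\<^sub>0 'b::comm_monoid_add"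
  assumes s: "\<And>M c. P (sg M c)" and a: "\<And>p q. P p \<Longrightarrow> P q \<Longrightarrow> P (p + q)"
  shows "P p"
proof -
  have z: "P 0" using s[of undefined 0] by simp
  have "P (\<Sum>M\<in>A. sg M (lk p M))" if "finite A" for A
    using that by (induction A) (auto simp: z s a)
  from this[of "ks p"] show ?thesis using poly_mapping_as_sum[of p] by simp
qed

lemma monom_induct [case_names zero add]:
  fixes M :: "'v monom"
  assumes z: "P 0" and a: "\<And>M v. P M \<Longrightarrow> P (sg v 1 + M)"
  shows "P M"
proof (induction M rule: poly_mapping_induct)
  have b: "P (sg v c + M)" if "P M" for v c and M :: "'v monom"
  proof (induction c)
    case 0 then show ?case using that by simp
  next
    case (Suc c)
    have "sg v (Suc c) + M = sg v 1 + (sg v c + M)"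
      by (simp add: single_add[symmetric] add.assoc[symmetric])
    then show ?case using a[OF Suc] by simp
  qed
  have "P (sg v c)" for v c using b[OF z, of v c] by simp
  {
    case (single M c) show ?case by fact
  next
    case (add p q)
    \<comment> \<open>\<open>P\<close> need not be closed under sums, so knowing \<open>P\<close>
      for \<open>p\<close> does not help; \<open>p\<close> is added to \<open>q\<close> one power of
      a variable at a time.\<close>
    have "P (p + q)" if "P q" for p q
    proof -
      have "P ((\<Sum>M\<in>A. sg M (lk p M)) + q)" if "finite A" for A
        using that by (induction A) (auto simp: add.assoc \<open>P q\<close> b)
      from this[of "ks p"] show ?thesis using poly_mapping_as_sum[of p] by simp
    qed
    then show ?case using add by simp
  }
qed

section \<open>Evaluation and substitution as one homomorphism\<close>

definition mon_val :: "('v \<Rightarrow> 'r::comm_ring_1) \<Rightarrow> 'v monom \<Rightarrow> 'r" where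
  "mon_val h M = (\<Prod>v\<in>ks M. h v ^ lk M v)"

lemma mon_val_superset:
  assumes "finite A" "ks M \<subseteq> A"
  shows "mon_val h M = (\<Prod>v\<in>A. h v ^ lk M v)"
  unfolding mon_val_def
  by (rule prod.mono_neutral_left) (use assms in \<open>auto simp: in_keys_iff\<close>)

lemma mon_val_0 [simp]: "mon_val h 0 = 1" by (simp add: mon_val_def)

lemma mon_val_single [simp]: "mon_val h (sg v n) = h v ^ n"
  by (cases "n = 0") (simp_all add: mon_val_def)

lemma ks_add_nat: "ks (M + N :: 'v monom) = ks M \<union> ks N"
  by (auto simp: in_keys_iff lookup_add)

lemma mon_val_add: "mon_val h (M + N) = mon_val h M * mon_val h N"
proof -
  let ?A = "ks M \<union> ks N"
  have "mon_val h (M + N) = (\<Prod>v\<in>?A. h v ^ lk (M + N) v)"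
    by (rule mon_val_superset) (auto simp: ks_add_nat)
  also have "\<dots> = (\<Prod>v\<in>?A. h v ^ lk M v) * (\<Prod>v\<in>?A. h v ^ lk N v)"
    by (simp add: lookup_add power_add prod.distrib)
  also have "\<dots> = mon_val h M * mon_val h N"
    by (subst (1 2) mon_val_superset[of ?A]) auto
  finally show ?thesis .
qed

lemma mon_val_cong: "(\<And>v. v \<in> ks M \<Longrightarrow> h v = h' v) \<Longrightarrow> mon_val h M = mon_val h' M"
  unfolding mon_val_def by (rule prod.cong) auto

text \<open>Evaluation and substitution are the same construction, a homomorphism on coefficients
  extended by the images of the variables. Hence the target is an arbitrary commutative ring: the
  complex numbers in \<open>evl\<close>, the polynomials in \<open>sub\<close>.\<close>

locale coeff_hom =
  fixes \<kappa> :: "'a::comm_ring_1 \<Rightarrow> 'r::comm_ring_1"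
  assumes add: "\<kappa> (a + b) = \<kappa> a + \<kappa> b" and mult: "\<kappa> (a * b) = \<kappa> a * \<kappa> b"
    and one: "\<kappa> 1 = 1"
begin

definition ins :: "('v \<Rightarrow> 'r) \<Rightarrow> ('v monom \<Rightarrow>\<^sub>0 'a) \<Rightarrow> 'r" where
  "ins h p = (\<Sum>M\<in>ks p. \<kappa> (lk p M) * mon_val h M)"

lemma zero: "\<kappa> 0 = 0" using add[of 0 0] by simp

lemma ins_superset:
  assumes "finite A" "ks p \<subseteq> A"
  shows "ins h p = (\<Sum>M\<in>A. \<kappa> (lk p M) * mon_val h M)"
  unfolding ins_def
  by (rule sum.mono_neutral_left) (use assms in \<open>auto simp: in_keys_iff zero\<close>)

lemma ins_0: "ins h 0 = 0" by (simp add: ins_def)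

lemma ins_single: "ins h (sg M c) = \<kappa> c * mon_val h M"
  by (cases "c = 0") (simp_all add: ins_def zero)

lemma ins_add: "ins h (p + q) = ins h p + ins h q"
proof -
  let ?A = "ks p \<union> ks q"
  have "ins h (p + q) = (\<Sum>M\<in>?A. \<kappa> (lk (p + q) M) * mon_val h M)"
    by (rule ins_superset) (use keys_add[of p q] in auto)
  also have "\<dots> = (\<Sum>M\<in>?A. \<kappa> (lk p M) * mon_val h M) + (\<Sum>M\<in>?A. \<kappa> (lk q M) * mon_val h M)"
    by (simp add: lookup_add add distrib_right sum.distrib)
  also have "\<dots> = ins h p + ins h q"
    by (subst (1 2) ins_superset[of ?A]) auto
  finally show ?thesis .
qed

lemma ins_mult: "ins h (p * q) = ins h p * ins h q"
proof (induction p rule: poly_mapping_induct)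
  case (single M c)
  show ?case
  proof (induction q rule: poly_mapping_induct)
    case (single N d)
    show ?case by (simp add: mult_single ins_single mult mon_val_add mult_ac)
  next
    case (add p q) then show ?case by (simp add: ins_add distrib_left)
  qed
next
  case (add p q) then show ?case by (simp add: ins_add distrib_right)
qed

end

lemma const_0 [simp]: "const 0 = 0" and const_1 [simp]: "const 1 = 1"
  and const_add: "const (a + b) = const a + const b" and const_mult: "const (a * b) = const a * const b"
  by (simp_all add: const_def single_add mult_single)

lemma const_uminus: "const (- a) = - const a"
  by (simp add: const_def single_uminus)

interpretation sub: coeff_hom "const :: complex \<Rightarrow> 'v cpoly"
  by unfold_locales (simp_all add: const_add const_mult)

interpretation evl: coeff_hom "\<lambda>c::complex. c"
  by unfold_locales simp_all

lemma poly_subst_ins: "poly_subst = sub.ins"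
  by (intro ext) (simp add: poly_subst_def sub.ins_def mon_val_def)

lemma poly_eval_ins: "poly_eval = evl.ins"
  by (intro ext) (simp add: poly_eval_def evl.ins_def mon_val_def)

lemma var_single: "var v = sg (sg v 1) 1" by (simp add: var_def)

lemma poly_subst_0 [simp]: "poly_subst h 0 = 0"
  and poly_subst_add: "poly_subst h (p + q) = poly_subst h p + poly_subst h q"
  and poly_subst_mult: "poly_subst h (p * q) = poly_subst h p * poly_subst h q"
  and poly_subst_single: "poly_subst h (sg M c) = const c * mon_val h M"
  and poly_subst_const [simp]: "poly_subst h (const c) = const c"
  and poly_subst_var [simp]: "poly_subst h (var v) = h v"
  by (simp_all add: poly_subst_ins sub.ins_0 sub.ins_add sub.ins_mult sub.ins_single const_def var_single)

lemma poly_eval_0 [simp]: "poly_eval a 0 = 0"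
  and poly_eval_add: "poly_eval a (p + q) = poly_eval a p + poly_eval a q"
  and poly_eval_mult: "poly_eval a (p * q) = poly_eval a p * poly_eval a q"
  and poly_eval_const [simp]: "poly_eval a (const c) = c"
  and poly_eval_var [simp]: "poly_eval a (var v) = a v"
  by (simp_all add: poly_eval_ins evl.ins_0 evl.ins_add evl.ins_mult evl.ins_single const_def var_single)

lemma poly_eval_uminus: "poly_eval h (- p) = - poly_eval h p"
  using poly_eval_add[of h p "- p"] by (simp add: add_eq_0_iff2)
lemma poly_eval_diff: "poly_eval h (p - q) = poly_eval h p - poly_eval h q"
  using poly_eval_add[of h p "- q"] by (simp add: poly_eval_uminus)

lemma poly_subst_sum: "poly_subst h (\<Sum>i\<in>A. f i) = (\<Sum>i\<in>A. poly_subst h (f i))"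
  by (induction A rule: infinite_finite_induct) (simp_all add: poly_subst_add)
lemma poly_eval_sum: "poly_eval h (\<Sum>i\<in>A. f i) = (\<Sum>i\<in>A. poly_eval h (f i))"
  by (induction A rule: infinite_finite_induct) (simp_all add: poly_eval_add)

lemma sg_Suc_monom: "sg (sg v 1 + M) (c::complex) = var v * sg M c"
  by (simp add: var_single mult_single)

text \<open>Suited to derivatives and substitutions, whose behaviour on \<open>var v * p\<close> is
  simple while that on a whole monomial is not.\<close>

lemma cpoly_induct [case_names const var_mult add]:
  fixes p :: "'v cpoly"
  assumes c: "\<And>c. P (const c)" and v: "\<And>v p. P p \<Longrightarrow> P (var v * p)"
    and a: "\<And>p q. P p \<Longrightarrow> P q \<Longrightarrow> P (p + q)"
  shows "P p"
proof (induction p rule: poly_mapping_induct)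
  case (single M c)
  show ?case
  proof (induction M rule: monom_induct)
    case zero show ?case using c[of c] by (simp add: const_def)
  next
    case (add M v) then show ?case using v by (simp add: sg_Suc_monom del: One_nat_def)
  qed
next
  case (add p q) then show ?case by (rule a)
qed

lemma poly_subst_comp: "poly_subst h (poly_subst k p) = poly_subst (\<lambda>v. poly_subst h (k v)) p"
  by (induction p rule: cpoly_induct) (simp_all add: poly_subst_add poly_subst_mult)

lemma poly_eval_subst: "poly_eval a (poly_subst k p) = poly_eval (\<lambda>v. poly_eval a (k v)) p"
  by (induction p rule: cpoly_induct) (simp_all add: poly_subst_add poly_subst_mult poly_eval_add poly_eval_mult)

lemma poly_subst_cong:
  "(\<And>M v. M \<in> ks p \<Longrightarrow> v \<in> ks M \<Longrightarrow> h v = h' v) \<Longrightarrow> poly_subst h p = poly_subst h' p"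
  unfolding poly_subst_ins sub.ins_def by (intro sum.cong refl arg_cong2[where f="(*)"] mon_val_cong) auto

lemma poly_eval_cong:
  "(\<And>M v. M \<in> ks p \<Longrightarrow> v \<in> ks M \<Longrightarrow> h v = h' v) \<Longrightarrow> poly_eval h p = poly_eval h' p"
  unfolding poly_eval_ins evl.ins_def by (intro sum.cong refl arg_cong2[where f="(*)"] mon_val_cong) auto

lemma lk_const_mult [simp]: "lk (const c * p) M = c * lk p M"
proof (induction p rule: poly_mapping_induct)
  case (single N d) show ?case by (simp add: const_def mult_single lookup_single when_def)
next
  case (add p q) then show ?case by (simp add: distrib_left lookup_add)
qed

text \<open>Subtraction of exponents is truncated, so \<open>M - sg v 1\<close> undoes the addition
  of \<open>sg v 1\<close> only if \<open>v\<close> occurs in \<open>M\<close>; hence the case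
  distinction.\<close>

lemma lk_var_mult: "lk (var v * p) M = (if lk M v = 0 then 0 else lk p (M - sg v 1))"
proof (induction p rule: poly_mapping_induct)
  case (single N d)
  show ?case
  proof (cases "sg v 1 + N = M")
    case True
    then have "lk M v \<noteq> 0" "M - sg v 1 = N" by (auto simp: lookup_add)
    then show ?thesis using True by (simp add: var_single mult_single lookup_single when_def)
  next
    case False
    have "N \<noteq> M - sg v 1" if "lk M v \<noteq> 0"
    proof
      assume "N = M - sg v 1"
      then have "sg v 1 + N = M" using that
        by (auto intro!: poly_mapping_eqI simp: lookup_add lookup_minus lookup_single when_def)
      then show False using False by simp
    qed
    then show ?thesis using False by (auto simp: var_single mult_single lookup_single when_def)
  qed
next
  case (add p q) then show ?case by (simp add: distrib_left lookup_add)
qed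

section \<open>Weighted degrees and homogeneous polynomials\<close>

definition wdeg :: "('v \<Rightarrow> nat) \<Rightarrow> 'v monom \<Rightarrow> nat" where
  "wdeg w M = (\<Sum>v\<in>ks M. lk M v * w v)"

lemma wdeg_superset:
  assumes "finite A" "ks M \<subseteq> A"
  shows "wdeg w M = (\<Sum>v\<in>A. lk M v * w v)"
  unfolding wdeg_def
  by (rule sum.mono_neutral_left) (use assms in \<open>auto simp: in_keys_iff\<close>)

lemma wdeg_0 [simp]: "wdeg w 0 = 0" by (simp add: wdeg_def)
lemma wdeg_single [simp]: "wdeg w (sg v n) = n * w v" by (cases "n = 0") (simp_all add: wdeg_def)
lemma wdeg_add: "wdeg w (M + N) = wdeg w M + wdeg w N"
  by (subst (1 2 3) wdeg_superset[of "ks M \<union> ks N"])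
     (auto simp: ks_add_nat lookup_add distrib_right sum.distrib)

text \<open>The weight lets one notion cover the two partial degrees of a form, with weights 0 and 1
  on the two blocks, and the total degree of a polynomial in the coefficients of a form.\<close>

definition hom_forms :: "'v set \<Rightarrow> ('v \<Rightarrow> nat) \<Rightarrow> nat \<Rightarrow> 'v cpoly set" where
  "hom_forms X w d = {p. \<forall>M\<in>ks p. ks M \<subseteq> X \<and> wdeg w M = d}"

lemma hom_forms_0 [simp]: "0 \<in> hom_forms X w d" by (simp add: hom_forms_def)

lemma hom_forms_add: "p \<in> hom_forms X w d \<Longrightarrow> q \<in> hom_forms X w d \<Longrightarrow> p + q \<in> hom_forms X w d"
  unfolding hom_forms_def using keys_add[of p q] by blast

lemma hom_forms_sum: "(\<And>i. i \<in> A \<Longrightarrow> f i \<in> hom_forms X w d) \<Longrightarrow> (\<Sum>i\<in>A. f i) \<in> hom_forms X w d"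
  by (induction A rule: infinite_finite_induct) (auto intro: hom_forms_add)

lemma hom_forms_mult:
  assumes "p \<in> hom_forms X w d" "q \<in> hom_forms X w e"
  shows "p * q \<in> hom_forms X w (d + e)"
  unfolding hom_forms_def
proof safe
  fix M v assume "M \<in> ks (p * q)"
  with keys_mult[of p q] obtain a b where "M = a + b" "a \<in> ks p" "b \<in> ks q" by blast
  with assms show "wdeg w M = d + e" "\<And>v. v \<in> ks M \<Longrightarrow> v \<in> X"
    by (auto simp: hom_forms_def wdeg_add ks_add_nat)
qed

lemma hom_forms_const: "const c \<in> hom_forms X w 0"
  by (auto simp: hom_forms_def const_def split: if_splits)

lemma hom_forms_var: "v \<in> X \<Longrightarrow> var v \<in> hom_forms X w (w v)"
  by (auto simp: hom_forms_def var_single)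

lemma hom_forms_const_mult: "p \<in> hom_forms X w d \<Longrightarrow> const c * p \<in> hom_forms X w d"
  using hom_forms_mult[OF hom_forms_const] by fastforce

lemma hom_forms_subst:
  assumes h: "\<And>v. v \<in> X \<Longrightarrow> h v \<in> hom_forms Y u (w v)" and p: "p \<in> hom_forms X w d"
  shows "poly_subst h p \<in> hom_forms Y u d"
proof -
  have m: "mon_val h M \<in> hom_forms Y u (wdeg w M)" if "ks M \<subseteq> X" for M
    using that
  proof (induction M rule: monom_induct)
    case zero show ?case using hom_forms_const[of 1] by simp
  next
    case (add M v)
    have "v \<in> X" "ks M \<subseteq> X" using add.prems by (auto simp: ks_add_nat)
    then show ?case
      using hom_forms_mult[OF h add.IH] by (simp add: mon_val_add wdeg_add)
  qed
  show ?thesis unfolding poly_subst_ins sub.ins_def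
    by (intro hom_forms_sum hom_forms_const_mult) (use p m in \<open>auto simp: hom_forms_def[of X]\<close>)
qed

subsection \<open>Relations compatible with polynomial operations\<close>

text \<open>
  Specialisation along a place and passage to a limit are both of this kind: a family of numbers
  is related to its special value, compatibly with sums and products.
\<close>

locale ring_rel =
  fixes R :: "('a \<Rightarrow> complex) \<Rightarrow> complex \<Rightarrow> bool"
  assumes R_const: "R (\<lambda>_. c) c"
    and R_add: "R x c \<Longrightarrow> R y d \<Longrightarrow> R (\<lambda>s. x s + y s) (c + d)"
    and R_mult: "R x c \<Longrightarrow> R y d \<Longrightarrow> R (\<lambda>s. x s * y s) (c * d)"
begin

lemma R_uminus: "R x c \<Longrightarrow> R (\<lambda>s. - x s) (- c)"
  using R_mult[OF R_const[of "-1"]] by fastforce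

lemma R_diff: "R x c \<Longrightarrow> R y d \<Longrightarrow> R (\<lambda>s. x s - y s) (c - d)"
  using R_add[of x c "\<lambda>s. - y s" "- d"] R_uminus by simp

lemma R_sum: "(\<And>i. i \<in> A \<Longrightarrow> R (x i) (c i)) \<Longrightarrow> R (\<lambda>s. \<Sum>i\<in>A. x i s) (\<Sum>i\<in>A. c i)"
  by (induction A rule: infinite_finite_induct) (auto intro: R_add R_const)

lemma R_prod: "(\<And>i. i \<in> A \<Longrightarrow> R (x i) (c i)) \<Longrightarrow> R (\<lambda>s. \<Prod>i\<in>A. x i s) (\<Prod>i\<in>A. c i)"
  by (induction A rule: infinite_finite_induct) (auto intro: R_mult R_const)

lemma R_power: "R x c \<Longrightarrow> R (\<lambda>s. x s ^ n) (c ^ n)"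
  by (induction n) (auto intro: R_mult R_const)

lemma R_eval:
  assumes "\<And>M v. M \<in> ks p \<Longrightarrow> v \<in> ks M \<Longrightarrow> R (\<lambda>s. a s v) (a0 v)"
  shows "R (\<lambda>s. poly_eval (a s) p) (poly_eval a0 p)"
  unfolding poly_eval_def using assms by (intro R_sum R_mult R_const R_prod R_power) auto

lemma R_det:
  assumes "\<And>s. A s \<in> carrier_mat N N" "A0 \<in> carrier_mat N N"
    and "\<And>i j. i < N \<Longrightarrow> j < N \<Longrightarrow> R (\<lambda>s. A s $$ (i, j)) (A0 $$ (i, j))"
  shows "R (\<lambda>s. det (A s)) (det A0)"
proof -
  have e: "det A = (\<Sum>p\<in>{p. p permutes {0..<N}}. signof p * (\<Prod>i = 0..<N. A $$ (i, p i)))"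
    if "A \<in> carrier_mat N N" for A :: "complex mat" using that by (simp add: det_def)
  have "R (\<lambda>s. \<Sum>p\<in>{p. p permutes {0..<N}}. signof p * (\<Prod>i = 0..<N. A s $$ (i, p i)))
    (\<Sum>p\<in>{p. p permutes {0..<N}}. signof p * (\<Prod>i = 0..<N. A0 $$ (i, p i)))"
    by (intro R_sum R_mult R_prod R_const assms(3)) (auto simp: permutes_def dest!: permutes_in_image)
  then show ?thesis using assms by (simp add: e)
qed

text \<open>The entries of the adjugate are, up to sign, minors and thus polynomial in the entries
  of the matrix. On \<open>SL\<close> the adjugate is the inverse, so inverses pass through such
  relations as well.\<close>

lemma R_adj:
  assumes "\<And>s. A s \<in> carrier_mat N N" "A0 \<in> carrier_mat N N"
    and "\<And>i j. i < N \<Longrightarrow> j < N \<Longrightarrow> R (\<lambda>s. A s $$ (i, j)) (A0 $$ (i, j))"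
    and ij: "i < N" "j < N"
  shows "R (\<lambda>s. adj_mat (A s) $$ (i, j)) (adj_mat A0 $$ (i, j))"
proof -
  have e: "adj_mat A $$ (i, j) = (- 1) ^ (j + i) * det (mat_delete A j i)" if "A \<in> carrier_mat N N" for A :: "complex mat"
    using that ij by (simp add: adj_mat_def cofactor_def)
  have d: "dim_row (A s) = N" "dim_col (A s) = N" "dim_row A0 = N" "dim_col A0 = N" for s
    using assms(1)[of s] assms(2) by auto
  have "R (\<lambda>s. (- 1) ^ (j + i) * det (mat_delete (A s) j i)) ((- 1) ^ (j + i) * det (mat_delete A0 j i))"
    by (intro R_mult R_const R_det[where N="N - 1"])
       (use assms in \<open>auto simp: mat_delete_def d intro!: mat_delete_carrier\<close>)
  then show ?thesis unfolding e[OF assms(1)] e[OF assms(2)] .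
qed

lemma R_matmult:
  assumes "\<And>s. A s \<in> carrier_mat N N" "A0 \<in> carrier_mat N N"
    and "\<And>s. B s \<in> carrier_mat N N" "B0 \<in> carrier_mat N N"
    and "\<And>i j. i < N \<Longrightarrow> j < N \<Longrightarrow> R (\<lambda>s. A s $$ (i, j)) (A0 $$ (i, j))"
    and "\<And>i j. i < N \<Longrightarrow> j < N \<Longrightarrow> R (\<lambda>s. B s $$ (i, j)) (B0 $$ (i, j))"
    and ij: "i < N" "j < N"
  shows "R (\<lambda>s. (A s * B s) $$ (i, j)) ((A0 * B0) $$ (i, j))"
proof -
  have e: "(A * B) $$ (i, j) = (\<Sum>k = 0..<N. A $$ (i, k) * B $$ (k, j))"
    if "A \<in> carrier_mat N N" "B \<in> carrier_mat N N" for A B :: "complex mat"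
    using that ij by (simp add: scalar_prod_def)
  have "R (\<lambda>s. \<Sum>k = 0..<N. A s $$ (i, k) * B s $$ (k, j)) (\<Sum>k = 0..<N. A0 $$ (i, k) * B0 $$ (k, j))"
    by (intro R_sum R_mult assms) (use ij in auto)
  then show ?thesis unfolding e[OF assms(1,3)] e[OF assms(2,4)] .
qed

definition frel :: "('a \<Rightarrow> 'v cpoly) \<Rightarrow> 'v cpoly \<Rightarrow> bool" where
  "frel P p \<longleftrightarrow> (\<forall>M. R (\<lambda>s. lk (P s) M) (lk p M))"

lemma frel_const: "frel (\<lambda>_. p) p" by (simp add: frel_def R_const)

lemma frel_add: "frel P p \<Longrightarrow> frel Q q \<Longrightarrow> frel (\<lambda>s. P s + Q s) (p + q)"
  by (simp add: frel_def lookup_add R_add)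

lemma frel_sum: "(\<And>i. i \<in> A \<Longrightarrow> frel (P i) (p i)) \<Longrightarrow> frel (\<lambda>s. \<Sum>i\<in>A. P i s) (\<Sum>i\<in>A. p i)"
  by (induction A rule: infinite_finite_induct) (auto intro: frel_add frel_const)

lemma frel_const_mult: "R x c \<Longrightarrow> frel P p \<Longrightarrow> frel (\<lambda>s. const (x s) * P s) (const c * p)"
  by (simp add: frel_def R_mult)

lemma frel_var_mult: "frel P p \<Longrightarrow> frel (\<lambda>s. var v * P s) (var v * p)"
  by (auto simp: frel_def lk_var_mult R_const)

text \<open>A substituted monomial is a product of linear forms, built up one variable at a time;
  each factor only combines shifted coefficients linearly. The bound on the supports lets all sums
  run over the fixed finite set \<open>ks p\<close>.\<close>

lemma frel_subst_linear:
  assumes l: "\<And>v. v \<in> X \<Longrightarrow> \<exists>x c. h0 v = (\<Sum>j\<in>Y v. const (c j) * var (g v j)) \<and>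
      (\<forall>s. h s v = (\<Sum>j\<in>Y v. const (x s j) * var (g v j))) \<and> (\<forall>j\<in>Y v. R (\<lambda>s. x s j) (c j))"
    and X: "\<And>M. M \<in> ks p \<Longrightarrow> ks M \<subseteq> X" and P: "frel P p" "\<And>s. ks (P s) \<subseteq> ks p"
  shows "frel (\<lambda>s. poly_subst (h s) (P s)) (poly_subst h0 p)"
proof -
  have m: "frel (\<lambda>s. mon_val (h s) M) (mon_val h0 M)" if "ks M \<subseteq> X" for M
    using that
  proof (induction M rule: monom_induct)
    case zero show ?case by (simp add: frel_const)
  next
    case (add M v)
    have v: "v \<in> X" "ks M \<subseteq> X" using add.prems by (auto simp: ks_add_nat)
    from l[OF v(1)] obtain x c where xc: "h0 v = (\<Sum>j\<in>Y v. const (c j) * var (g v j))"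
      "\<And>s. h s v = (\<Sum>j\<in>Y v. const (x s j) * var (g v j))" "\<And>j. j \<in> Y v \<Longrightarrow> R (\<lambda>s. x s j) (c j)"
      by blast
    show ?case unfolding mon_val_add
      by (simp add: xc sum_distrib_right mult.assoc)
         (intro frel_sum frel_const_mult frel_var_mult xc add.IH v)
  qed
  have e: "poly_subst (h s) (P s) = (\<Sum>M\<in>ks p. const (lk (P s) M) * mon_val (h s) M)" for s
    unfolding poly_subst_ins by (rule sub.ins_superset) (use P in auto)
  show ?thesis
    unfolding e unfolding poly_subst_ins sub.ins_def
    by (intro frel_sum frel_const_mult m X) (use P in \<open>auto simp: frel_def\<close>)
qed

end

section \<open>The group action\<close>

definition coords :: "nat \<Rightarrow> nat \<Rightarrow> coord set" where
  "coords m n = Inl ` {..m} \<union> Inr ` {..n}"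

lemma finite_coords [simp]: "finite (coords m n)" by (simp add: coords_def)

lemma sum_coords: "(\<Sum>v\<in>coords m n. f v) = (\<Sum>i\<le>m. f (Inl i)) + (\<Sum>j\<le>n. f (Inr j))"
  unfolding coords_def by (subst sum.union_disjoint) (auto simp: sum.reindex)

lemma prod_coords: "(\<Prod>v\<in>coords m n. f v) = (\<Prod>i\<le>m. f (Inl i)) * (\<Prod>j\<le>n. f (Inr j))"
  unfolding coords_def by (subst prod.union_disjoint) (auto simp: prod.reindex)

lemma Xi_iff: "I \<in> Xi m n k l \<longleftrightarrow> ks I \<subseteq> coords m n \<and>
    wdeg (case_sum (\<lambda>_. 1) (\<lambda>_. 0)) I = k \<and> wdeg (case_sum (\<lambda>_. 0) (\<lambda>_. 1)) I = l"
proof (cases "ks I \<subseteq> coords m n")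
  case True
  note w = wdeg_superset[OF finite_coords True]
  show ?thesis using True by (simp add: w sum_coords Xi_def) (simp add: coords_def)
next
  case False then show ?thesis by (simp add: Xi_def coords_def)
qed

lemma bihom_forms_hom: "bihom_forms m n k l =
    hom_forms (coords m n) (case_sum (\<lambda>_. 1) (\<lambda>_. 0)) k \<inter> hom_forms (coords m n) (case_sum (\<lambda>_. 0) (\<lambda>_. 1)) l"
  by (auto simp: bihom_forms_def hom_forms_def Xi_iff subset_iff)

lemma sections_hom: "sections m n k l d = hom_forms (Xi m n k l) (\<lambda>_. 1) d"
  by (auto simp: sections_def hom_forms_def wdeg_def)

lemma finite_Xi: "finite (Xi m n k l)"
proof -
  let ?F = "{f. \<forall>v. (v \<in> coords m n \<longrightarrow> f v \<in> {..max k l}) \<and> (v \<notin> coords m n \<longrightarrow> f v = (0::nat))}"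
  have "finite ?F" 
    using finite_set_of_finite_funs[of "coords m n" "{..max k l}" 0] by simp
  moreover have "lk ` Xi m n k l \<subseteq> ?F"
  proof (rule image_subsetI)
    fix I assume I: "I \<in> Xi m n k l"
    have 1: "lk I (Inl i) \<le> k" if "i \<le> m" for i
      using I member_le_sum[of i "{..m}" "\<lambda>i. lk I (Inl i)"] that by (auto simp: Xi_def)
    have 2: "lk I (Inr i) \<le> l" if "i \<le> n" for i
      using I member_le_sum[of i "{..n}" "\<lambda>i. lk I (Inr i)"] that by (auto simp: Xi_def)
    have "lk I v \<le> max k l" if "v \<in> coords m n" for v
      using that 1 2 by (auto simp: coords_def le_max_iff_disj)
    moreover have "lk I v = 0" if "v \<notin> coords m n" for v
      using that I by (auto simp: Xi_def coords_def in_keys_iff)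
    ultimately show "lk I \<in> ?F" by auto
  qed
  ultimately have "finite (lk ` Xi m n k l)" using finite_subset by blast
  then show ?thesis by (rule finite_imageD) (simp add: inj_on_def lookup_inject)
qed

text \<open>The action with the inverses left out. Inversion permutes \<open>SL\<close>, so orbits
  can be described by \<open>sbst\<close> just as well as by \<open>act\<close>.\<close>

definition sbst :: "complex mat \<Rightarrow> complex mat \<Rightarrow> form \<Rightarrow> form" where
  "sbst A B F = poly_subst (lin_change A B) F"

lemma sbst_bihom:
  assumes "A \<in> carrier_mat (m + 1) (m + 1)" "B \<in> carrier_mat (n + 1) (n + 1)" "F \<in> bihom_forms m n k l"
  shows "sbst A B F \<in> bihom_forms m n k l"
proof -
  have "lin_change A B v \<in> hom_forms (coords m n) w (w v)"
    if "v \<in> coords m n" "w = case_sum (\<lambda>_. a) (\<lambda>_. b)" for v w a b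
  proof (cases v)
    case (Inl i)
    have "var (Inl j) \<in> hom_forms (coords m n) w (w v)" if "j < m + 1" for j
      using hom_forms_var[of "Inl j" "coords m n" w] that \<open>w = _\<close> by (auto simp: coords_def Inl)
    then show ?thesis using assms(1) by (auto simp: Inl simp del: sum.lessThan_Suc intro!: hom_forms_sum hom_forms_const_mult)
  next
    case (Inr i)
    have "var (Inr j) \<in> hom_forms (coords m n) w (w v)" if "j < n + 1" for j
      using hom_forms_var[of "Inr j" "coords m n" w] that \<open>w = _\<close> by (auto simp: coords_def Inr)
    then show ?thesis using assms(2) by (auto simp: Inr simp del: sum.lessThan_Suc intro!: hom_forms_sum hom_forms_const_mult)
  qed
  with assms(3) show ?thesis unfolding bihom_forms_hom sbst_def
    by (auto intro!: hom_forms_subst[where X="coords m n"])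
qed

lemma sbst_const_mult: "sbst A B (const c * F) = const c * sbst A B F" by (simp add: sbst_def poly_subst_mult)

lemma bihom_coords: "F \<in> bihom_forms m n k l \<Longrightarrow> M \<in> ks F \<Longrightarrow> ks M \<subseteq> coords m n"
  by (auto simp: bihom_forms_hom hom_forms_def)

text \<open>Substitution is a right action: putting \<open>A x\<close> for \<open>x\<close> in
  \<open>F (C x)\<close> gives \<open>F (C A x)\<close>, so the matrices appear in reverse
  order.\<close>

lemma sbst_comp:
  assumes "A \<in> carrier_mat (m + 1) (m + 1)" "B \<in> carrier_mat (n + 1) (n + 1)"
    and "C \<in> carrier_mat (m + 1) (m + 1)" "D \<in> carrier_mat (n + 1) (n + 1)"
    and F: "F \<in> bihom_forms m n k l"
  shows "sbst A B (sbst C D F) = sbst (C * A) (D * B) F"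
  unfolding sbst_def poly_subst_comp
proof (rule poly_subst_cong)
  have aux: "(\<Sum>j<N. const (C $$ (i, j)) * (\<Sum>k<N. const (A $$ (j, k)) * var (f k))) =
      (\<Sum>k<N. const ((C * A) $$ (i, k)) * (var (f k) :: form))"
    if "C \<in> carrier_mat N N" "A \<in> carrier_mat N N" "i < N" for A C :: "complex mat" and N i and f :: "nat \<Rightarrow> coord"
  proof -
    have "(\<Sum>j<N. const (C $$ (i, j)) * (\<Sum>k<N. const (A $$ (j, k)) * var (f k))) =
        (\<Sum>j<N. \<Sum>k<N. const (C $$ (i, j) * A $$ (j, k)) * (var (f k) :: form))"
      by (simp add: sum_distrib_left const_mult mult.assoc)
    also have "\<dots> = (\<Sum>k<N. \<Sum>j<N. const (C $$ (i, j) * A $$ (j, k)) * (var (f k) :: form))"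
      by (rule sum.swap)
    also have "\<dots> = (\<Sum>k<N. const (\<Sum>j<N. C $$ (i, j) * A $$ (j, k)) * (var (f k) :: form))"
    proof -
      have "(const (\<Sum>j\<in>S. x j) :: form) = (\<Sum>j\<in>S. const (x j))" for S :: "nat set" and x
        by (induction S rule: infinite_finite_induct) (simp_all add: const_add)
      from this[of _ "{..<N}"] show ?thesis by (simp add: sum_distrib_right)
    qed
    also have "\<dots> = (\<Sum>k<N. const ((C * A) $$ (i, k)) * (var (f k) :: form))"
      using that by (intro sum.cong refl) (simp add: scalar_prod_def atLeast0LessThan)
    finally show ?thesis .
  qed
  fix M v assume "M \<in> ks F" "v \<in> ks M"
  with bihom_coords[OF F] have "v \<in> coords m n" by blast
  then show "poly_subst (lin_change A B) (lin_change C D v) = lin_change (C * A) (D * B) v"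
  proof (cases v)
    case (Inl i)
    with \<open>v \<in> coords m n\<close> have "i < m + 1" by (auto simp: coords_def)
    with aux[of C "m + 1" A i Inl] assms show ?thesis
      by (simp add: Inl poly_subst_sum poly_subst_mult del: sum.lessThan_Suc index_mult_mat(1))
  next
    case (Inr i)
    with \<open>v \<in> coords m n\<close> have "i < n + 1" by (auto simp: coords_def)
    with aux[of D "n + 1" B i Inr] assms show ?thesis
      by (simp add: Inr poly_subst_sum poly_subst_mult del: sum.lessThan_Suc index_mult_mat(1))
  qed
qed

lemma lk_scale: "lk (poly_subst (\<lambda>v. const (D v) * var v) p) I = mon_val D I * lk p I"
proof (induction p rule: poly_mapping_induct)
  case (single M c)
  have "mon_val (\<lambda>v. const (D v) * var v) M = const (mon_val D M) * sg M 1"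
  proof (induction M rule: monom_induct)
    case zero show ?case by (simp add: single_one)
  next
    case (add M v)
    then show ?case
      by (simp add: mon_val_add const_mult sg_Suc_monom mult_ac del: One_nat_def)
  qed
  then show ?case by (simp add: poly_subst_single lookup_single when_def)
next
  case (add p q) then show ?case by (simp add: poly_subst_add lookup_add distrib_left)
qed

text \<open>Diagonal matrices act on each coefficient by the character of its monomial. This is the
  source of all weights in the sequel.\<close>

lemma lk_sbst_diag:
  assumes F: "F \<in> bihom_forms m n k l"
  shows "lk (sbst (mat_diag (m + 1) d) (mat_diag (n + 1) e) F) I = mon_val (case_sum d e) I * lk F I"
proof -
  have "sbst (mat_diag (m + 1) d) (mat_diag (n + 1) e) F =
      poly_subst (\<lambda>v. const (case_sum d e v) * var v) F"
    unfolding sbst_def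
  proof (rule poly_subst_cong)
    have aux: "(\<Sum>j<N. const (mat_diag N d $$ (i, j)) * var (f j)) = const (d i) * (var (f i) :: form)"
      if "i < N" for N i d and f :: "nat \<Rightarrow> coord"
    proof -
      have "(\<Sum>j<N. const (mat_diag N d $$ (i, j)) * var (f j)) =
          (\<Sum>j<N. if j = i then const (d i) * (var (f i) :: form) else 0)"
        by (rule sum.cong) (use that in \<open>auto simp: mat_diag_def\<close>)
      then show ?thesis using that by simp
    qed
    fix M v assume "M \<in> ks F" "v \<in> ks M"
    with bihom_coords[OF F] have "v \<in> coords m n" by blast
    then show "lin_change (mat_diag (m + 1) d) (mat_diag (n + 1) e) v = const (case_sum d e v) * var v"
    proof (cases v)
      case (Inl i)
      with \<open>v \<in> coords m n\<close> have "i < m + 1" by (auto simp: coords_def)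
      with aux[of i "m + 1" d Inl] show ?thesis by (simp add: Inl mat_diag_def)
    next
      case (Inr i)
      with \<open>v \<in> coords m n\<close> have "i < n + 1" by (auto simp: coords_def)
      with aux[of i "n + 1" e Inr] show ?thesis by (simp add: Inr mat_diag_def)
    qed
  qed
  then show ?thesis by (simp add: lk_scale)
qed

lemma sbst_one: "F \<in> bihom_forms m n k l \<Longrightarrow> sbst (1\<^sub>m (m + 1)) (1\<^sub>m (n + 1)) F = F"
proof (rule poly_mapping_eqI)
  fix I assume F: "F \<in> bihom_forms m n k l"
  have "mat_diag N (\<lambda>_. 1) = (1\<^sub>m N :: complex mat)" for N by (auto simp: mat_diag_def)
  with lk_sbst_diag[OF F, of "\<lambda>_. 1" "\<lambda>_. 1" I]
  show "lk (sbst (1\<^sub>m (m + 1)) (1\<^sub>m (n + 1)) F) I = lk F I"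
    by (simp add: mon_val_def split: sum.split)
qed

section \<open>Inverses in the special linear group\<close>

lemma SL_carrier: "A \<in> SL N \<Longrightarrow> A \<in> carrier_mat N N" by (simp add: SL_def)
lemma SL_mult: "A \<in> SL N \<Longrightarrow> B \<in> SL N \<Longrightarrow> A * B \<in> SL N"
  using det_mult[of A N B] by (auto simp: SL_def intro: mult_carrier_mat)
lemma SL_one: "1\<^sub>m N \<in> SL N" by (simp add: SL_def)
lemma SL_adj:
  assumes "A \<in> SL N"
  shows "adj_mat A \<in> SL N" "A * adj_mat A = 1\<^sub>m N" "adj_mat A * A = 1\<^sub>m N"
proof -
  have A: "A \<in> carrier_mat N N" "det A = 1" using assms by (auto simp: SL_def)
  show 1: "A * adj_mat A = 1\<^sub>m N" "adj_mat A * A = 1\<^sub>m N"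
    using adj_mat(2,3)[OF A(1)] A(2) by auto
  have "det (A * adj_mat A) = 1" using 1 by simp
  then show "adj_mat A \<in> SL N" using det_mult[OF A(1) adj_mat(1)[OF A(1)]] A adj_mat(1)[OF A(1)]
    by (simp add: SL_def)
qed

lemma mat_inverse_unique:
  assumes "A * C = 1\<^sub>m N" "C' * A = 1\<^sub>m N" "A \<in> carrier_mat N N" "C \<in> carrier_mat N N" "C' \<in> carrier_mat N N"
  shows "C = (C' :: complex mat)"
proof -
  have "C' = C' * (A * C)" using assms by simp
  also have "\<dots> = C" unfolding assoc_mult_mat[OF assms(5,3,4), symmetric] using assms by simp
  finally show ?thesis by simp
qed

lemma SL_adj_adj:
  assumes A: "A \<in> SL N"
  shows "adj_mat (adj_mat A) = A"
proof -
  note 1 = SL_adj[OF A]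
  note 2 = SL_adj[OF 1(1)]
  show ?thesis
    by (rule mat_inverse_unique[OF 2(2) 1(2) SL_carrier[OF 1(1)] SL_carrier[OF 2(1)] SL_carrier[OF A]])
qed

text \<open>Elimination cannot fail on a matrix with a two-sided inverse, and inverses are unique.
  From here on the inverse is the adjugate, which unlike the result of elimination is visibly
  polynomial in the entries.\<close>

lemma SL_mat_inverse:
  assumes A: "A \<in> SL N"
  shows "the (mat_inverse A) = adj_mat A"
proof (cases "mat_inverse A")
  case None
  have "A \<in> Units (ring_mat TYPE(complex) N ())"
    unfolding Units_def
    using SL_adj(2,3)[OF A] SL_carrier[OF A] SL_carrier[OF SL_adj(1)[OF A]]
    by (auto simp: ring_mat_simps intro!: bexI[of _ "adj_mat A"])
  with mat_inverse(1)[OF SL_carrier[OF A] None, of "()"] show ?thesis by simp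
next
  case (Some B)
  from mat_inverse(2)[OF SL_carrier[OF A] Some]
  have B: "A * B = 1\<^sub>m N" "B * A = 1\<^sub>m N" "B \<in> carrier_mat N N" by auto
  have "B = adj_mat A"
    by (rule mat_inverse_unique[OF B(1) SL_adj(3)[OF A] SL_carrier[OF A] B(3) SL_carrier[OF SL_adj(1)[OF A]]])
  with Some show ?thesis by simp
qed

lemma act_sbst: "A \<in> SL (m + 1) \<Longrightarrow> B \<in> SL (n + 1) \<Longrightarrow> act (A, B) F = sbst (adj_mat A) (adj_mat B) F"
  by (simp only: act.simps sbst_def SL_mat_inverse)

lemma sbst_act: "A \<in> SL (m + 1) \<Longrightarrow> B \<in> SL (n + 1) \<Longrightarrow> sbst A B F = act (adj_mat A, adj_mat B) F"
  using act_sbst[OF SL_adj(1) SL_adj(1), of A m B n F] SL_adj_adj[of A] SL_adj_adj[of B] by simp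

text \<open>On \<open>SL\<close> the map \<open>adj_mat\<close> is an involution, so
  \<open>act g F\<close> and \<open>sbst A B F\<close> run over the same orbit.\<close>

lemma ball_act: "(\<forall>g\<in>grp m n. P (act g F)) \<longleftrightarrow> (\<forall>A\<in>SL (m + 1). \<forall>B\<in>SL (n + 1). P (sbst A B F))"
proof (intro iffI ballI)
  fix A B assume *: "\<forall>g\<in>grp m n. P (act g F)" "A \<in> SL (m + 1)" "B \<in> SL (n + 1)"
  have "(adj_mat A, adj_mat B) \<in> grp m n" using SL_adj(1)[OF *(2)] SL_adj(1)[OF *(3)] by (simp add: grp_def)
  with *(1) show "P (sbst A B F)" unfolding sbst_act[OF *(2,3)] by (rule bspec)
next
  fix g assume *: "\<forall>A\<in>SL (m + 1). \<forall>B\<in>SL (n + 1). P (sbst A B F)" "g \<in> grp m n"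
  obtain A B where g: "g = (A, B)" "A \<in> SL (m + 1)" "B \<in> SL (n + 1)" using *(2) by (auto simp: grp_def)
  show "P (act g F)" unfolding g act_sbst[OF g(2,3)] using *(1) SL_adj(1)[OF g(2)] SL_adj(1)[OF g(3)] by blast
qed

lemma bex_act: "(\<exists>g\<in>grp m n. P (act g F)) \<longleftrightarrow> (\<exists>A\<in>SL (m + 1). \<exists>B\<in>SL (n + 1). P (sbst A B F))"
  using ball_act[of m n "\<lambda>F. \<not> P F" F] by blast

lemma act_bihom: "g \<in> grp m n \<Longrightarrow> F \<in> bihom_forms m n k l \<Longrightarrow> act g F \<in> bihom_forms m n k l"
  using ball_act[of m n "\<lambda>G. G \<in> bihom_forms m n k l" F] sbst_bihom SL_carrier by meson

context ring_rel
begin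

lemma frel_sbst:
  assumes "\<And>s. A s \<in> carrier_mat (m + 1) (m + 1)" "A0 \<in> carrier_mat (m + 1) (m + 1)"
    and "\<And>s. B s \<in> carrier_mat (n + 1) (n + 1)" "B0 \<in> carrier_mat (n + 1) (n + 1)"
    and A: "\<And>i j. i < m + 1 \<Longrightarrow> j < m + 1 \<Longrightarrow> R (\<lambda>s. A s $$ (i, j)) (A0 $$ (i, j))"
    and B: "\<And>i j. i < n + 1 \<Longrightarrow> j < n + 1 \<Longrightarrow> R (\<lambda>s. B s $$ (i, j)) (B0 $$ (i, j))"
    and F: "F \<in> bihom_forms m n k l" "frel G F" "\<And>s. ks (G s) \<subseteq> ks F"
  shows "frel (\<lambda>s. sbst (A s) (B s) (G s)) (sbst A0 B0 F)"
proof -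
  have d: "dim_col (A s) = m + 1" "dim_col A0 = m + 1" "dim_col (B s) = n + 1" "dim_col B0 = n + 1" for s
    using assms(1)[of s] assms(3)[of s] assms(2,4) by auto
  show ?thesis unfolding sbst_def
  proof (rule frel_subst_linear[where X="coords m n" and Y="case_sum (\<lambda>_. {..<m + 1}) (\<lambda>_. {..<n + 1})"
        and g="case_sum (\<lambda>_. Inl) (\<lambda>_. Inr)"])
    fix v assume v: "v \<in> coords m n"
    show "\<exists>x c. lin_change A0 B0 v = (\<Sum>j\<in>case_sum (\<lambda>_. {..<m + 1}) (\<lambda>_. {..<n + 1}) v. const (c j) * var (case_sum (\<lambda>_. Inl) (\<lambda>_. Inr) v j)) \<and>
       (\<forall>s. lin_change (A s) (B s) v = (\<Sum>j\<in>case_sum (\<lambda>_. {..<m + 1}) (\<lambda>_. {..<n + 1}) v. const (x s j) * var (case_sum (\<lambda>_. Inl) (\<lambda>_. Inr) v j))) \<and>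
       (\<forall>j\<in>case_sum (\<lambda>_. {..<m + 1}) (\<lambda>_. {..<n + 1}) v. R (\<lambda>s. x s j) (c j))"
    proof (cases v)
      case (Inl i)
      with v have "i < m + 1" by (auto simp: coords_def)
      with A show ?thesis unfolding Inl
        by (intro exI[of _ "\<lambda>s j. A s $$ (i, j)"] exI[of _ "\<lambda>j. A0 $$ (i, j)"]) (simp add: d del: One_nat_def)
    next
      case (Inr i)
      with v have "i < n + 1" by (auto simp: coords_def)
      with B show ?thesis unfolding Inr
        by (intro exI[of _ "\<lambda>s j. B s $$ (i, j)"] exI[of _ "\<lambda>j. B0 $$ (i, j)"]) (simp add: d del: One_nat_def)
    qed
  qed (use F bihom_coords[OF F(1)] in auto)
qed

end

section \<open>Apolar inner products and invariants\<close>

text \<open>The squared norm of a monomial. The factorials make differentiation adjoint to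
  multiplication, and \<open>\<omega>\<close> gives each variable its own norm. The latter is needed
  for functions on the space of forms, whose variables stand for monomials of different
  norms.\<close>

definition apolar_weight :: "('v \<Rightarrow> real) \<Rightarrow> 'v monom \<Rightarrow> real" where
  "apolar_weight \<omega> M = (\<Prod>v\<in>ks M. fact (lk M v) * \<omega> v ^ lk M v)"

lemma apolar_weight_superset: "finite S \<Longrightarrow> ks M \<subseteq> S \<Longrightarrow> apolar_weight \<omega> M = (\<Prod>v\<in>S. fact (lk M v) * \<omega> v ^ lk M v)"
  unfolding apolar_weight_def by (rule prod.mono_neutral_left) (auto simp: in_keys_iff)

lemma apolar_weight_0 [simp]: "apolar_weight \<omega> 0 = 1" by (simp add: apolar_weight_def)

lemma apolar_weight_pos: "(\<And>v. \<omega> v > 0) \<Longrightarrow> apolar_weight \<omega> M > 0"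
  unfolding apolar_weight_def by (rule prod_pos) simp

lemma apolar_weight_add: "apolar_weight \<omega> (sg v 1 + M) = (real (lk M v) + 1) * \<omega> v * apolar_weight \<omega> M"
proof -
  let ?S = "insert v (ks M)"
  have "apolar_weight \<omega> (sg v 1 + M) = (\<Prod>u\<in>?S. fact (lk (sg v 1 + M) u) * \<omega> u ^ lk (sg v 1 + M) u)"
    by (rule apolar_weight_superset) (auto simp: ks_add_nat)
  also have "\<dots> = (fact (lk M v + 1) * \<omega> v ^ (lk M v + 1)) * (\<Prod>u\<in>?S - {v}. fact (lk M u) * \<omega> u ^ lk M u)"
    by (subst prod.remove[of _ v]) (auto simp: lookup_add lookup_single when_def intro!: prod.cong)
  also have "\<dots> = (real (lk M v) + 1) * \<omega> v * (\<Prod>u\<in>?S. fact (lk M u) * \<omega> u ^ lk M u)"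
    by (subst (2) prod.remove[of _ v]) (auto simp: algebra_simps)
  also have "(\<Prod>u\<in>?S. fact (lk M u) * \<omega> u ^ lk M u) = apolar_weight \<omega> M"
    by (rule apolar_weight_superset[symmetric]) auto
  finally show ?thesis .
qed

text \<open>
  With weights 1 this is the apolar inner product, for which multiplication by a variable is adjoint
  to differentiation; hence substitution of linear forms is adjoint to substitution by the conjugate
  transpose.
\<close>

definition apolar :: "('v \<Rightarrow> real) \<Rightarrow> 'v cpoly \<Rightarrow> 'v cpoly \<Rightarrow> complex" where
  "apolar \<omega> p q = (\<Sum>M\<in>ks p. lk p M * cnj (lk q M) * of_real (apolar_weight \<omega> M))"

lemma apolar_superset: "finite S \<Longrightarrow> ks p \<subseteq> S \<Longrightarrow> apolar \<omega> p q = (\<Sum>M\<in>S. lk p M * cnj (lk q M) * of_real (apolar_weight \<omega> M))"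
  unfolding apolar_def by (rule sum.mono_neutral_left) (auto simp: in_keys_iff)

lemma apolar_add_left: "apolar \<omega> (p + p') q = apolar \<omega> p q + apolar \<omega> p' q"
proof -
  let ?S = "ks p \<union> ks p'"
  have "apolar \<omega> (p + p') q = (\<Sum>M\<in>?S. lk (p + p') M * cnj (lk q M) * of_real (apolar_weight \<omega> M))"
    by (rule apolar_superset) (use keys_add[of p p'] in auto)
  then show ?thesis
    by (subst (1 2) apolar_superset[of ?S]) (auto simp: lookup_add algebra_simps sum.distrib)
qed

lemma apolar_add_right: "apolar \<omega> p (q + q') = apolar \<omega> p q + apolar \<omega> p q'"
  by (simp add: apolar_def lookup_add algebra_simps sum.distrib)

lemma apolar_const_left: "apolar \<omega> (const c * p) q = c * apolar \<omega> p q"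
proof -
  have "apolar \<omega> (const c * p) q = (\<Sum>M\<in>ks p. lk (const c * p) M * cnj (lk q M) * of_real (apolar_weight \<omega> M))"
    by (rule apolar_superset) (auto simp: in_keys_iff)
  then show ?thesis by (simp add: apolar_def sum_distrib_left mult.assoc)
qed

lemma apolar_const_right: "apolar \<omega> p (const c * q) = cnj c * apolar \<omega> p q"
  by (simp add: apolar_def sum_distrib_left) (simp add: mult_ac)

lemma apolar_0_left [simp]: "apolar \<omega> 0 q = 0" by (simp add: apolar_def)
lemma apolar_0_right [simp]: "apolar \<omega> q 0 = 0" by (simp add: apolar_def)

lemma apolar_uminus_left: "apolar \<omega> (- p) q = - apolar \<omega> p q"
  using apolar_add_left[of \<omega> p "- p" q] by (simp add: add_eq_0_iff2)
lemma apolar_diff_left: "apolar \<omega> (p - p') q = apolar \<omega> p q - apolar \<omega> p' q"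
  using apolar_add_left[of \<omega> p "- p'" q] by (simp add: apolar_uminus_left)

lemma apolar_sum_left: "apolar \<omega> (\<Sum>i\<in>S. f i) q = (\<Sum>i\<in>S. apolar \<omega> (f i) q)"
  by (induction S rule: infinite_finite_induct) (simp_all add: apolar_add_left)
lemma apolar_sum_right: "apolar \<omega> q (\<Sum>i\<in>S. f i) = (\<Sum>i\<in>S. apolar \<omega> q (f i))"
  by (induction S rule: infinite_finite_induct) (simp_all add: apolar_add_right)

lemma apolar_cnj: "apolar \<omega> q p = cnj (apolar \<omega> p q)"
proof -
  let ?S = "ks p \<union> ks q"
  have "apolar \<omega> q p = (\<Sum>M\<in>?S. lk q M * cnj (lk p M) * of_real (apolar_weight \<omega> M))" by (rule apolar_superset) auto
  moreover have "apolar \<omega> p q = (\<Sum>M\<in>?S. lk p M * cnj (lk q M) * of_real (apolar_weight \<omega> M))" by (rule apolar_superset) auto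
  ultimately show ?thesis by (simp add: mult_ac)
qed

lemma apolar_self: "apolar \<omega> p p = of_real (\<Sum>M\<in>ks p. (norm (lk p M))\<^sup>2 * apolar_weight \<omega> M)"
  by (simp add: apolar_def complex_norm_square[symmetric])

lemma apolar_self_eq_0:
  assumes "\<And>v. \<omega> v > 0" "apolar \<omega> p p = 0"
  shows "p = 0"
proof (rule ccontr)
  assume "p \<noteq> 0"
  then have "ks p \<noteq> {}" by (metis keys_eq_empty)
  then have "(\<Sum>M\<in>ks p. (norm (lk p M))\<^sup>2 * apolar_weight \<omega> M) > 0"
    by (intro sum_pos) (auto simp: in_keys_iff apolar_weight_pos assms(1))
  with assms(2) show False by (simp only: apolar_self of_real_eq_0_iff)
qed

lemma apolar_single: "apolar \<omega> (sg M c) q = c * cnj (lk q M) * of_real (apolar_weight \<omega> M)"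
  by (subst apolar_superset[of "{M}"]) auto

section \<open>Differentiation and the adjoint of a linear substitution\<close>

definition partial :: "'v \<Rightarrow> 'v cpoly \<Rightarrow> 'v cpoly" where
  "partial v q = (\<Sum>N\<in>ks q. sg (N - sg v 1) (of_nat (lk N v) * lk q N))"

lemma lk_partial: "lk (partial v q) M = (of_nat (lk M v) + 1) * lk q (sg v 1 + M)"
proof -
  have *: "N = sg v 1 + M" if "N - sg v 1 = M" "lk N v \<noteq> 0" for N
    using that by (auto intro!: poly_mapping_eqI simp: lookup_add lookup_minus lookup_single when_def)
  have "lk (partial v q) M = (\<Sum>N\<in>ks q. if N = sg v 1 + M then (of_nat (lk M v) + 1) * lk q N else 0)"
    unfolding partial_def lookup_sum
  proof (rule sum.cong)
    fix N assume "N \<in> ks q"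
    show "lk (sg (N - sg v 1) (of_nat (lk N v) * lk q N)) M =
      (if N = sg v 1 + M then (of_nat (lk M v) + 1) * lk q N else 0)"
    proof (cases "N = sg v 1 + M")
      case True
      then have "N - sg v 1 = M" "lk N v = lk M v + 1" by (simp_all add: lookup_add)
      then show ?thesis using True by (simp add: add.commute)
    next
      case False
      then have "lk N v = 0 \<or> N - sg v 1 \<noteq> M" using * by blast
      then show ?thesis using False by (auto simp: lookup_single_not_eq)
    qed
  qed simp
  then show ?thesis by (auto simp: in_keys_iff)
qed

lemma partial_add: "partial v (p + q) = partial v p + partial v q"
  by (rule poly_mapping_eqI) (simp add: lk_partial lookup_add algebra_simps)
lemma partial_const_mult: "partial v (const c * q) = const c * partial v q"
  by (rule poly_mapping_eqI) (simp add: lk_partial)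
lemma partial_0 [simp]: "partial v 0 = 0" by (simp add: partial_def)
lemma partial_sum: "partial v (\<Sum>i\<in>S. f i) = (\<Sum>i\<in>S. partial v (f i))"
  by (induction S rule: infinite_finite_induct) (simp_all add: partial_add)

lemma partial_const [simp]: "partial (v :: 'v) (const c) = 0"
proof (rule poly_mapping_eqI)
  fix M :: "'v monom"
  have "sg v 1 + M \<noteq> 0"
  proof
    assume "sg v 1 + M = 0"
    then have "lk (sg v 1 + M) v = 0" by simp
    then show False by (simp add: lookup_add)
  qed
  then show "lk (partial v (const c)) M = lk 0 M" by (simp add: lk_partial const_def lookup_single when_def)
qed

lemma partial_var_mult: "partial v (var w * q) = (if v = w then q else 0) + var w * partial v q"
proof (rule poly_mapping_eqI)
  fix M
  show "lk (partial v (var w * q)) M = lk ((if v = w then q else 0) + var w * partial v q) M"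
  proof (cases "v = w")
    case True
    have "sg w 1 + M - sg w 1 = M" by simp
    moreover have "sg w 1 + (M - sg w 1) = M" if "lk M w \<noteq> 0"
      using that by (auto intro!: poly_mapping_eqI simp: lookup_add lookup_minus lookup_single when_def)
    moreover have "(of_nat (lk M w - Suc 0) + 1 :: complex) = of_nat (lk M w)" if "lk M w \<noteq> 0"
      using that by (simp add: of_nat_diff)
    ultimately show ?thesis unfolding True
      by (auto simp: lk_partial lk_var_mult lookup_add lookup_minus distrib_right)
  next
    case False
    have "sg v 1 + M - sg w 1 = sg v 1 + (M - sg w 1)"
      using False by (intro poly_mapping_eqI) (auto simp: lookup_add lookup_minus lookup_single when_def)
    then show ?thesis using False
      by (auto simp: lk_partial lk_var_mult lookup_add lookup_minus lookup_single when_def)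
  qed
qed

lemma apolar_var_mult: "apolar \<omega> (var v * p) q = of_real (\<omega> v) * apolar \<omega> p (partial v q)"
proof (induction p rule: poly_mapping_induct)
  case (single M c)
  show ?case unfolding sg_Suc_monom[symmetric] apolar_single apolar_weight_add lk_partial by simp
next
  case (add p p') then show ?case by (simp add: distrib_left apolar_add_left)
qed

text \<open>Variables outside \<open>X\<close> are set to 0, which makes the identities below unconditional.\<close>

definition lins :: "'v set \<Rightarrow> ('v \<Rightarrow> 'v \<Rightarrow> complex) \<Rightarrow> 'v \<Rightarrow> 'v cpoly" where
  "lins X a v = (if v \<in> X then (\<Sum>w\<in>X. const (a v w) * var w) else 0)"

lemma partial_lins_mult:
  assumes "finite X" "v \<in> X"
  shows "partial u (lins X a v * p) = (if u \<in> X then const (a v u) * p else 0) + lins X a v * partial u p"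
proof -
  have "partial u (lins X a v * p) = (\<Sum>w\<in>X. const (a v w) * partial u (var w * p))"
    using assms by (simp add: lins_def sum_distrib_right partial_sum partial_const_mult mult.assoc)
  also have "\<dots> = (\<Sum>w\<in>X. (if w = u then const (a v w) * p else 0) + const (a v w) * var w * partial u p)"
    by (rule sum.cong) (auto simp: partial_var_mult distrib_left mult.assoc)
  finally show ?thesis using assms by (simp add: sum.distrib lins_def sum_distrib_right)
qed

text \<open>The chain rule for a linear substitution.\<close>

lemma partial_subst:
  assumes X: "finite X"
  shows "partial u (poly_subst (lins X a) q) =
    (if u \<in> X then (\<Sum>v\<in>X. const (a v u) * poly_subst (lins X a) (partial v q)) else 0)"
proof (induction q rule: cpoly_induct)
  case (const c) then show ?case by simp
next
  case (var_mult v q)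
  let ?h = "poly_subst (lins X a)"
  show ?case
  proof (cases "v \<in> X")
    case True
    have "(\<Sum>w\<in>X. const (a w u) * ?h (partial w (var v * q))) =
        (\<Sum>w\<in>X. (if w = v then const (a w u) * ?h q else 0) + lins X a v * (const (a w u) * ?h (partial w q)))"
      by (rule sum.cong) (auto simp: partial_var_mult poly_subst_add poly_subst_mult distrib_left mult.left_commute)
    also have "\<dots> = const (a v u) * ?h q + lins X a v * (\<Sum>w\<in>X. const (a w u) * ?h (partial w q))"
      using X True by (simp add: sum.distrib sum_distrib_left)
    finally show ?thesis using True var_mult by (simp add: poly_subst_mult partial_lins_mult[OF X])
  next
    case False
    then have "lins X a v = 0" by (simp add: lins_def)
    moreover have "?h (partial w (var v * q)) = 0" if "w \<in> X" for w
      using that False \<open>lins X a v = 0\<close> by (auto simp: partial_var_mult poly_subst_mult)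
    ultimately show ?thesis by (simp add: poly_subst_mult)
  qed
next
  case (add p q)
  then show ?case by (simp add: poly_subst_add partial_add distrib_left sum.distrib)
qed

lemma lk_lins_mult_0:
  assumes "finite X"
  shows "lk (lins X a v * p) 0 = 0"
proof -
  have "lins X a v * p = (if v \<in> X then \<Sum>w\<in>X. const (a v w) * (var w * p) else 0)"
    by (simp add: lins_def sum_distrib_right mult.assoc)
  then show ?thesis by (simp add: lookup_sum lk_var_mult)
qed

text \<open>Pairing with a constant sees only the constant term, so this is the base case of the
  adjointness below.\<close>

lemma lk_subst_lins_0:
  assumes "finite X"
  shows "lk (poly_subst (lins X a) p) 0 = lk p 0"
  by (induction p rule: cpoly_induct)
     (simp_all add: poly_subst_add poly_subst_mult lookup_add lk_lins_mult_0[OF assms] lk_var_mult)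

text \<open>Peeling a variable off \<open>p\<close> turns it into a linear form on the left, whose
  adjoint is a combination of derivatives; the chain rule for \<open>b\<close> collects these into
  one derivative on the right. The hypothesis \<open>adj\<close> says that \<open>a\<close> and
  \<open>b\<close> are adjoint on the variables themselves, with squared norms
  \<open>\<omega>\<close>.\<close>

lemma apolar_adjoint:
  assumes X: "finite X"
    and adj: "\<And>v w. v \<in> X \<Longrightarrow> w \<in> X \<Longrightarrow> a v w * of_real (\<omega> w) = cnj (b w v) * of_real (\<omega> v)"
  shows "apolar \<omega> (poly_subst (lins X a) p) q = apolar \<omega> p (poly_subst (lins X b) q)"
proof (induction p arbitrary: q rule: cpoly_induct)
  case (const c)
  show ?case by (simp add: poly_subst_single apolar_single lk_subst_lins_0[OF X] const_def apolar_single)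
next
  case (var_mult v p)
  let ?g = "poly_subst (lins X a)" and ?h = "poly_subst (lins X b)"
  show ?case
  proof (cases "v \<in> X")
    case True
    have "apolar \<omega> (?g (var v * p)) q = (\<Sum>w\<in>X. a v w * (of_real (\<omega> w) * apolar \<omega> (?g p) (partial w q)))"
      using True by (simp add: poly_subst_mult lins_def sum_distrib_right mult.assoc apolar_sum_left apolar_const_left apolar_var_mult)
    also have "\<dots> = (\<Sum>w\<in>X. of_real (\<omega> v) * (cnj (b w v) * apolar \<omega> p (?h (partial w q))))"
    proof (rule sum.cong)
      fix w assume w: "w \<in> X"
      show "a v w * (of_real (\<omega> w) * apolar \<omega> (?g p) (partial w q)) = of_real (\<omega> v) * (cnj (b w v) * apolar \<omega> p (?h (partial w q)))"
        using adj[OF True w] unfolding var_mult.IH by (metis mult.assoc mult.commute)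
    qed simp
    also have "\<dots> = of_real (\<omega> v) * apolar \<omega> p (partial v (?h q))"
      using True by (simp add: partial_subst[OF X] apolar_sum_right apolar_const_right sum_distrib_left)
    finally show ?thesis by (simp add: apolar_var_mult)
  next
    case False
    then have "lins X a v = 0" by (simp add: lins_def)
    then show ?thesis using False by (simp add: poly_subst_mult apolar_var_mult partial_subst[OF X])
  qed
next
  case (add p p')
  then show ?case by (simp add: poly_subst_add apolar_add_left)
qed

text \<open>\<open>U\<close> is a subspace of a finite-dimensional space. An orthonormal system in
  \<open>U\<close> of largest size exists because Bessel's inequality bounds the size by
  \<open>card S\<close>. The projection to its span works for all of \<open>U\<close>, since a
  vector of \<open>U\<close> outside the span would give, after Gram-Schmidt, a further
  member.\<close>

lemma orthogonal_decomposition: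
  assumes \<omega>: "\<And>v. \<omega> v > 0" and S: "finite S" "\<And>u. u \<in> U \<Longrightarrow> ks u \<subseteq> S"
    and U: "0 \<in> U" "\<And>u v c. u \<in> U \<Longrightarrow> v \<in> U \<Longrightarrow> u + const c * v \<in> U"
  shows "\<exists>u\<in>U. \<forall>u'\<in>U. apolar \<omega> (q - u) u' = 0"
proof -
  define on where "on E \<longleftrightarrow> finite E \<and> E \<subseteq> U \<and> (\<forall>e\<in>E. \<forall>e'\<in>E. apolar \<omega> e e' = (if e = e' then 1 else 0))" for E
  define proj where "proj E x = (\<Sum>e\<in>E. const (apolar \<omega> x e) * e)" for E x
  have U_sum: "(\<Sum>e\<in>E. const (c e) * e) \<in> U" if "E \<subseteq> U" for E and c
    using that
  proof (induction E rule: infinite_finite_induct)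
    case (insert e E)
    then show ?case using U(2)[of "\<Sum>e\<in>E. const (c e) * e" e "c e"] by (simp add: add.commute)
  qed (use U in auto)
  have apolar_proj: "apolar \<omega> (proj E x) e = apolar \<omega> x e" if "on E" "e \<in> E" for E x e
  proof -
    have "apolar \<omega> (proj E x) e = (\<Sum>e'\<in>E. if e' = e then apolar \<omega> x e' else 0)"
      unfolding proj_def apolar_sum_left apolar_const_left
      by (rule sum.cong) (use that in \<open>auto simp: on_def\<close>)
    then show ?thesis using that by (simp add: on_def)
  qed
  have bound: "card E \<le> card S" if E: "on E" for E
  proof -
    \<comment> \<open>Bessel's inequality for the single monomial \<open>M\<close>, divided by its
      squared norm: the residual of \<open>M\<close> after projection has nonnegative squared
      norm.\<close>
    have bessel: "(\<Sum>e\<in>E. (norm (lk e M))\<^sup>2 * apolar_weight \<omega> M) \<le> 1" for M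
    proof -
      define x where "x = (sg M 1 :: 'a cpoly)"
      have ix: "apolar \<omega> x e = cnj (lk e M) * of_real (apolar_weight \<omega> M)" for e by (simp add: x_def apolar_single)
      have "apolar \<omega> (x - proj E x) (x - proj E x) = apolar \<omega> x x - apolar \<omega> (proj E x) x"
      proof -
        have "apolar \<omega> (x - proj E x) (proj E x) = (\<Sum>e\<in>E. cnj (apolar \<omega> x e) * apolar \<omega> (x - proj E x) e)"
          by (simp add: proj_def apolar_sum_right apolar_const_right)
        also have "\<dots> = 0" by (rule sum.neutral) (simp add: apolar_diff_left apolar_proj[OF E])
        finally have 0: "apolar \<omega> (x - proj E x) (proj E x) = 0" .
        have "apolar \<omega> (x - proj E x) x = apolar \<omega> (x - proj E x) ((x - proj E x) + proj E x)" by simp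
        then show ?thesis unfolding apolar_add_right 0 by (simp add: apolar_diff_left)
      qed
      also have "apolar \<omega> (proj E x) x = of_real (\<Sum>e\<in>E. (norm (apolar \<omega> x e))\<^sup>2)"
        unfolding proj_def apolar_sum_left apolar_const_left
        by (simp add: apolar_cnj[of \<omega> _ x] complex_norm_square[symmetric] del: of_real_power)
      also have "apolar \<omega> x x = of_real (apolar_weight \<omega> M)" by (simp add: ix) (simp add: x_def)
      finally have "complex_of_real (\<Sum>N\<in>ks (x - proj E x). (norm (lk (x - proj E x) N))\<^sup>2 * apolar_weight \<omega> N)
          = of_real (apolar_weight \<omega> M - (\<Sum>e\<in>E. (norm (apolar \<omega> x e))\<^sup>2))" unfolding apolar_self by simp
      then have "(\<Sum>N\<in>ks (x - proj E x). (norm (lk (x - proj E x) N))\<^sup>2 * apolar_weight \<omega> N)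
          = apolar_weight \<omega> M - (\<Sum>e\<in>E. (norm (apolar \<omega> x e))\<^sup>2)" by (simp only: of_real_eq_iff)
      moreover have "(\<Sum>N\<in>ks (x - proj E x). (norm (lk (x - proj E x) N))\<^sup>2 * apolar_weight \<omega> N) \<ge> 0"
        by (intro sum_nonneg mult_nonneg_nonneg) (simp_all add: less_imp_le apolar_weight_pos \<omega>)
      moreover have "(\<Sum>e\<in>E. (norm (apolar \<omega> x e))\<^sup>2) = apolar_weight \<omega> M * (\<Sum>e\<in>E. (norm (lk e M))\<^sup>2 * apolar_weight \<omega> M)"
        by (simp add: ix norm_mult power_mult_distrib sum_distrib_left power2_eq_square[of "apolar_weight \<omega> M"] mult_ac)
      ultimately have "apolar_weight \<omega> M * (\<Sum>e\<in>E. (norm (lk e M))\<^sup>2 * apolar_weight \<omega> M) \<le> apolar_weight \<omega> M * 1" by simp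
      then show ?thesis using apolar_weight_pos[of \<omega> M, OF \<omega>] by (simp only: mult_le_cancel_left_pos)
    qed
    have one: "(\<Sum>M\<in>S. (norm (lk e M))\<^sup>2 * apolar_weight \<omega> M) = 1" if "e \<in> E" for e
    proof -
      have "apolar \<omega> e e = 1" "ks e \<subseteq> S" using that E S by (auto simp: on_def)
      moreover have "apolar \<omega> e e = of_real (\<Sum>M\<in>S. (norm (lk e M))\<^sup>2 * apolar_weight \<omega> M)"
        using apolar_superset[OF S(1) \<open>ks e \<subseteq> S\<close>, of \<omega> e] by (simp add: complex_norm_square[symmetric])
      ultimately have "complex_of_real (\<Sum>M\<in>S. (norm (lk e M))\<^sup>2 * apolar_weight \<omega> M) = of_real 1" by simp
      then show ?thesis by (simp only: of_real_eq_iff)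
    qed
    \<comment> \<open>Double counting: each unit vector contributes 1, each monomial of
      \<open>S\<close> receives at most 1.\<close>
    have "real (card E) = (\<Sum>e\<in>E. \<Sum>M\<in>S. (norm (lk e M))\<^sup>2 * apolar_weight \<omega> M)" by (simp add: one)
    also have "\<dots> = (\<Sum>M\<in>S. \<Sum>e\<in>E. (norm (lk e M))\<^sup>2 * apolar_weight \<omega> M)" by (rule sum.swap)
    also have "\<dots> \<le> (\<Sum>M\<in>S. 1)" by (rule sum_mono) (rule bessel)
    finally show ?thesis by simp
  qed
  have "on {}" by (simp add: on_def)
  then obtain E where E: "on E" and max: "\<And>E'. on E' \<Longrightarrow> card E' \<le> card E"
    using ex_has_greatest_nat[of on "{}" card "Suc (card S)"] bound by (metis less_Suc_eq_le)
  have orth: "apolar \<omega> (q - proj E q) u = 0" if u: "u \<in> U" for u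
  proof (rule ccontr)
    assume ne: "apolar \<omega> (q - proj E q) u \<noteq> 0"
    define y where "y = u - proj E u"
    have y_e: "apolar \<omega> y e = 0" if "e \<in> E" for e by (simp add: y_def apolar_diff_left apolar_proj[OF E that])
    have e_y: "apolar \<omega> e y = 0" if "e \<in> E" for e using y_e[OF that] apolar_cnj[of \<omega> e y] by simp
    \<comment> \<open>Otherwise \<open>u\<close> lies in the span of \<open>E\<close>, to which the
      residual of \<open>q\<close> is orthogonal.\<close>
    have "y \<noteq> 0"
    proof
      assume "y = 0"
      then have "u = proj E u" by (simp add: y_def)
      then have "apolar \<omega> (q - proj E q) u = apolar \<omega> (q - proj E q) (proj E u)" by simp
      also have "\<dots> = (\<Sum>e\<in>E. cnj (apolar \<omega> u e) * apolar \<omega> (q - proj E q) e)"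
        by (simp add: proj_def apolar_sum_right apolar_const_right)
      also have "\<dots> = 0" by (rule sum.neutral) (simp add: apolar_diff_left apolar_proj[OF E])
      finally show False using ne by simp
    qed
    have yU: "y \<in> U"
    proof -
      have "proj E u \<in> U" unfolding proj_def by (rule U_sum) (use E in \<open>simp add: on_def\<close>)
      from U(2)[OF u this, of "- 1"] show ?thesis by (simp add: y_def const_uminus)
    qed
    define r where "r = (\<Sum>M\<in>ks y. (norm (lk y M))\<^sup>2 * apolar_weight \<omega> M)"
    have yy: "apolar \<omega> y y = of_real r" by (simp only: r_def apolar_self)
    have "r \<ge> 0" unfolding r_def by (intro sum_nonneg mult_nonneg_nonneg) (simp_all add: less_imp_le apolar_weight_pos \<omega>)
    moreover have "r \<noteq> 0" using apolar_self_eq_0[where p = y, OF \<omega>] \<open>y \<noteq> 0\<close> yy by auto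
    ultimately have r: "r > 0" by simp
    define z where "z = const (of_real (1 / sqrt r)) * y"
    have zz: "apolar \<omega> z z = 1"
    proof -
      have "apolar \<omega> z z = of_real ((1 / sqrt r) * ((1 / sqrt r) * r))"
        unfolding z_def apolar_const_left apolar_const_right yy by (simp only: complex_cnj_complex_of_real of_real_mult)
      also have "(1 / sqrt r) * ((1 / sqrt r) * r) = 1" using r by (simp add: field_simps)
      finally show ?thesis by simp
    qed
    have z_e: "apolar \<omega> z e = 0" "apolar \<omega> e z = 0" if "e \<in> E" for e
      by (simp_all add: z_def apolar_const_left apolar_const_right y_e e_y that)
    have "z \<notin> E" using zz z_e by auto
    have "z \<in> U" using U(2)[OF U(1) yU, of "of_real (1 / sqrt r)"] by (simp add: z_def)
    then have "on (insert z E)" using E zz z_e \<open>z \<notin> E\<close> by (auto simp: on_def)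
    from max[OF this] show False using \<open>z \<notin> E\<close> E by (simp add: on_def)
  qed
  moreover have "proj E q \<in> U" unfolding proj_def by (rule U_sum) (use E in \<open>simp add: on_def\<close>)
  ultimately show ?thesis by blast
qed


subsection \<open>Invariants separate orbits from closed cones\<close>

text \<open>The conjugate transpose, which gives the adjoint for the inner product on forms;
  \<open>adj_mat\<close> in contrast is the inverse on \<open>SL\<close>.\<close>

definition adj_form :: "complex mat \<Rightarrow> complex mat" where
  "adj_form A = mat (dim_col A) (dim_row A) (\<lambda>(i, j). cnj (A $$ (j, i)))"

lemma adj_form_SL:
  assumes "A \<in> SL N"
  shows "adj_form A \<in> SL N"
proof -
  have A: "A \<in> carrier_mat N N" "det A = 1" using assms by (auto simp: SL_def)
  have e: "adj_form A = transpose_mat (mat N N (\<lambda>(i, j). cnj (A $$ (i, j))))"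
    using A by (auto simp: adj_form_def)
  have "det (mat N N (\<lambda>(i, j). cnj (A $$ (i, j)))) = cnj (det A)"
  proof -
    have "cnj (signof p) = (signof p :: complex)" for p :: "nat \<Rightarrow> nat" by (simp add: sign_def)
    moreover have "(\<Prod>i = 0..<N. mat N N (\<lambda>(i, j). cnj (A $$ (i, j))) $$ (i, p i)) = (\<Prod>i = 0..<N. cnj (A $$ (i, p i)))"
      if "p permutes {0..<N}" for p
      by (rule prod.cong) (use that permutes_in_image[OF that] in auto)
    ultimately show ?thesis using A(1) by (simp add: det_def)
  qed
  then show ?thesis using A unfolding e SL_def by (auto simp: det_transpose[of _ N])
qed

definition block_entry :: "complex mat \<Rightarrow> complex mat \<Rightarrow> coord \<Rightarrow> coord \<Rightarrow> complex" where
  "block_entry A B v w = (case (v, w) of (Inl i, Inl j) \<Rightarrow> A $$ (i, j) | (Inr i, Inr j) \<Rightarrow> B $$ (i, j) | _ \<Rightarrow> 0)"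

lemma sbst_lins:
  assumes A: "A \<in> carrier_mat (m + 1) (m + 1)" "B \<in> carrier_mat (n + 1) (n + 1)" and F: "F \<in> bihom_forms m n k l"
  shows "sbst A B F = poly_subst (lins (coords m n) (block_entry A B)) F"
  unfolding sbst_def
proof (rule poly_subst_cong)
  fix M v assume "M \<in> ks F" "v \<in> ks M"
  with bihom_coords[OF F] have v: "v \<in> coords m n" by blast
  have s: "(\<Sum>w\<in>coords m n. const (f w) * var w) = (\<Sum>i<m + 1. const (f (Inl i)) * var (Inl i)) + (\<Sum>j<n + 1. const (f (Inr j)) * (var (Inr j) :: form))" for f
    unfolding coords_def by (subst sum.union_disjoint) (auto simp: sum.reindex lessThan_Suc_atMost)
  show "lin_change A B v = lins (coords m n) (block_entry A B) v"
    using v A unfolding lins_def s by (cases v) (auto simp: block_entry_def)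
qed

definition monom_coeff :: "complex mat \<Rightarrow> complex mat \<Rightarrow> coord monom \<Rightarrow> coord monom \<Rightarrow> complex" where
  "monom_coeff A B I J = lk (sbst A B (sg J 1)) I"

lemma single_bihom: "I \<in> Xi m n k l \<Longrightarrow> sg I c \<in> bihom_forms m n k l"
  by (cases "c = 0") (auto simp: bihom_forms_def)

lemma monom_coeff_adjoint:
  assumes "A \<in> SL (m + 1)" "B \<in> SL (n + 1)" and I: "I \<in> Xi m n k l" and J: "J \<in> Xi m n k l"
  shows "monom_coeff A B I J * of_real (apolar_weight (\<lambda>_. 1) I) = cnj (monom_coeff (adj_form A) (adj_form B) J I) * of_real (apolar_weight (\<lambda>_. 1) J)"
proof -
  note c = SL_carrier[OF assms(1)] SL_carrier[OF assms(2)]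
    SL_carrier[OF adj_form_SL[OF assms(1)]] SL_carrier[OF adj_form_SL[OF assms(2)]]
  have "apolar (\<lambda>_. 1) (poly_subst (lins (coords m n) (block_entry A B)) (sg J 1)) (sg I 1) =
      apolar (\<lambda>_. 1) (sg J 1) (poly_subst (lins (coords m n) (block_entry (adj_form A) (adj_form B))) (sg I 1))"
  proof (rule apolar_adjoint)
    fix v w assume "v \<in> coords m n" "w \<in> coords m n"
    then show "block_entry A B v w * of_real 1 = cnj (block_entry (adj_form A) (adj_form B) w v) * of_real 1"
      using c(1,2) by (auto simp: block_entry_def adj_form_def coords_def)
  qed simp
  then have "apolar (\<lambda>_. 1) (sbst A B (sg J 1)) (sg I 1) = apolar (\<lambda>_. 1) (sg J 1) (sbst (adj_form A) (adj_form B) (sg I 1))"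
    using sbst_lins[OF c(1,2) single_bihom[OF J]] sbst_lins[OF c(3,4) single_bihom[OF I]] by simp
  moreover have "apolar (\<lambda>_. 1) (sbst A B (sg J 1)) (sg I 1) = monom_coeff A B I J * of_real (apolar_weight (\<lambda>_. 1) I)"
    by (subst apolar_cnj) (simp add: apolar_single monom_coeff_def)
  ultimately show ?thesis by (simp add: apolar_single monom_coeff_def)
qed

lemma lk_sbst:
  assumes F: "F \<in> bihom_forms m n k l"
  shows "lk (sbst A B F) I = (\<Sum>J\<in>Xi m n k l. monom_coeff A B I J * lk F J)"
proof -
  have "F = (\<Sum>J\<in>ks F. sg J (lk F J))" by (rule poly_mapping_as_sum)
  also have "\<dots> = (\<Sum>J\<in>Xi m n k l. sg J (lk F J))"
    by (rule sum.mono_neutral_left) (use F in \<open>auto simp: bihom_forms_def finite_Xi in_keys_iff\<close>)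
  also have "\<dots> = (\<Sum>J\<in>Xi m n k l. const (lk F J) * sg J 1)" by (simp add: const_def mult_single)
  finally have "lk (sbst A B F) I = lk (sbst A B (\<Sum>J\<in>Xi m n k l. const (lk F J) * sg J 1)) I" by simp
  also have "\<dots> = (\<Sum>J\<in>Xi m n k l. monom_coeff A B I J * lk F J)"
    by (simp add: sbst_def poly_subst_sum poly_subst_mult lookup_sum monom_coeff_def mult.commute)
  finally show ?thesis .
qed

text \<open>On forms \<open>sbst A B\<close> is linear with matrix \<open>monom_coeff A B\<close>,
  so composing a polynomial function with it is a linear substitution in the coefficient variables.
  Hence \<open>apolar_adjoint\<close> applies a second time, one level up.\<close>

definition pull :: "nat \<Rightarrow> nat \<Rightarrow> nat \<Rightarrow> nat \<Rightarrow> complex mat \<Rightarrow> complex mat \<Rightarrow> coord monom cpoly \<Rightarrow> coord monom cpoly" where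
  "pull m n k l A B = poly_subst (lins (Xi m n k l) (monom_coeff A B))"

lemma value_pull:
  assumes F: "F \<in> bihom_forms m n k l" and f: "\<And>M. M \<in> ks f \<Longrightarrow> ks M \<subseteq> Xi m n k l"
  shows "value_at (pull m n k l A B f) F = value_at f (sbst A B F)"
  unfolding value_at_def pull_def poly_eval_subst
proof (rule poly_eval_cong)
  fix M I assume "M \<in> ks f" "I \<in> ks M"
  then have "I \<in> Xi m n k l" using f by blast
  then show "poly_eval (lk F) (lins (Xi m n k l) (monom_coeff A B) I) = lk (sbst A B F) I"
    by (simp add: lins_def poly_eval_sum poly_eval_mult lk_sbst[OF F])
qed

lemma pull_hom: "p \<in> hom_forms (Xi m n k l) (\<lambda>_. 1) d \<Longrightarrow> pull m n k l A B p \<in> hom_forms (Xi m n k l) (\<lambda>_. 1) d"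
proof -
  have "lins (Xi m n k l) (monom_coeff A B) v \<in> hom_forms (Xi m n k l) (\<lambda>_. 1) 1" for v
    unfolding lins_def using hom_forms_var[of _ "Xi m n k l" "\<lambda>_. 1"]
    by (auto intro!: hom_forms_sum hom_forms_const_mult)
  then show "p \<in> hom_forms (Xi m n k l) (\<lambda>_. 1) d \<Longrightarrow> ?thesis"
    unfolding pull_def by (rule hom_forms_subst)
qed

text \<open>The variables are coefficient functionals, dual to the monomials, and therefore carry
  the reciprocal squared norms.\<close>

lemma pull_adjoint:
  assumes "A \<in> SL (m + 1)" "B \<in> SL (n + 1)"
  shows "apolar (\<lambda>I. 1 / apolar_weight (\<lambda>_. 1) I) (pull m n k l A B p) q =
    apolar (\<lambda>I. 1 / apolar_weight (\<lambda>_. 1) I) p (pull m n k l (adj_form A) (adj_form B) q)"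
  unfolding pull_def
proof (rule apolar_adjoint[OF finite_Xi])
  fix I J assume "I \<in> Xi m n k l" "J \<in> Xi m n k l"
  note a = monom_coeff_adjoint[OF assms this]
  have "apolar_weight (\<lambda>_. 1) I > 0" "apolar_weight (\<lambda>_. 1) J > 0" by (rule apolar_weight_pos; simp)+
  then have "complex_of_real (apolar_weight (\<lambda>_. 1) I) \<noteq> 0" "complex_of_real (apolar_weight (\<lambda>_. 1) J) \<noteq> 0" by simp_all
  with a show "monom_coeff A B I J * of_real (1 / apolar_weight (\<lambda>_. 1) J) = cnj (monom_coeff (adj_form A) (adj_form B) J I) * of_real (1 / apolar_weight (\<lambda>_. 1) I)"
    by (simp add: field_simps)
qed

section \<open>Homogeneous components and the construction of invariants\<close>

lemma finite_bounded_degree: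
  assumes "finite X"
  shows "finite {M :: 'v monom. ks M \<subseteq> X \<and> wdeg (\<lambda>_. 1) M \<le> D}"
proof -
  let ?F = "{f. \<forall>v. (v \<in> X \<longrightarrow> f v \<in> {..D}) \<and> (v \<notin> X \<longrightarrow> f v = (0::nat))}"
  have "finite ?F" using finite_set_of_finite_funs[of X "{..D}" 0] assms by simp
  moreover have "lk ` {M :: 'v monom. ks M \<subseteq> X \<and> wdeg (\<lambda>_. 1) M \<le> D} \<subseteq> ?F"
  proof (rule image_subsetI)
    fix M :: "'v monom" assume "M \<in> {M. ks M \<subseteq> X \<and> wdeg (\<lambda>_. 1) M \<le> D}"
    then have M: "ks M \<subseteq> X" "wdeg (\<lambda>_. 1) M \<le> D" by auto
    have "lk M v \<le> D" if "v \<in> X" for v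
      using M(2) member_le_sum[of v X "lk M"] that assms by (simp add: wdeg_superset[OF assms M(1)])
    then show "lk M \<in> ?F" using M(1) by (auto simp: in_keys_iff)
  qed
  ultimately have "finite (lk ` {M :: 'v monom. ks M \<subseteq> X \<and> wdeg (\<lambda>_. 1) M \<le> D})" using finite_subset by blast
  then show ?thesis by (rule finite_imageD) (simp add: inj_on_def lookup_inject)
qed

definition hpart :: "nat \<Rightarrow> 'v cpoly \<Rightarrow> 'v cpoly" where
  "hpart d p = (\<Sum>M\<in>{M \<in> ks p. wdeg (\<lambda>_. 1) M = d}. sg M (lk p M))"

lemma lk_hpart: "lk (hpart d p) M = (if wdeg (\<lambda>_. 1) M = d then lk p M else 0)"
proof -
  have "lk (hpart d p) M = (\<Sum>N\<in>{N \<in> ks p. wdeg (\<lambda>_. 1) N = d}. if N = M then lk p M else 0)"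
    unfolding hpart_def lookup_sum by (rule sum.cong) (auto simp: lookup_single when_def)
  then show ?thesis by (auto simp: in_keys_iff)
qed

lemma hpart_hom: "(\<And>M. M \<in> ks p \<Longrightarrow> ks M \<subseteq> X) \<Longrightarrow> hpart d p \<in> hom_forms X (\<lambda>_. 1) d"
proof -
  assume p: "\<And>M. M \<in> ks p \<Longrightarrow> ks M \<subseteq> X"
  have "ks M \<subseteq> X \<and> wdeg (\<lambda>_. 1) M = d" if "M \<in> ks (hpart d p)" for M
    using that p[of M] unfolding in_keys_iff[of M] lk_hpart by (metis (no_types, lifting))
  then show ?thesis by (simp add: hom_forms_def)
qed

lemma hpart_sum:
  assumes "\<And>M. M \<in> ks p \<Longrightarrow> wdeg (\<lambda>_. 1) M \<in> S" "finite S"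
  shows "p = (\<Sum>d\<in>S. hpart d p)"
proof (rule poly_mapping_eqI)
  fix M
  have "lk (\<Sum>d\<in>S. hpart d p) M = (\<Sum>d\<in>S. if d = wdeg (\<lambda>_. 1) M then lk p M else 0)"
    unfolding lookup_sum by (rule sum.cong) (auto simp: lk_hpart)
  then show "lk p M = lk (\<Sum>d\<in>S. hpart d p) M"
    using assms by (cases "M \<in> ks p") (auto simp: in_keys_iff)
qed

text \<open>
  Modulo the functions that vanish on the orbit, \<open>q\<close> is invariant; its component orthogonal to
  these functions is invariant outright.
\<close>

lemma invariant_from_orbit:
  assumes F: "F \<in> bihom_forms m n k l"
    and q: "\<And>M. M \<in> ks q \<Longrightarrow> ks M \<subseteq> Xi m n k l" "lk q 0 = 0"
    and orb: "\<And>A B. A \<in> SL (m + 1) \<Longrightarrow> B \<in> SL (n + 1) \<Longrightarrow> value_at q (sbst A B F) = 1"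
  shows "\<exists>d f. d \<ge> 1 \<and> invariant_section m n k l d f \<and> value_at f F \<noteq> 0"
proof -
  let ?X = "Xi m n k l" and ?deg = "wdeg (\<lambda>_. 1)" and ?\<omega> = "\<lambda>I :: coord monom. 1 / apolar_weight (\<lambda>_. 1) I"
  define D where "D = Max (insert 0 (?deg ` ks q))"
  \<comment> \<open>The constant monomial is excluded, so that every component of the function found
    below has positive degree.\<close>
  define Ms where "Ms = {M. ks M \<subseteq> ?X \<and> ?deg M \<le> D \<and> M \<noteq> 0}"
  have finMs: "finite Ms"
    by (rule finite_subset[OF _ finite_bounded_degree[OF finite_Xi, of m n k l D]]) (auto simp: Ms_def)
  have deg0: "?deg M = 0 \<Longrightarrow> M = 0" for M :: "coord monom monom"
    by (auto simp: wdeg_def in_keys_iff intro!: poly_mapping_eqI)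
  define W :: "coord monom cpoly set" where "W = {p. ks p \<subseteq> Ms}"
  have W_vars: "ks M \<subseteq> ?X" if "p \<in> W" "M \<in> ks p" for p M using that by (auto simp: W_def Ms_def)
  have qW: "q \<in> W"
  proof -
    have "?deg M \<le> D" if "M \<in> ks q" for M unfolding D_def using that by (intro Max_ge) auto
    moreover have "M \<noteq> 0" if "M \<in> ks q" for M using that q(2) by (auto simp: in_keys_iff)
    ultimately show ?thesis using q(1) by (auto simp: W_def Ms_def)
  qed
  have W_add: "p + const c * r \<in> W" if "p \<in> W" "r \<in> W" for p r c
  proof -
    have "ks (p + const c * r) \<subseteq> ks p \<union> ks r" by (auto simp: in_keys_iff lookup_add)
    also have "\<dots> \<subseteq> Ms" using that by (simp add: W_def)
    finally show ?thesis by (simp add: W_def)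
  qed
  have W_add': "p + r \<in> W" if "p \<in> W" "r \<in> W" for p r using W_add[OF that, of 1] by simp
  have W_sum: "(\<Sum>i\<in>S. f i) \<in> W" if "\<And>i. i \<in> S \<Longrightarrow> f i \<in> W" for S :: "coord monom monom set" and f
    using that by (induction S rule: infinite_finite_induct) (auto simp: W_add', auto simp: W_def)
  have pull_W: "pull m n k l A B p \<in> W" if "p \<in> W" for A B p
  proof -
    have "pull m n k l A B p = pull m n k l A B (\<Sum>M\<in>ks p. sg M (lk p M))"
      by (simp add: poly_mapping_as_sum[symmetric])
    also have "\<dots> = (\<Sum>M\<in>ks p. pull m n k l A B (sg M (lk p M)))" by (simp add: pull_def poly_subst_sum)
    also have "\<dots> \<in> W"
    proof (rule W_sum)
      fix M assume "M \<in> ks p"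
      then have M: "M \<in> Ms" using that by (auto simp: W_def)
      then have "sg M (lk p M) \<in> hom_forms ?X (\<lambda>_. 1) (?deg M)" by (auto simp: hom_forms_def Ms_def split: if_splits)
      from pull_hom[OF this, of A B] show "pull m n k l A B (sg M (lk p M)) \<in> W"
        using M deg0[of M] by (auto simp: hom_forms_def W_def Ms_def)
    qed
    finally show ?thesis .
  qed
  define U where "U = {u \<in> W. \<forall>A\<in>SL (m + 1). \<forall>B\<in>SL (n + 1). value_at u (sbst A B F) = 0}"
  have \<omega>: "?\<omega> I > 0" for I using apolar_weight_pos[of "\<lambda>_. 1" I] by simp
  have "\<exists>u\<in>U. \<forall>u'\<in>U. apolar ?\<omega> (q - u) u' = 0"
  proof (rule orthogonal_decomposition[OF \<omega> finMs])
    show "ks u \<subseteq> Ms" if "u \<in> U" for u using that by (auto simp: U_def W_def)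
    show "0 \<in> U" by (auto simp: U_def W_def value_at_def)
    show "u + const c * v \<in> U" if "u \<in> U" "v \<in> U" for u v c
      using that W_add by (auto simp: U_def value_at_def poly_eval_add poly_eval_mult)
  qed
  then obtain u where u: "u \<in> U" "\<And>u'. u' \<in> U \<Longrightarrow> apolar ?\<omega> (q - u) u' = 0" by blast
  define f where "f = q - u"
  have fW: "f \<in> W" using W_add[of q u "- 1"] qW u(1) by (simp add: f_def U_def const_uminus)
  have f_orb: "value_at f (sbst A B F) = 1" if "A \<in> SL (m + 1)" "B \<in> SL (n + 1)" for A B
    using orb[OF that] u(1) that by (simp add: f_def value_at_def poly_eval_diff U_def)
  have pull_orb: "value_at (pull m n k l A B p) (sbst C E F) = value_at p (sbst (C * A) (E * B) F)"
    if "A \<in> SL (m + 1)" "B \<in> SL (n + 1)" "C \<in> SL (m + 1)" "E \<in> SL (n + 1)" "p \<in> W" for A B C E p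
  proof -
    note c = that(1-4)[THEN SL_carrier]
    show ?thesis
      using value_pull[OF sbst_bihom[OF c(3,4) F], of p A B] W_vars[OF that(5)] sbst_comp[OF c F] by simp
  qed
  have pull_U: "pull m n k l A B p \<in> U" if "A \<in> SL (m + 1)" "B \<in> SL (n + 1)" "p \<in> U" for A B p
    using that pull_W pull_orb[OF that(1,2)] SL_mult by (auto simp: U_def)
  \<comment> \<open>The difference vanishes on the orbit, where \<open>f\<close> is constantly 1, so
    it lies in \<open>U\<close>. It is also orthogonal to \<open>U\<close>, because the adjoint of
    \<open>pull\<close> is a \<open>pull\<close> again and preserves \<open>U\<close>. Thus it is
    orthogonal to itself.\<close>
  have inv: "pull m n k l A B f = f" if AB: "A \<in> SL (m + 1)" "B \<in> SL (n + 1)" for A B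
  proof -
    have "pull m n k l A B f - f \<in> U"
    proof -
      have "pull m n k l A B f - f \<in> W" using W_add[OF pull_W[OF fW] fW, of A B "- 1"] by (simp add: const_uminus)
      moreover have "value_at (pull m n k l A B f - f) (sbst C E F) = 0" if "C \<in> SL (m + 1)" "E \<in> SL (n + 1)" for C E
        using pull_orb[OF AB that fW] f_orb[OF that] f_orb[OF SL_mult[OF that(1) AB(1)] SL_mult[OF that(2) AB(2)]]
        by (simp add: value_at_def poly_eval_diff)
      ultimately show ?thesis by (simp add: U_def)
    qed
    moreover have "apolar ?\<omega> (pull m n k l A B f - f) u' = 0" if "u' \<in> U" for u'
      using u(2)[OF that] u(2)[OF pull_U[OF adj_form_SL[OF AB(1)] adj_form_SL[OF AB(2)] that]]
      by (simp add: apolar_diff_left pull_adjoint[OF AB] f_def[symmetric])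
    ultimately have "apolar ?\<omega> (pull m n k l A B f - f) (pull m n k l A B f - f) = 0" by blast
    then have "pull m n k l A B f - f = 0" by (rule apolar_self_eq_0[OF \<omega>])
    then show ?thesis by simp
  qed
  \<comment> \<open>\<open>pull\<close> preserves degrees, so comparing the parts of degree
    \<open>d\<close> on both sides of \<open>inv\<close> gives the invariance of each
    component.\<close>
  have inv_d: "pull m n k l A B (hpart d f) = hpart d f" if AB: "A \<in> SL (m + 1)" "B \<in> SL (n + 1)" for A B d
  proof (rule poly_mapping_eqI)
    fix M
    have hom: "pull m n k l A B (hpart e f) \<in> hom_forms ?X (\<lambda>_. 1) e" for e
      by (intro pull_hom hpart_hom W_vars[OF fW])
    show "lk (pull m n k l A B (hpart d f)) M = lk (hpart d f) M"
    proof (cases "?deg M = d")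
      case False
      then show ?thesis using hom[of d] by (auto simp: lk_hpart hom_forms_def in_keys_iff)
    next
      case True
      have z: "lk (pull m n k l A B (hpart e f)) M = 0" if "e \<noteq> d" for e
        using hom[of e] that True by (auto simp: hom_forms_def in_keys_iff)
      let ?S = "insert d (?deg ` ks f)"
      have "lk f M = lk (pull m n k l A B (\<Sum>e\<in>?S. hpart e f)) M"
        using inv[OF AB] hpart_sum[of f ?S] by simp
      also have "\<dots> = (\<Sum>e\<in>?S. lk (pull m n k l A B (hpart e f)) M)"
        by (simp only: pull_def poly_subst_sum lookup_sum)
      also have "\<dots> = (\<Sum>e\<in>?S. if e = d then lk (pull m n k l A B (hpart d f)) M else 0)"
        by (rule sum.cong) (simp_all add: z)
      also have "\<dots> = lk (pull m n k l A B (hpart d f)) M" by simp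
      finally show ?thesis using True by (simp add: lk_hpart)
    qed
  qed
  \<comment> \<open>The components of \<open>f\<close> add up to the value 1 at \<open>F\<close>, so
    one of them is nonzero there.\<close>
  have "\<exists>d\<in>?deg ` ks f. value_at (hpart d f) F \<noteq> 0"
  proof (rule ccontr)
    assume *: "\<not> ?thesis"
    have "value_at f F = value_at (\<Sum>d\<in>?deg ` ks f. hpart d f) F"
      using hpart_sum[of f "?deg ` ks f"] by simp
    also have "\<dots> = 0" using * unfolding value_at_def poly_eval_sum by (intro sum.neutral) simp
    finally show False using f_orb[OF SL_one SL_one] by (simp add: sbst_one[OF F, simplified])
  qed
  then obtain M where M: "M \<in> ks f" "value_at (hpart (?deg M) f) F \<noteq> 0" by blast
  have "?deg M \<ge> 1" using M(1) fW deg0[of M] by (fastforce simp: W_def Ms_def)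
  moreover have "invariant_section m n k l (?deg M) (hpart (?deg M) f)"
    unfolding invariant_section_def
  proof (intro conjI)
    have vars: "ks N \<subseteq> ?X" if "N \<in> ks (hpart d f)" for N d
      using that W_vars[OF fW, of N] by (auto simp: in_keys_iff lk_hpart split: if_splits)
    show "hpart (?deg M) f \<in> sections m n k l (?deg M)"
      unfolding sections_hom by (rule hpart_hom[OF W_vars[OF fW]])
    have "\<forall>G\<in>bihom_forms m n k l. \<forall>g\<in>grp m n. value_at (hpart (?deg M) f) (act g G) = value_at (hpart (?deg M) f) G"
    proof
      fix G assume G: "G \<in> bihom_forms m n k l"
      show "\<forall>g\<in>grp m n. value_at (hpart (?deg M) f) (act g G) = value_at (hpart (?deg M) f) G"
        unfolding ball_act[of m n "\<lambda>H. value_at (hpart (?deg M) f) H = value_at (hpart (?deg M) f) G"]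
        using value_pull[OF G vars] inv_d by metis
    qed
    then show "\<forall>g\<in>grp m n. \<forall>G\<in>bihom_forms m n k l. value_at (hpart (?deg M) f) (act g G) = value_at (hpart (?deg M) f) G"
      by blast
  qed
  ultimately show ?thesis using M(2) by blast
qed

text \<open>A function \<open>p\<close> separating the origin from the orbit can be turned into
  \<open>q = 1 - p / p(0)\<close>, which has no constant term and equals 1 on the orbit. Such a
  \<open>q\<close> yields an invariant that does not vanish at \<open>F\<close>.\<close>

lemma unstable_closure:
  assumes F: "F \<in> bihom_forms m n k l" "F \<noteq> 0" and un: "git_unstable m n k l F"
    and p: "\<And>M. M \<in> ks p \<Longrightarrow> ks M \<subseteq> Xi m n k l"
    and van: "\<And>A B. A \<in> SL (m + 1) \<Longrightarrow> B \<in> SL (n + 1) \<Longrightarrow> value_at p (sbst A B F) = 0"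
  shows "value_at p 0 = 0"
proof (rule ccontr)
  assume ne: "value_at p 0 \<noteq> 0"
  have v0: "value_at p 0 = lk p 0"
  proof -
    have z: "lk (0 :: form) = (\<lambda>_. 0)" by (rule ext) simp
    have "value_at p 0 = (\<Sum>M\<in>ks p. lk p M * mon_val (\<lambda>_. 0) M)"
      by (simp add: value_at_def poly_eval_ins evl.ins_def z)
    also have "\<dots> = (\<Sum>M\<in>ks p. if M = 0 then lk p M else 0)"
    proof (rule sum.cong)
      fix M assume "M \<in> ks p"
      have "mon_val (\<lambda>_. 0 :: complex) M = 0" if nz: "M \<noteq> 0"
      proof -
        obtain v where "v \<in> ks M" using nz by (metis all_not_in_conv keys_eq_empty)
        then show ?thesis by (auto simp: mon_val_def in_keys_iff intro!: prod_zero bexI[of _ v])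
      qed
      then show "lk p M * mon_val (\<lambda>_. 0) M = (if M = 0 then lk p M else 0)" by simp
    qed simp
    finally show ?thesis by (simp add: in_keys_iff)
  qed
  define q where "q = 1 - const (1 / lk p 0) * p"
  have "\<exists>d f. d \<ge> 1 \<and> invariant_section m n k l d f \<and> value_at f F \<noteq> 0"
  proof (rule invariant_from_orbit[OF F(1)])
    show "ks M \<subseteq> Xi m n k l" if "M \<in> ks q" for M
      using that p[of M] by (cases "M = 0") (auto simp: q_def in_keys_iff lookup_minus lookup_one when_def)
    show "lk q 0 = 0" using ne v0 by (simp add: q_def lookup_minus)
    show "value_at q (sbst A B F) = 1" if "A \<in> SL (m + 1)" "B \<in> SL (n + 1)" for A B
      using van[OF that] poly_eval_const[of _ 1] by (simp add: q_def value_at_def poly_eval_diff poly_eval_mult)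
  qed
  then show False using un F by (auto simp: git_unstable_def git_semistable_def)
qed

section \<open>Places on rings of functions\<close>

text \<open>
  A graph is a subring of \<open>('a \<Rightarrow> \<complex>) \<times> \<complex>\<close> containing the constants; the last condition makes it the
  graph of a homomorphism.  Since the functions do not form a field, a maximal graph plays the role
  of a place of a residue field: the idempotents it contains single out the residue field.
\<close>

definition place_graph :: "(('a \<Rightarrow> complex) \<times> complex) set \<Rightarrow> bool" where
  "place_graph \<Gamma> \<longleftrightarrow> (\<forall>c. (\<lambda>_. c, c) \<in> \<Gamma>) \<and>
     (\<forall>x c y d. (x, c) \<in> \<Gamma> \<longrightarrow> (y, d) \<in> \<Gamma> \<longrightarrow> (\<lambda>s. x s + y s, c + d) \<in> \<Gamma> \<and> (\<lambda>s. x s * y s, c * d) \<in> \<Gamma>) \<and>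
     (\<forall>c. (\<lambda>_. 0, c) \<in> \<Gamma> \<longrightarrow> c = 0)"

lemma place_graphI:
  assumes "\<And>c. (\<lambda>_. c, c) \<in> \<Gamma>"
    and "\<And>x c y d. (x, c) \<in> \<Gamma> \<Longrightarrow> (y, d) \<in> \<Gamma> \<Longrightarrow> (\<lambda>s. x s + y s, c + d) \<in> \<Gamma>"
    and "\<And>x c y d. (x, c) \<in> \<Gamma> \<Longrightarrow> (y, d) \<in> \<Gamma> \<Longrightarrow> (\<lambda>s. x s * y s, c * d) \<in> \<Gamma>"
    and "\<And>c. (\<lambda>_. 0, c) \<in> \<Gamma> \<Longrightarrow> c = 0"
  shows "place_graph \<Gamma>"
  unfolding place_graph_def by (intro conjI allI impI assms) assumption+

text \<open>The hypothesis \<open>zero\<close> makes the special value depend only on the values on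
  \<open>S\<close>; geometrically, the special point lies in the Zariski closure of
  \<open>S\<close>. Values off \<open>S\<close> are left arbitrary, so that \<open>S\<close> counts
  as the whole parameter set.\<close>

lemma place_graph_evaluation:
  fixes ev :: "'r::comm_ring_1 \<Rightarrow> 'a \<Rightarrow> complex" and ev0 :: "'r \<Rightarrow> complex"
  assumes const: "\<And>c. \<exists>p\<in>R. (\<forall>s\<in>S. ev p s = c) \<and> ev0 p = c"
    and add: "\<And>p q. p \<in> R \<Longrightarrow> q \<in> R \<Longrightarrow> p + q \<in> R \<and> (\<forall>s\<in>S. ev (p + q) s = ev p s + ev q s) \<and> ev0 (p + q) = ev0 p + ev0 q"
    and mult: "\<And>p q. p \<in> R \<Longrightarrow> q \<in> R \<Longrightarrow> p * q \<in> R \<and> (\<forall>s\<in>S. ev (p * q) s = ev p s * ev q s) \<and> ev0 (p * q) = ev0 p * ev0 q"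
    and zero: "\<And>p. p \<in> R \<Longrightarrow> (\<And>s. s \<in> S \<Longrightarrow> ev p s = 0) \<Longrightarrow> ev0 p = 0"
  shows "place_graph {(x, ev0 p) | x p. p \<in> R \<and> (\<forall>s\<in>S. x s = ev p s)}" (is "place_graph ?G")
proof (rule place_graphI)
  have I: "(x, c) \<in> ?G" if "p \<in> R" "\<forall>s\<in>S. x s = ev p s" "c = ev0 p" for x c p using that by blast
  show "(\<lambda>_. c, c) \<in> ?G" for c
  proof -
    from const[of c] obtain p where "p \<in> R" "\<forall>s\<in>S. ev p s = c" "ev0 p = c" by blast
    then show ?thesis by (intro I[of p]) auto
  qed
  fix x c y d assume "(x, c) \<in> ?G" "(y, d) \<in> ?G"
  then obtain p q where *: "p \<in> R" "\<forall>s\<in>S. x s = ev p s" "c = ev0 p" "q \<in> R" "\<forall>s\<in>S. y s = ev q s" "d = ev0 q"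
    by blast
  show "(\<lambda>s. x s + y s, c + d) \<in> ?G" using * add[of p q] by (intro I[of "p + q"]) auto
  show "(\<lambda>s. x s * y s, c * d) \<in> ?G" using * mult[of p q] by (intro I[of "p * q"]) auto
next
  fix c assume "(\<lambda>_. 0, c) \<in> ?G"
  then obtain p where "p \<in> R" "\<forall>s\<in>S. 0 = ev p s" "c = ev0 p" by blast
  then show "c = 0" using zero[of p] by simp
qed

lemma maximal_place_graph:
  assumes "place_graph \<Gamma>0"
  shows "\<exists>\<Gamma>. place_graph \<Gamma> \<and> \<Gamma>0 \<subseteq> \<Gamma> \<and> (\<forall>\<Delta>. place_graph \<Delta> \<longrightarrow> \<Gamma> \<subseteq> \<Delta> \<longrightarrow> \<Delta> = \<Gamma>)"
proof -
  have "\<exists>M\<in>{\<Gamma>. place_graph \<Gamma> \<and> \<Gamma>0 \<subseteq> \<Gamma>}. \<forall>X\<in>{\<Gamma>. place_graph \<Gamma> \<and> \<Gamma>0 \<subseteq> \<Gamma>}. M \<subseteq> X \<longrightarrow> X = M"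
  proof (rule subset_Zorn_nonempty)
    show "{\<Gamma>. place_graph \<Gamma> \<and> \<Gamma>0 \<subseteq> \<Gamma>} \<noteq> {}" using assms by blast
    fix \<C> assume C: "\<C> \<noteq> {}" "subset.chain {\<Gamma>. place_graph \<Gamma> \<and> \<Gamma>0 \<subseteq> \<Gamma>} \<C>"
    then obtain \<Gamma>1 where 1: "\<Gamma>1 \<in> \<C>" by blast
    have C': "\<And>X. X \<in> \<C> \<Longrightarrow> place_graph X" "\<And>X. X \<in> \<C> \<Longrightarrow> \<Gamma>0 \<subseteq> X"
      "\<And>X Y. X \<in> \<C> \<Longrightarrow> Y \<in> \<C> \<Longrightarrow> X \<subseteq> Y \<or> Y \<subseteq> X"
      using C(2) unfolding subset_chain_def by blast+
    have two: "\<exists>X\<in>\<C>. p \<in> X \<and> q \<in> X" if "p \<in> \<Union>\<C>" "q \<in> \<Union>\<C>" for p q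
      using that C'(3) by blast
    have "place_graph (\<Union>\<C>)"
    proof (rule place_graphI)
      show "(\<lambda>_. c, c) \<in> \<Union>\<C>" for c using C'(1)[OF 1] 1 by (auto simp: place_graph_def)
      show "(\<lambda>s. x s + y s, c + d) \<in> \<Union>\<C>" if "(x, c) \<in> \<Union>\<C>" "(y, d) \<in> \<Union>\<C>" for x c y d
      proof -
        from two[OF that] obtain X where X: "X \<in> \<C>" "(x, c) \<in> X" "(y, d) \<in> X" by blast
        with C'(1)[OF X(1)] have "(\<lambda>s. x s + y s, c + d) \<in> X" unfolding place_graph_def by blast
        with X show ?thesis by blast
      qed
      show "(\<lambda>s. x s * y s, c * d) \<in> \<Union>\<C>" if "(x, c) \<in> \<Union>\<C>" "(y, d) \<in> \<Union>\<C>" for x c y d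
      proof -
        from two[OF that] obtain X where X: "X \<in> \<C>" "(x, c) \<in> X" "(y, d) \<in> X" by blast
        with C'(1)[OF X(1)] have "(\<lambda>s. x s * y s, c * d) \<in> X" unfolding place_graph_def by blast
        with X show ?thesis by blast
      qed
      show "c = 0" if "(\<lambda>_. 0, c) \<in> \<Union>\<C>" for c using that C'(1) unfolding place_graph_def by blast
    qed
    then show "\<Union>\<C> \<in> {\<Gamma>. place_graph \<Gamma> \<and> \<Gamma>0 \<subseteq> \<Gamma>}" using C'(2) 1 by blast
  qed
  then show ?thesis by (metis (no_types, lifting) mem_Collect_eq subset_trans)
qed

locale place =
  fixes \<Gamma> :: "(('a \<Rightarrow> complex) \<times> complex) set"
  assumes graph: "place_graph \<Gamma>"
    and maximal: "\<And>\<Delta>. place_graph \<Delta> \<Longrightarrow> \<Gamma> \<subseteq> \<Delta> \<Longrightarrow> \<Delta> = \<Gamma>"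
begin

definition pl :: "('a \<Rightarrow> complex) \<Rightarrow> complex \<Rightarrow> bool" where "pl x c \<longleftrightarrow> (x, c) \<in> \<Gamma>"

sublocale ring_rel pl
  using graph by unfold_locales (auto simp: pl_def place_graph_def)

lemma pl_zero: "pl (\<lambda>_. 0) c \<Longrightarrow> c = 0"
  using graph by (auto simp: pl_def place_graph_def)

lemma pl_unique: "pl x c \<Longrightarrow> pl x d \<Longrightarrow> c = d"
  using R_diff[of x c x d] pl_zero[of "c - d"] by simp

definition integral :: "('a \<Rightarrow> complex) \<Rightarrow> bool" where "integral x \<longleftrightarrow> (\<exists>c. pl x c)"

lemma integralI: "pl x c \<Longrightarrow> integral x" by (auto simp: integral_def)

lemma integral_const: "integral (\<lambda>_. c)" by (rule integralI, rule R_const)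
lemma integral_add: "integral x \<Longrightarrow> integral y \<Longrightarrow> integral (\<lambda>s. x s + y s)"
  unfolding integral_def using R_add by blast
lemma integral_mult: "integral x \<Longrightarrow> integral y \<Longrightarrow> integral (\<lambda>s. x s * y s)"
  unfolding integral_def using R_mult by blast

text \<open>Membership in the ring generated by \<open>x\<close> over the functions with a residue:
  \<open>y\<close> is a polynomial expression in \<open>x\<close> and \<open>Q\<close> is the
  residue of that expression. The same \<open>y\<close> may have several \<open>Q\<close>, and this
  ambiguity is what can prevent \<open>x\<close> from having a value. The bound \<open>n\<close> may
  exceed the degree of \<open>Q\<close>, as coefficients of residue 0 are allowed.\<close>

definition ext_rel :: "('a \<Rightarrow> complex) \<Rightarrow> complex poly \<Rightarrow> ('a \<Rightarrow> complex) \<Rightarrow> bool" where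
  "ext_rel x Q y \<longleftrightarrow> (\<exists>n q. (\<forall>i. pl (q i) (coeff Q i)) \<and> (\<forall>i>n. q i = (\<lambda>_. 0)) \<and>
     y = (\<lambda>s. \<Sum>i\<le>n. q i s * x s ^ i))"

lemma ext_rel_const: "pl y c \<Longrightarrow> ext_rel x [:c:] y"
  unfolding ext_rel_def
  by (intro exI[of _ 0] exI[of _ "\<lambda>i. if i = 0 then y else (\<lambda>_. 0)"])
     (auto simp: coeff_pCons R_const split: nat.split)

lemma ext_rel_var: "ext_rel x [:0, 1:] x"
  unfolding ext_rel_def
  by (intro exI[of _ 1] exI[of _ "\<lambda>i. if i = 1 then (\<lambda>_. 1) else (\<lambda>_. 0)"])
     (auto simp: coeff_pCons R_const split: nat.split)

lemma ext_rel_add: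
  assumes "ext_rel x Q y" "ext_rel x Q' y'"
  shows "ext_rel x (Q + Q') (\<lambda>s. y s + y' s)"
proof -
  from assms obtain n q n' q' where
    1: "\<And>i. pl (q i) (coeff Q i)" "\<And>i. i > n \<Longrightarrow> q i = (\<lambda>_. 0)" "y = (\<lambda>s. \<Sum>i\<le>n. q i s * x s ^ i)" and
    2: "\<And>i. pl (q' i) (coeff Q' i)" "\<And>i. i > n' \<Longrightarrow> q' i = (\<lambda>_. 0)" "y' = (\<lambda>s. \<Sum>i\<le>n'. q' i s * x s ^ i)"
    unfolding ext_rel_def by blast
  have "(\<Sum>i\<le>n. q i s * x s ^ i) = (\<Sum>i\<le>max n n'. q i s * x s ^ i)" for s
    by (rule sum.mono_neutral_left) (auto simp: 1(2))
  moreover have "(\<Sum>i\<le>n'. q' i s * x s ^ i) = (\<Sum>i\<le>max n n'. q' i s * x s ^ i)" for s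
    by (rule sum.mono_neutral_left) (auto simp: 2(2))
  ultimately show ?thesis unfolding ext_rel_def
    by (intro exI[of _ "max n n'"] exI[of _ "\<lambda>i s. q i s + q' i s"])
       (auto simp: 1 2 R_add sum.distrib distrib_right)
qed

lemma ext_rel_sum:
  "(\<And>i. i \<in> S \<Longrightarrow> ext_rel x (Q i) (y i)) \<Longrightarrow> ext_rel x (\<Sum>i\<in>S. Q i) (\<lambda>s. \<Sum>i\<in>S. y i s)"
proof (induction S rule: infinite_finite_induct)
  case (insert a S) then show ?case by (simp add: ext_rel_add)
qed (use ext_rel_const[OF R_const[of 0]] in simp_all)

lemma ext_rel_var_mult:
  assumes "ext_rel x Q y"
  shows "ext_rel x (pCons 0 Q) (\<lambda>s. x s * y s)"
proof -
  from assms obtain n q where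
    1: "\<And>i. pl (q i) (coeff Q i)" "\<And>i. i > n \<Longrightarrow> q i = (\<lambda>_. 0)" "y = (\<lambda>s. \<Sum>i\<le>n. q i s * x s ^ i)"
    unfolding ext_rel_def by blast
  have "(\<Sum>i\<le>Suc n. (case i of 0 \<Rightarrow> \<lambda>_. 0 | Suc i \<Rightarrow> q i) s * x s ^ i) = x s * y s" for s
    by (subst sum.atMost_Suc_shift) (simp add: 1 sum_distrib_left mult_ac)
  then show ?thesis unfolding ext_rel_def
    by (intro exI[of _ "Suc n"] exI[of _ "\<lambda>i. case i of 0 \<Rightarrow> \<lambda>_. 0 | Suc i \<Rightarrow> q i"])
       (auto simp: coeff_pCons 1 R_const split: nat.split)
qed

lemma ext_rel_pl_mult:
  assumes "pl z c" "ext_rel x Q y"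
  shows "ext_rel x (smult c Q) (\<lambda>s. z s * y s)"
proof -
  from assms(2) obtain n q where
    1: "\<And>i. pl (q i) (coeff Q i)" "\<And>i. i > n \<Longrightarrow> q i = (\<lambda>_. 0)" "y = (\<lambda>s. \<Sum>i\<le>n. q i s * x s ^ i)"
    unfolding ext_rel_def by blast
  then show ?thesis using assms(1) unfolding ext_rel_def
    by (intro exI[of _ n] exI[of _ "\<lambda>i s. z s * q i s"]) (auto simp: R_mult sum_distrib_left mult.assoc)
qed

lemma ext_rel_mult:
  assumes "ext_rel x Q y" "ext_rel x Q' y'"
  shows "ext_rel x (Q * Q') (\<lambda>s. y s * y' s)"
proof -
  have *: "ext_rel x (monom 1 i * Q') (\<lambda>s. x s ^ i * y' s)" for i
  proof (induction i)
    case 0 show ?case using assms(2) by simp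
  next
    case (Suc i)
    from ext_rel_var_mult[OF Suc] show ?case by (simp add: monom_Suc mult.assoc)
  qed
  from assms obtain n q where
    1: "\<And>i. pl (q i) (coeff Q i)" "\<And>i. i > n \<Longrightarrow> q i = (\<lambda>_. 0)" "y = (\<lambda>s. \<Sum>i\<le>n. q i s * x s ^ i)"
    unfolding ext_rel_def by blast
  \<comment> \<open>Beyond \<open>n\<close> the coefficient functions are zero, and the zero
    function has no residue but 0; so \<open>Q\<close> is a sum over the same range.\<close>
  have "coeff Q i = 0" if "i > n" for i using 1(1)[of i] 1(2)[OF that] pl_zero by simp
  then have "Q = (\<Sum>i\<le>n. monom (coeff Q i) i)"
    by (intro poly_eqI) (auto simp: coeff_sum not_le)
  also have "\<dots> = (\<Sum>i\<le>n. smult (coeff Q i) (monom 1 i))" by (simp add: smult_monom)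
  finally have "Q * Q' = (\<Sum>i\<le>n. smult (coeff Q i) (monom 1 i * Q'))"
    by (metis (no_types, lifting) mult_smult_left sum.cong sum_distrib_right)
  moreover have "ext_rel x (\<Sum>i\<le>n. smult (coeff Q i) (monom 1 i * Q')) (\<lambda>s. \<Sum>i\<le>n. q i s * (x s ^ i * y' s))"
    by (intro ext_rel_sum ext_rel_pl_mult 1 *)
  moreover have "(\<lambda>s. \<Sum>i\<le>n. q i s * (x s ^ i * y' s)) = (\<lambda>s. y s * y' s)"
    by (simp add: 1 sum_distrib_right mult.assoc)
  ultimately show ?thesis by simp
qed

text \<open>
  If no value can be assigned to \<open>x\<close>, then the residues of the relations satisfied by \<open>x\<close> have no
  common root, hence generate the unit ideal.
\<close>

lemma nonintegral_relation:
  assumes "\<not> integral x"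
  shows "ext_rel x 1 (\<lambda>_. 0)"
proof -
  define J where "J = {Q. ext_rel x Q (\<lambda>_. 0)}"
  have J_mult: "P * Q \<in> J" if "Q \<in> J" for P Q
  proof -
    have "ext_rel x P (\<lambda>s. poly P (x s))"
    proof (induction P)
      case 0 show ?case using ext_rel_const[OF R_const[of 0]] by simp
    next
      case (pCons a P)
      from ext_rel_add[OF ext_rel_const[OF R_const[of a]] ext_rel_var_mult[OF pCons.IH]]
      show ?case by simp
    qed
    from ext_rel_mult[OF this, of Q "\<lambda>_. 0"] that show ?thesis by (simp add: J_def)
  qed
  have J_diff: "P - Q \<in> J" if "P \<in> J" "Q \<in> J" for P Q
    using ext_rel_add[of x P "\<lambda>_. 0" "-1 * Q" "\<lambda>_. 0"] J_mult[OF that(2), of "-1"] that(1) by (simp add: J_def)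
  \<comment> \<open>A common root \<open>c\<close> would let every expression be evaluated at
    \<open>x = c\<close> consistently, and so extend the graph by a value for \<open>x\<close>,
    against maximality.\<close>
  have no_root: "\<exists>Q\<in>J. poly Q c \<noteq> 0" for c
  proof (rule ccontr)
    assume "\<not> ?thesis"
    then have root: "\<And>Q. ext_rel x Q (\<lambda>_. 0) \<Longrightarrow> poly Q c = 0" by (auto simp: J_def)
    define \<Delta> where "\<Delta> = {(y, poly Q c) | y Q. ext_rel x Q y}"
    have \<Delta>I: "(y, d) \<in> \<Delta>" if "ext_rel x Q y" "d = poly Q c" for y d Q
      using that by (auto simp: \<Delta>_def)
    have "place_graph \<Delta>"
    proof (rule place_graphI)
      show "(\<lambda>_. d, d) \<in> \<Delta>" for d by (rule \<Delta>I[OF ext_rel_const[OF R_const]]) simp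
      show "(\<lambda>s. y s + y' s, d + d') \<in> \<Delta>" if "(y, d) \<in> \<Delta>" "(y', d') \<in> \<Delta>" for y d y' d'
        using that by (auto simp: \<Delta>_def intro!: ext_rel_add simp flip: poly_add)
      show "(\<lambda>s. y s * y' s, d * d') \<in> \<Delta>" if "(y, d) \<in> \<Delta>" "(y', d') \<in> \<Delta>" for y d y' d'
        using that by (auto simp: \<Delta>_def intro!: ext_rel_mult simp flip: poly_mult)
      show "d = 0" if "(\<lambda>_. 0, d) \<in> \<Delta>" for d using that root by (auto simp: \<Delta>_def)
    qed
    moreover have "\<Gamma> \<subseteq> \<Delta>"
    proof
      fix p assume "p \<in> \<Gamma>"
      then show "p \<in> \<Delta>" by (cases p) (auto simp: pl_def intro!: \<Delta>I[OF ext_rel_const])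
    qed
    ultimately have "\<Delta> = \<Gamma>" by (rule maximal)
    moreover have "(x, c) \<in> \<Delta>" by (rule \<Delta>I[OF ext_rel_var]) simp
    ultimately show False using assms by (auto simp: integral_def pl_def)
  qed
  \<comment> \<open>\<open>J\<close> is an ideal of the univariate polynomials over a field, so a
    nonzero element of least degree generates it.\<close>
  define nz where "nz = {Q \<in> J. Q \<noteq> 0}"
  obtain Q0 where "Q0 \<in> J" "poly Q0 0 \<noteq> 0" using no_root[of 0] by blast
  then have "Q0 \<in> nz" by (auto simp: nz_def)
  then obtain Q where Q: "Q \<in> nz" and min: "\<And>P. P \<in> nz \<Longrightarrow> degree Q \<le> degree P"
    using ex_has_least_nat[of "\<lambda>Q. Q \<in> nz" Q0 degree] by blast
  have dvd: "Q dvd P" if "P \<in> J" for P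
  proof (rule ccontr)
    assume "\<not> Q dvd P"
    then have "P mod Q \<noteq> 0" by (simp add: dvd_eq_mod_eq_0)
    moreover have "P mod Q = P - (P div Q) * Q" by (simp add: minus_div_mult_eq_mod)
    ultimately have "P mod Q \<in> nz" using J_diff[OF that J_mult] Q by (simp add: nz_def)
    from min[OF this] show False using degree_mod_less[of Q P] \<open>P mod Q \<noteq> 0\<close> Q by (auto simp: nz_def)
  qed
  \<comment> \<open>A generator of positive degree has a root, which would be common to all of
    \<open>J\<close>.\<close>
  have "degree Q = 0"
  proof (rule ccontr)
    assume "degree Q \<noteq> 0"
    then have "\<not> constant (poly Q)" by (simp add: constant_degree)
    then obtain c where "poly Q c = 0" using fundamental_theorem_of_algebra by blast
    moreover obtain P where "P \<in> J" "poly P c \<noteq> 0" using no_root by blast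
    ultimately show False using dvd[of P] by (auto elim!: dvdE)
  qed
  then obtain a where "Q = [:a:]" by (rule degree_eq_zeroE)
  moreover from this have "a \<noteq> 0" using Q by (auto simp: nz_def)
  ultimately have "[:1 / a:] * Q = 1" by simp
  with J_mult[of Q "[:1 / a:]"] Q show ?thesis by (simp add: nz_def J_def)
qed

lemma nonintegralE:
  assumes "\<not> integral x"
  obtains n a where "n \<ge> 1" "pl (a 0) 1" "\<And>i. i > 0 \<Longrightarrow> pl (a i) 0" "\<And>s. (\<Sum>i\<le>n. a i s * x s ^ i) = 0"
proof -
  from nonintegral_relation[OF assms] obtain n q where
    1: "\<And>i. pl (q i) (coeff (1 :: complex poly) i)" "\<And>i. i > n \<Longrightarrow> q i = (\<lambda>_. 0)"
      "(\<lambda>_. 0) = (\<lambda>s. \<Sum>i\<le>n. q i s * x s ^ i)"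
    unfolding ext_rel_def by blast
  \<comment> \<open>Padding with one zero coefficient ensures a positive degree bound, which keeps
    the matrix used in \<open>integral_or_inverse\<close> nonempty.\<close>
  have "(\<Sum>i\<le>Suc n. q i s * x s ^ i) = 0" for s
    using fun_cong[OF 1(3), of s] 1(2)[of "Suc n"] by simp
  moreover have "pl (q 0) 1" using 1(1)[of 0] by simp
  moreover have "pl (q i) 0" if "i > 0" for i
    using 1(1)[of i] that by (cases i) (simp_all add: one_pCons)
  ultimately show ?thesis by (intro that[of "Suc n" q]) simp_all
qed

section \<open>Null sets, inverses and the ultrafilter of a place\<close>

definition ind :: "('a \<Rightarrow> bool) \<Rightarrow> 'a \<Rightarrow> complex" where "ind P s = (if P s then 1 else 0)"

text \<open>A nonintegral \<open>x\<close> satisfies a relation whose constant coefficient has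
  residue 1; off \<open>P\<close> this relation reduces to that coefficient being 0, which is
  impossible on a set of residue 1. Once \<open>x\<close> has a value, \<open>x = x * ind P\<close>
  forces the value 0.\<close>

lemma null_pl:
  assumes P: "pl (ind P) 0" and x: "\<And>s. \<not> P s \<Longrightarrow> x s = 0"
  shows "pl x 0"
proof -
  have "integral x"
  proof (rule ccontr)
    assume ni: "\<not> integral x"
    from nonintegralE[OF ni] obtain n a where
      a: "n \<ge> 1" "pl (a 0) 1" "\<And>i. i > 0 \<Longrightarrow> pl (a i) 0" "\<And>s. (\<Sum>i\<le>n. a i s * x s ^ i) = 0"
      by blast
    have "a 0 s = 0" if "\<not> P s" for s
    proof -
      have "(\<Sum>i\<le>n. a i s * x s ^ i) = (\<Sum>i\<le>n. if i = 0 then a i s else 0)"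
        by (rule sum.cong) (auto simp: x that)
      then show ?thesis using a(4)[of s] by simp
    qed
    then have "(\<lambda>s. (1 - ind P s) * a 0 s) = (\<lambda>_. 0)" by (auto simp: ind_def)
    moreover have "pl (\<lambda>s. (1 - ind P s) * a 0 s) ((1 - 0) * 1)" by (intro R_mult R_diff R_const P a)
    ultimately show False using pl_zero[of 1] by simp
  qed
  then obtain c where c: "pl x c" by (auto simp: integral_def)
  moreover have "pl (\<lambda>s. x s * ind P s) (c * 0)" by (intro R_mult c P)
  moreover have "(\<lambda>s. x s * ind P s) = x" using x by (auto simp: ind_def)
  ultimately show ?thesis using pl_unique by auto
qed

text \<open>
  The Sylvester matrix of the two relations has the identity as residue, but annihilates the vector
  of powers of \<open>x\<close>.
\<close>

lemma integral_or_inverse: "integral x \<or> integral (\<lambda>s. inverse (x s))"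
proof (rule ccontr)
  assume "\<not> ?thesis"
  then have ni: "\<not> integral x" "\<not> integral (\<lambda>s. inverse (x s))" by auto
  from nonintegralE[OF ni(1)] obtain n a where
    a: "n \<ge> 1" "pl (a 0) 1" "\<And>i. i > 0 \<Longrightarrow> pl (a i) 0" "\<And>s. (\<Sum>i\<le>n. a i s * x s ^ i) = 0"
    by blast
  from nonintegralE[OF ni(2)] obtain n' b where
    b: "n' \<ge> 1" "pl (b 0) 1" "\<And>i. i > 0 \<Longrightarrow> pl (b i) 0" "\<And>s. (\<Sum>i\<le>n'. b i s * inverse (x s) ^ i) = 0"
    by blast
  define N where "N = n' + n"
  \<comment> \<open>The first \<open>n'\<close> rows are the relation for \<open>x\<close> times
    \<open>x ^ i\<close>, the other \<open>n\<close> rows the relation for the inverse times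
    \<open>x ^ i\<close>. The diagonal carries \<open>a 0\<close> and \<open>b 0\<close>, the only
    coefficients with residue 1.\<close>
  define f where "f s i j = (if i < n' then (if i \<le> j \<and> j \<le> i + n then a (j - i) s else 0)
      else (if j \<le> i \<and> i \<le> j + n' then b (i - j) s else 0))" for s i j
  define M where "M s = mat N N (\<lambda>(i, j). f s i j)" for s
  have "pl (\<lambda>s. f s i j) (if i = j then 1 else 0)" for i j
    unfolding f_def using a(2,3) b(2,3)
    by (cases "i < n'"; cases "i \<le> j \<and> j \<le> i + n"; cases "j \<le> i \<and> i \<le> j + n'") (auto simp: R_const)
  then have "pl (\<lambda>s. det (M s)) (det (1\<^sub>m N))"
    by (intro R_det[of _ N]) (auto simp: M_def one_mat_def)
  \<comment> \<open>The factor \<open>a 0\<close> takes care of the zeros of \<open>x\<close>: there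
    powers of \<open>x\<close> and of its inverse cannot be exchanged, but the first relation gives
    \<open>a 0 s = 0\<close>.\<close>
  from R_mult[OF a(2) this] have "pl (\<lambda>s. a 0 s * det (M s)) 1" by simp
  moreover have "a 0 s * det (M s) = 0" for s
  proof (cases "x s = 0")
    case True
    have "(\<Sum>i\<le>n. a i s * x s ^ i) = (\<Sum>i\<le>n. if i = 0 then a i s else 0)"
      by (rule sum.cong) (auto simp: True)
    then show ?thesis using a(4)[of s] by simp
  next
    case False
    define v where "v = vec N (\<lambda>i. x s ^ i)"
    have v0: "v \<noteq> 0\<^sub>v N"
    proof
      assume "v = 0\<^sub>v N"
      then have "v $ 0 = 0" using a(1) by (simp add: N_def)
      then show False using a(1) by (simp add: v_def N_def)
    qed
    have row: "(\<Sum>j<N. f s i j * x s ^ j) = 0" if i: "i < N" for i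
    proof (cases "i < n'")
      case True
      have "(\<Sum>j<N. f s i j * x s ^ j) = (\<Sum>j\<in>{i..i + n}. f s i j * x s ^ j)"
        by (rule sum.mono_neutral_right) (use True in \<open>auto simp: f_def N_def\<close>)
      also have "\<dots> = (\<Sum>t\<le>n. f s i (i + t) * x s ^ (i + t))"
        by (rule sum.reindex_bij_witness[of _ "\<lambda>t. i + t" "\<lambda>j. j - i"]) auto
      also have "\<dots> = x s ^ i * (\<Sum>t\<le>n. a t s * x s ^ t)"
        by (simp add: f_def True power_add sum_distrib_left mult_ac)
      finally show ?thesis using a(4)[of s] by simp
    next
      case F: False
      have "(\<Sum>j<N. f s i j * x s ^ j) = (\<Sum>j\<in>{i - n'..i}. f s i j * x s ^ j)"
        by (rule sum.mono_neutral_right) (use F i in \<open>auto simp: f_def N_def\<close>)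
      also have "\<dots> = (\<Sum>t\<le>n'. f s i (i - t) * x s ^ (i - t))"
        by (rule sum.reindex_bij_witness[of _ "\<lambda>t. i - t" "\<lambda>j. i - j"]) (use F in auto)
      also have "\<dots> = (\<Sum>t\<le>n'. x s ^ i * (b t s * inverse (x s) ^ t))"
        by (rule sum.cong) (use F False in \<open>auto simp: f_def power_diff field_simps\<close>)
      also have "\<dots> = x s ^ i * (\<Sum>t\<le>n'. b t s * inverse (x s) ^ t)" by (simp add: sum_distrib_left)
      finally show ?thesis using b(4)[of s] by simp
    qed
    have "M s *\<^sub>v v = 0\<^sub>v N"
      by (rule eq_vecI) (use row in \<open>auto simp: M_def v_def scalar_prod_def atLeast0LessThan\<close>)
    moreover have "M s \<in> carrier_mat N N" "v \<in> carrier_vec N" by (auto simp: M_def v_def)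
    ultimately have "det (M s) = 0" using det_0_iff_vec_prod_zero_field v0 by blast
    then show ?thesis by simp
  qed
  ultimately have "pl (\<lambda>_. 0) 1" by simp
  then show False using pl_zero by fastforce
qed

text \<open>If \<open>inverse x\<close> were not integral, clearing denominators in its relation
  would give a relation for \<open>x\<close> with residue \<open>c ^ (n + 1)\<close>, which is not
  0.\<close>

lemma pl_inverse:
  assumes x: "pl x c" and c: "c \<noteq> 0"
  shows "pl (\<lambda>s. inverse (x s)) (inverse c)"
proof -
  have "integral (\<lambda>s. inverse (x s))"
  proof (rule ccontr)
    assume ni: "\<not> ?thesis"
    from nonintegralE[OF ni] obtain n b where b: "n \<ge> 1" "pl (b 0) 1" "\<And>i. i > 0 \<Longrightarrow> pl (b i) 0"
      "\<And>s. (\<Sum>i\<le>n. b i s * inverse (x s) ^ i) = 0" by blast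
    \<comment> \<open>One factor \<open>x s\<close> more than the denominators require makes every
      term vanish where \<open>x s = 0\<close>, so that the identity holds at all points.\<close>
    have "(\<Sum>i\<le>n. b i s * x s ^ (n - i + 1)) = 0" for s
    proof (cases "x s = 0")
      case False
      have "(\<Sum>i\<le>n. b i s * x s ^ (n - i + 1)) = (\<Sum>i\<le>n. x s ^ (n + 1) * (b i s * inverse (x s) ^ i))"
        by (rule sum.cong) (use False in \<open>auto simp: power_diff field_simps\<close>)
      also have "\<dots> = x s ^ (n + 1) * (\<Sum>i\<le>n. b i s * inverse (x s) ^ i)" by (simp only: sum_distrib_left)
      finally show ?thesis using b(4) by simp
    qed simp
    moreover have "pl (\<lambda>s. \<Sum>i\<le>n. b i s * x s ^ (n - i + 1)) (\<Sum>i\<le>n. (if i = 0 then 1 else 0) * c ^ (n - i + 1))"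
      by (intro R_sum R_mult R_power x) (use b in auto)
    ultimately have "(\<Sum>i\<le>n. (if i = 0 then 1 else 0) * c ^ (n - i + 1)) = 0" using pl_zero by simp
    moreover have "(\<Sum>i\<le>n. (if i = 0 then 1 else 0) * c ^ (n - i + 1)) = (\<Sum>i\<le>n. if i = 0 then c ^ (n + 1) else 0)"
      by (rule sum.cong) auto
    ultimately show False using c by simp
  qed
  then obtain d where d: "pl (\<lambda>s. inverse (x s)) d" by (auto simp: integral_def)
  \<comment> \<open>Since \<open>inverse 0 = 0\<close>, the identity
    \<open>x * inverse x * x = x\<close> holds everywhere, whereas \<open>x * inverse x = 1\<close>
    fails at the zeros of \<open>x\<close>.\<close>
  have "pl (\<lambda>s. x s * inverse (x s) * x s - x s) (c * d * c - c)" by (intro R_mult R_diff x d)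
  moreover have "(\<lambda>s. x s * inverse (x s) * x s - x s) = (\<lambda>_. 0)"
  proof
    fix s show "x s * inverse (x s) * x s - x s = 0" by (cases "x s = 0") simp_all
  qed
  ultimately have "c * d * c - c = 0" by (intro pl_zero) simp
  then have "d = inverse c" using c by (simp add: field_simps)
  with d show ?thesis by simp
qed

text \<open>These sets form an ultrafilter. The quotient of the functions by it is a field, and the
  place descends to that field; computing almost everywhere amounts to computing there.\<close>

definition ae :: "('a \<Rightarrow> bool) \<Rightarrow> bool" where "ae P \<longleftrightarrow> pl (ind P) 1"

text \<open>An indicator is its own \<open>inverse\<close>, hence integral by the valuation
  alternative, and its residue is idempotent.\<close>

lemma ind_cases: "pl (ind P) 0 \<or> pl (ind P) 1"
proof -
  have "(\<lambda>s. inverse (ind P s)) = ind P" by (auto simp: ind_def)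
  then obtain c where c: "pl (ind P) c" using integral_or_inverse[of "ind P"] by (auto simp: integral_def)
  have "(\<lambda>s. ind P s * ind P s) = ind P" by (auto simp: ind_def)
  with R_mult[OF c c] pl_unique[OF c, of "c * c"] have "c = c * c" by simp
  then show ?thesis using c by auto
qed

text \<open>The difference of the two functions is supported on a null set.\<close>

lemma ae_cong:
  assumes "ae P" "pl x c" "\<And>s. P s \<Longrightarrow> x s = y s"
  shows "pl y c"
proof -
  have "ind (\<lambda>s. \<not> P s) = (\<lambda>s. 1 - ind P s)" by (auto simp: ind_def)
  with R_diff[OF R_const[of 1], of "ind P" 1] assms(1) have "pl (ind (\<lambda>s. \<not> P s)) 0" by (simp add: ae_def)
  then have "pl (\<lambda>s. y s - x s) 0" by (rule null_pl) (use assms(3) in auto)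
  from R_add[OF assms(2) this] show ?thesis by simp
qed

lemma ae_mono:
  assumes P: "ae P" and "\<And>s. P s \<Longrightarrow> Q s"
  shows "ae Q"
  using ae_cong[OF P P[unfolded ae_def], of "ind Q"] assms(2) by (simp add: ae_def ind_def)

lemma ae_conj: "ae P \<Longrightarrow> ae Q \<Longrightarrow> ae (\<lambda>s. P s \<and> Q s)"
proof -
  assume "ae P" "ae Q"
  then have "pl (\<lambda>s. ind P s * ind Q s) (1 * 1)" unfolding ae_def by (rule R_mult)
  moreover have "(\<lambda>s. ind P s * ind Q s) = ind (\<lambda>s. P s \<and> Q s)" by (auto simp: ind_def)
  ultimately show ?thesis by (simp add: ae_def)
qed

lemma ae_integral_cong: "ae P \<Longrightarrow> integral x \<Longrightarrow> (\<And>s. P s \<Longrightarrow> x s = y s) \<Longrightarrow> integral y"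
  unfolding integral_def using ae_cong by blast

lemma ae_nonzero:
  assumes "pl x c" "c \<noteq> 0"
  shows "ae (\<lambda>s. x s \<noteq> 0)"
proof (rule ccontr)
  assume "\<not> ?thesis"
  then have "pl (ind (\<lambda>s. x s \<noteq> 0)) 0" using ind_cases ae_def by blast
  then have "pl x 0" by (rule null_pl) auto
  with assms pl_unique show False by blast
qed

lemma ae_or: "ae P \<or> ae (\<lambda>s. \<not> P s)"
proof (cases "ae P")
  case False
  then have "pl (ind P) 0" using ind_cases ae_def by blast
  from R_diff[OF R_const[of 1] this] have "pl (\<lambda>s. 1 - ind P s) 1" by simp
  moreover have "(\<lambda>s. 1 - ind P s) = ind (\<lambda>s. \<not> P s)" by (auto simp: ind_def)
  ultimately show ?thesis by (simp add: ae_def)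
qed simp

lemma not_ae_False: "\<not> ae (\<lambda>_. False)"
  unfolding ae_def ind_def using pl_zero[of 1] by auto

end

text \<open>All places used below arise in this way, from a special value that respects every
  relation holding identically on \<open>S\<close>.\<close>

lemma place_of_evaluation:
  fixes ev :: "'r::comm_ring_1 \<Rightarrow> 'a \<Rightarrow> complex" and ev0 :: "'r \<Rightarrow> complex"
  assumes "\<And>c. \<exists>p\<in>R. (\<forall>s\<in>S. ev p s = c) \<and> ev0 p = c"
    and "\<And>p q. p \<in> R \<Longrightarrow> q \<in> R \<Longrightarrow> p + q \<in> R \<and> (\<forall>s\<in>S. ev (p + q) s = ev p s + ev q s) \<and> ev0 (p + q) = ev0 p + ev0 q"
    and "\<And>p q. p \<in> R \<Longrightarrow> q \<in> R \<Longrightarrow> p * q \<in> R \<and> (\<forall>s\<in>S. ev (p * q) s = ev p s * ev q s) \<and> ev0 (p * q) = ev0 p * ev0 q"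
    and "\<And>p. p \<in> R \<Longrightarrow> (\<And>s. s \<in> S \<Longrightarrow> ev p s = 0) \<Longrightarrow> ev0 p = 0"
  shows "\<exists>\<Gamma>. place \<Gamma> \<and> (\<forall>x p. p \<in> R \<longrightarrow> (\<forall>s\<in>S. x s = ev p s) \<longrightarrow> place.pl \<Gamma> x (ev0 p)) \<and> place.ae \<Gamma> (\<lambda>s. s \<in> S)"
proof -
  from maximal_place_graph[OF place_graph_evaluation[of R S ev ev0, OF assms]] obtain \<Gamma> where
    \<Gamma>: "place_graph \<Gamma>" "{(x, ev0 p) | x p. p \<in> R \<and> (\<forall>s\<in>S. x s = ev p s)} \<subseteq> \<Gamma>"
    "\<forall>\<Delta>. place_graph \<Delta> \<longrightarrow> \<Gamma> \<subseteq> \<Delta> \<longrightarrow> \<Delta> = \<Gamma>" by blast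
  interpret place \<Gamma> by unfold_locales (use \<Gamma>(1,3) in auto)
  have pl: "pl x (ev0 p)" if "p \<in> R" "\<forall>s\<in>S. x s = ev p s" for x p
    using \<Gamma>(2) that by (auto simp: pl_def)
  obtain p where p: "p \<in> R" "\<forall>s\<in>S. ev p s = 1" "ev0 p = 1" using assms(1)[of 1] by blast
  have "ae (\<lambda>s. s \<in> S)"
    unfolding ae_def using pl[OF p(1), of "ind (\<lambda>s. s \<in> S)"] p by (simp add: ind_def)
  then show ?thesis using pl place_axioms by blast
qed

section \<open>Elementary divisors over a place\<close>

definition transvection :: "nat \<Rightarrow> nat \<Rightarrow> (nat \<Rightarrow> complex) \<Rightarrow> complex mat" where
  "transvection N r c = mat N N (\<lambda>(i, j). if i = j then 1 else if j = r then c i else 0)"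

lemma transvection_carrier [simp]: "transvection N r c \<in> carrier_mat N N" by (simp add: transvection_def)

lemma transvection_dim [simp]: "dim_row (transvection N r c) = N" "dim_col (transvection N r c) = N" by (simp_all add: transvection_def)

lemma transvection_mult:
  assumes "B \<in> carrier_mat N N" "i < N" "j < N" "r < N"
  shows "(transvection N r c * B) $$ (i, j) = B $$ (i, j) + (if i = r then 0 else c i * B $$ (r, j))"
proof -
  have "(transvection N r c * B) $$ (i, j) = (\<Sum>k<N. transvection N r c $$ (i, k) * B $$ (k, j))"
    using assms by (simp add: scalar_prod_def atLeast0LessThan transvection_def)
  also have "\<dots> = (\<Sum>k<N. (if k = i then B $$ (k, j) else 0) + (if k = r then (if i = r then 0 else c i * B $$ (k, j)) else 0))"
    by (rule sum.cong) (use assms in \<open>auto simp: transvection_def\<close>)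
  also have "\<dots> = B $$ (i, j) + (if i = r then 0 else c i * B $$ (r, j))"
    using assms by (simp add: sum.distrib)
  finally show ?thesis .
qed

text \<open>Column \<open>r\<close> is filled on one side of the diagonal only, so the matrix is
  triangular with ones on the diagonal.\<close>

lemma transvection_SL:
  assumes "(\<forall>i<N. i \<ge> r \<longrightarrow> c i = 0) \<or> (\<forall>i<N. i \<le> r \<longrightarrow> c i = 0)"
  shows "transvection N r c \<in> SL N"
proof -
  have "prod_list (diag_mat (transvection N r c)) = 1"
    unfolding prod_list_diag_prod by (rule prod.neutral) (auto simp: transvection_def)
  moreover have "det (transvection N r c) = prod_list (diag_mat (transvection N r c))"
    using assms
  proof
    assume "\<forall>i<N. i \<ge> r \<longrightarrow> c i = 0"
    then have "upper_triangular (transvection N r c)" by (intro upper_triangularI) (auto simp: transvection_def)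
    then show ?thesis by (rule det_upper_triangular[OF _ transvection_carrier])
  next
    assume "\<forall>i<N. i \<le> r \<longrightarrow> c i = 0"
    then show ?thesis by (intro det_lower_triangular[of N]) (auto simp: transvection_def)
  qed
  ultimately show ?thesis by (simp add: SL_def)
qed

lemma transpose_SL: "A \<in> SL N \<Longrightarrow> transpose_mat A \<in> SL N"
  by (auto simp: SL_def det_transpose)

lemma det_zero_row:
  assumes "A \<in> carrier_mat N N" "i < N" "\<And>j. j < N \<Longrightarrow> A $$ (i, j) = (0::complex)"
  shows "det A = 0"
  using laplace_expansion_row[OF assms(1,2)] assms(3) by simp

lemma det_mat_diag: "det (mat_diag N f) = (\<Prod>i<N. f i :: complex)"
proof -
  have "det (mat_diag N f) = prod_list (diag_mat (mat_diag N f))"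
    by (rule det_upper_triangular[of _ N]) (auto simp: mat_diag_def)
  also have "\<dots> = (\<Prod>i<N. f i)"
    unfolding prod_list_diag_prod by (rule prod.cong) (auto simp: mat_diag_def)
  finally show ?thesis .
qed

section \<open>Special linear matrices over the valuation ring\<close>

context place
begin

text \<open>Elements of the special linear group over the valuation ring. Determinant 1 is imposed
  at every \<open>s\<close> and not just almost everywhere, so that the facts about
  \<open>SL\<close> apply pointwise.\<close>

definition imat :: "nat \<Rightarrow> ('a \<Rightarrow> complex mat) \<Rightarrow> bool" where
  "imat N a \<longleftrightarrow> (\<forall>s. a s \<in> SL N) \<and> (\<forall>i<N. \<forall>j<N. integral (\<lambda>s. a s $$ (i, j)))"

definition residue :: "('a \<Rightarrow> complex) \<Rightarrow> complex" where "residue x = (SOME c. pl x c)"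

lemma pl_residue: "integral x \<Longrightarrow> pl x (residue x)"
  unfolding integral_def residue_def by (rule someI_ex)

definition rmat :: "nat \<Rightarrow> ('a \<Rightarrow> complex mat) \<Rightarrow> complex mat" where
  "rmat N a = mat N N (\<lambda>(i, j). residue (\<lambda>s. a s $$ (i, j)))"

lemma imat_pl: "imat N a \<Longrightarrow> i < N \<Longrightarrow> j < N \<Longrightarrow> pl (\<lambda>s. a s $$ (i, j)) (rmat N a $$ (i, j))"
  by (simp add: imat_def rmat_def pl_residue)

lemma rmat_carrier [simp]: "rmat N a \<in> carrier_mat N N" by (simp add: rmat_def)

lemma imat_carrier: "imat N a \<Longrightarrow> a s \<in> carrier_mat N N" by (simp add: imat_def SL_def)

lemma rmat_SL:
  assumes "imat N a"
  shows "rmat N a \<in> SL N"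
proof -
  have "pl (\<lambda>s. det (a s)) (det (rmat N a))"
    by (rule R_det[of _ N]) (use assms imat_pl imat_carrier in auto)
  moreover have "det (a s) = 1" for s using assms by (simp add: imat_def SL_def)
  ultimately have "pl (\<lambda>_. 1) (det (rmat N a))" by simp
  with pl_unique[OF this R_const] show ?thesis by (simp add: SL_def)
qed

lemma imat_mult:
  assumes "imat N a" "imat N b"
  shows "imat N (\<lambda>s. a s * b s)"
  unfolding imat_def
proof (intro conjI allI impI)
  show "a s * b s \<in> SL N" for s using assms by (simp add: imat_def SL_mult)
  fix i j assume ij: "i < N" "j < N"
  have "pl (\<lambda>s. (a s * b s) $$ (i, j)) ((rmat N a * rmat N b) $$ (i, j))"
    by (rule R_matmult[of _ N]) (use assms imat_pl imat_carrier ij in auto)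
  then show "integral (\<lambda>s. (a s * b s) $$ (i, j))" by (rule integralI)
qed

lemma imat_adj:
  assumes "imat N a"
  shows "imat N (\<lambda>s. adj_mat (a s))"
  unfolding imat_def
proof (intro conjI allI impI)
  show "adj_mat (a s) \<in> SL N" for s using assms by (simp add: imat_def SL_adj(1))
  fix i j assume ij: "i < N" "j < N"
  have "pl (\<lambda>s. adj_mat (a s) $$ (i, j)) (adj_mat (rmat N a) $$ (i, j))"
    by (rule R_adj[of _ N]) (use assms imat_pl imat_carrier ij in auto)
  then show "integral (\<lambda>s. adj_mat (a s) $$ (i, j))" by (rule integralI)
qed

lemma imat_transpose:
  assumes a: "imat N a"
  shows "imat N (\<lambda>s. transpose_mat (a s))"
proof -
  have "dim_row (a s) = N" "dim_col (a s) = N" for s using imat_carrier[OF a, of s] by auto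
  then show ?thesis using a by (auto simp: imat_def transpose_SL)
qed

lemma imat_one: "imat N (\<lambda>_. 1\<^sub>m N)"
  by (auto simp: imat_def SL_one integral_const)

lemma imat_transvection:
  assumes "\<And>i. i < N \<Longrightarrow> integral (\<lambda>s. c s i)"
    and "(\<forall>i<N. i \<ge> r \<longrightarrow> (\<forall>s. c s i = 0)) \<or> (\<forall>i<N. i \<le> r \<longrightarrow> (\<forall>s. c s i = 0))"
  shows "imat N (\<lambda>s. transvection N r (c s))"
  unfolding imat_def
proof (intro conjI allI impI)
  show "transvection N r (c s) \<in> SL N" for s by (rule transvection_SL) (use assms(2) in auto)
  fix i j assume "i < N" "j < N"
  then show "integral (\<lambda>s. transvection N r (c s) $$ (i, j))"
    using assms(1) by (cases "i = j"; cases "j = r") (auto simp: transvection_def integral_const)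
qed

text \<open>Only the transforming matrices are integral. The family \<open>A\<close> may have poles,
  and its elementary divisors are to measure them.\<close>

definition eqv :: "nat \<Rightarrow> ('a \<Rightarrow> complex mat) \<Rightarrow> ('a \<Rightarrow> complex mat) \<Rightarrow> bool" where
  "eqv N A B \<longleftrightarrow> (\<forall>s. A s \<in> carrier_mat N N) \<and>
     (\<exists>a b. imat N a \<and> imat N b \<and> (\<forall>s. B s = a s * A s * b s))"

lemma eqv_carrier:
  assumes "eqv N A B"
  shows "A s \<in> carrier_mat N N" "B s \<in> carrier_mat N N"
proof -
  from assms obtain a b where "imat N a" "imat N b" "B s = a s * A s * b s" "A s \<in> carrier_mat N N"
    unfolding eqv_def by blast
  then show "A s \<in> carrier_mat N N" "B s \<in> carrier_mat N N"
    using imat_carrier[of N a s] imat_carrier[of N b s] by auto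
qed

lemma eqv_refl:
  assumes "\<And>s. X s \<in> carrier_mat N N"
  shows "eqv N X X"
  using assms imat_one left_mult_one_mat[OF assms] right_mult_one_mat[OF assms] unfolding eqv_def
  by (intro conjI exI[of _ "\<lambda>_. 1\<^sub>m N"]) auto

lemma eqv_trans:
  assumes "eqv N A B" "eqv N B C"
  shows "eqv N A C"
proof -
  from assms obtain a b a' b' where *: "imat N a" "imat N b" "\<And>s. B s = a s * A s * b s"
    "imat N a'" "imat N b'" "\<And>s. C s = a' s * B s * b' s" "\<And>s. A s \<in> carrier_mat N N"
    unfolding eqv_def by metis
  have "C s = (a' s * a s) * A s * (b s * b' s)" for s
  proof -
    have c: "a s \<in> carrier_mat N N" "b s \<in> carrier_mat N N" "a' s \<in> carrier_mat N N"
      "b' s \<in> carrier_mat N N" "A s \<in> carrier_mat N N"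
      using * imat_carrier by blast+
    have 1: "a s * A s \<in> carrier_mat N N" "a' s * a s \<in> carrier_mat N N" using c by auto
    have 2: "a' s * (a s * A s) \<in> carrier_mat N N" using c 1 by auto
    have "a' s * (a s * A s * b s) * b' s = a' s * (a s * A s) * b s * b' s"
      by (simp add: assoc_mult_mat[OF c(3) 1(1) c(2)])
    also have "\<dots> = a' s * (a s * A s) * (b s * b' s)" by (rule assoc_mult_mat[OF 2 c(2) c(4)])
    also have "a' s * (a s * A s) = a' s * a s * A s" by (rule assoc_mult_mat[OF c(3,1,5), symmetric])
    finally show ?thesis using * by simp
  qed
  then show ?thesis using *(7) imat_mult[OF *(4,1)] imat_mult[OF *(2,5)] unfolding eqv_def
    by (intro conjI allI exI[of _ "\<lambda>s. a' s * a s"] exI[of _ "\<lambda>s. b s * b' s"]) assumption+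
qed

lemma eqv_transpose:
  assumes "eqv N A B"
  shows "eqv N (\<lambda>s. transpose_mat (A s)) (\<lambda>s. transpose_mat (B s))"
proof -
  from assms obtain a b where *: "imat N a" "imat N b" "\<And>s. B s = a s * A s * b s" "\<And>s. A s \<in> carrier_mat N N"
    unfolding eqv_def by blast
  have "transpose_mat (B s) = transpose_mat (b s) * transpose_mat (A s) * transpose_mat (a s)" for s
  proof -
    have c: "a s \<in> carrier_mat N N" "b s \<in> carrier_mat N N" "A s \<in> carrier_mat N N"
      using * imat_carrier by blast+
    have "transpose_mat (a s * A s * b s) = transpose_mat (b s) * (transpose_mat (A s) * transpose_mat (a s))"
      using transpose_mult[OF mult_carrier_mat[OF c(1,3)] c(2)] transpose_mult[OF c(1,3)] by simp
    also have "\<dots> = transpose_mat (b s) * transpose_mat (A s) * transpose_mat (a s)"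
      by (rule assoc_mult_mat[symmetric]) (use c in auto)
    finally show ?thesis by (simp add: *)
  qed
  then show ?thesis using * imat_transpose unfolding eqv_def
    by (intro conjI exI[of _ "\<lambda>s. transpose_mat (b s)"] exI[of _ "\<lambda>s. transpose_mat (a s)"]) auto
qed

lemma eqv_row_op:
  assumes A: "\<And>s. A s \<in> carrier_mat N N" and r: "r < N" and c: "\<And>i. i < N \<Longrightarrow> integral (\<lambda>s. c s i)"
    "(\<forall>i<N. i \<ge> r \<longrightarrow> (\<forall>s. c s i = 0)) \<or> (\<forall>i<N. i \<le> r \<longrightarrow> (\<forall>s. c s i = 0))"
  shows "eqv N A (\<lambda>s. mat N N (\<lambda>(i, j). A s $$ (i, j) + (if i = r then 0 else c s i * A s $$ (r, j))))"
proof -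
  have "mat N N (\<lambda>(i, j). A s $$ (i, j) + (if i = r then 0 else c s i * A s $$ (r, j))) = transvection N r (c s) * A s * 1\<^sub>m N" for s
  proof -
    have "transvection N r (c s) * A s \<in> carrier_mat N N" using A[of s] by (simp add: mult_carrier_mat[OF transvection_carrier])
    then have "transvection N r (c s) * A s * 1\<^sub>m N = transvection N r (c s) * A s" by (rule right_mult_one_mat)
    moreover have "mat N N (\<lambda>(i, j). A s $$ (i, j) + (if i = r then 0 else c s i * A s $$ (r, j))) = transvection N r (c s) * A s"
      using carrier_matD[OF A[of s]] transvection_mult[OF A _ _ r] by (intro eq_matI) (simp_all del: index_mult_mat(1))
    ultimately show ?thesis by simp
  qed
  then show ?thesis using A imat_transvection[OF c] imat_one unfolding eqv_def
    by (intro conjI allI exI[of _ "\<lambda>s. transvection N r (c s)"] exI[of _ "\<lambda>_. 1\<^sub>m N"]) assumption+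
qed

text \<open>A plain transposition has determinant -1. With a sign it is a product of three
  transvections.\<close>

lemma eqv_swap_rows:
  assumes A: "\<And>s. A s \<in> carrier_mat N N" and r: "p < r" "r < N"
  shows "eqv N A (\<lambda>s. mat N N (\<lambda>(i, j). if i = p then A s $$ (r, j) else if i = r then - A s $$ (p, j) else A s $$ (i, j)))"
proof -
  define B where "B s = mat N N (\<lambda>(i, j). A s $$ (i, j) + (if i = r then 0 else (if i = p then 1 else 0) * A s $$ (r, j)))" for s
  define C where "C s = mat N N (\<lambda>(i, j). B s $$ (i, j) + (if i = p then 0 else (if i = r then - 1 else 0) * B s $$ (p, j)))" for s
  define D where "D s = mat N N (\<lambda>(i, j). C s $$ (i, j) + (if i = r then 0 else (if i = p then 1 else 0) * C s $$ (r, j)))" for s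
  have i: "integral (\<lambda>s. if i = p then 1 else 0)" "integral (\<lambda>s. if i = r then - 1 else 0)" for i :: nat by (rule integral_const)+
  have "eqv N A B" unfolding B_def
    by (rule eqv_row_op[where c="\<lambda>s i. if i = p then 1 else 0"]) (use A r i in auto)
  moreover have "eqv N B C" unfolding C_def
    by (rule eqv_row_op[where c="\<lambda>s i. if i = r then - 1 else 0"]) (use r i in \<open>auto simp: B_def\<close>)
  moreover have "eqv N C D" unfolding D_def
    by (rule eqv_row_op[where c="\<lambda>s i. if i = p then 1 else 0"]) (use r i in \<open>auto simp: C_def\<close>)
  ultimately have "eqv N A D" using eqv_trans by blast
  moreover have "D = (\<lambda>s. mat N N (\<lambda>(i, j). if i = p then A s $$ (r, j) else if i = r then - A s $$ (p, j) else A s $$ (i, j)))"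
  proof (intro ext eq_matI)
    fix s i j
    assume "i < dim_row (mat N N (\<lambda>(i, j). if i = p then A s $$ (r, j) else if i = r then - A s $$ (p, j) else A s $$ (i, j)))"
      "j < dim_col (mat N N (\<lambda>(i, j). if i = p then A s $$ (r, j) else if i = r then - A s $$ (p, j) else A s $$ (i, j)))"
    then have "i < N" "j < N" by auto
    then show "D s $$ (i, j) = mat N N (\<lambda>(i, j). if i = p then A s $$ (r, j) else if i = r then - A s $$ (p, j) else A s $$ (i, j)) $$ (i, j)"
      using r by (auto simp: D_def C_def B_def)
  qed (simp_all add: D_def)
  ultimately show ?thesis by simp
qed

section \<open>Pivoting and diagonalisation\<close>

lemma ae_ball: "finite S \<Longrightarrow> (\<And>i. i \<in> S \<Longrightarrow> ae (P i)) \<Longrightarrow> ae (\<lambda>s. \<forall>i\<in>S. P i s)"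
proof (induction S rule: finite_induct)
  case empty
  have "ind (\<lambda>_. True) = (\<lambda>_. 1)" by (auto simp: ind_def)
  then show ?case using R_const[of 1] by (simp add: ae_def)
next
  case (insert i S)
  then show ?case using ae_conj[of "P i" "\<lambda>s. \<forall>i\<in>S. P i s"] by simp
qed

lemma ae_all_less: "(\<And>i. i < (N::nat) \<Longrightarrow> ae (P i)) \<Longrightarrow> ae (\<lambda>s. \<forall>i<N. P i s)"
  by (rule ae_mono[OF ae_ball[OF finite_lessThan[of N], of P]]) auto

lemma ae_exists: "ae P \<Longrightarrow> \<exists>s. P s"
  using ae_mono[of P "\<lambda>_. False"] not_ae_False by blast

lemma null_integral: "ae (\<lambda>s. x s = 0) \<Longrightarrow> integral x"
  by (rule ae_integral_cong[of _ "\<lambda>_. 0"]) (auto intro: integral_const)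

text \<open>Divisibility is total over a valuation ring, so some element of a finite set divides all
  the others.\<close>

lemma pivot_exists:
  assumes "finite S" "S \<noteq> {}" "\<And>i. i \<in> S \<Longrightarrow> ae (\<lambda>s. x i s \<noteq> 0)"
  shows "\<exists>p\<in>S. \<forall>i\<in>S. integral (\<lambda>s. x i s * inverse (x p s))"
  using assms
proof (induction S rule: finite_ne_induct)
  case (singleton a)
  have "integral (\<lambda>s. x a s * inverse (x a s))"
    by (rule ae_integral_cong[OF singleton(1)[of a] integral_const[of 1]]) auto
  then show ?case by simp
next
  case (insert a S)
  then obtain p where p: "p \<in> S" "\<And>i. i \<in> S \<Longrightarrow> integral (\<lambda>s. x i s * inverse (x p s))" by auto
  have aa: "integral (\<lambda>s. x a s * inverse (x a s))"
    by (rule ae_integral_cong[OF insert.prems[of a] integral_const[of 1]]) auto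
  consider "integral (\<lambda>s. x a s * inverse (x p s))" | "integral (\<lambda>s. inverse (x a s * inverse (x p s)))"
    using integral_or_inverse by blast
  then show ?case
  proof cases
    case 1 then show ?thesis using p by auto
  next
    case 2
    have "integral (\<lambda>s. x i s * inverse (x a s))" if "i \<in> S" for i
      by (rule ae_integral_cong[OF insert.prems[of p] integral_mult[OF p(2)[OF that] 2]])
         (use p(1) in auto)
    then show ?thesis using aa by auto
  qed
qed

text \<open>
  Complete pivoting, from the last row and column upwards, so that every elementary divisor divides
  those with smaller index.
\<close>

definition red :: "nat \<Rightarrow> nat \<Rightarrow> ('a \<Rightarrow> complex mat) \<Rightarrow> bool" where
  "red N r B \<longleftrightarrow> ae (\<lambda>s. \<forall>i<N. \<forall>j<N. i \<noteq> j \<longrightarrow> r \<le> i \<or> r \<le> j \<longrightarrow> B s $$ (i, j) = 0)"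

text \<open>The pivot divides the whole leading block, so the multipliers that clear its row and
  column are integral. The clause quantified over \<open>x\<close> records that common divisors of
  the block survive the step; it transports divisibility by earlier pivots to the final
  diagonal.\<close>

lemma red_step:
  assumes B: "\<And>s. B s \<in> carrier_mat N N" and red: "red N (Suc r) B" and r: "r < N"
    and det: "ae (\<lambda>s. det (B s) \<noteq> 0)"
  shows "\<exists>C. eqv N B C \<and> red N r C \<and> (\<forall>i s. r < i \<longrightarrow> i < N \<longrightarrow> C s $$ (i, i) = B s $$ (i, i)) \<and>
    (\<forall>i<r. \<forall>j<r. integral (\<lambda>s. C s $$ (i, j) * inverse (C s $$ (r, r)))) \<and>
    (\<forall>x. (\<forall>i\<le>r. \<forall>j\<le>r. integral (\<lambda>s. B s $$ (i, j) * inverse (x s))) \<longrightarrow>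
       (\<forall>i\<le>r. \<forall>j\<le>r. integral (\<lambda>s. C s $$ (i, j) * inverse (x s))))"
proof -
  \<comment> \<open>Only entries that are nonzero almost everywhere can serve as pivots; by
    \<open>ae_or\<close> every other entry of the block vanishes almost everywhere.\<close>
  define T where "T = {(i, j). i \<le> r \<and> j \<le> r \<and> ae (\<lambda>s. B s $$ (i, j) \<noteq> 0)}"
  have "finite T" by (rule finite_subset[of _ "{..r} \<times> {..r}"]) (auto simp: T_def)
  moreover have "T \<noteq> {}"
  proof
    assume "T = {}"
    \<comment> \<open>Row \<open>r\<close> would be zero almost everywhere, beyond the block because
      of \<open>red\<close>, and the determinant with it.\<close>
    then have "ae (\<lambda>s. B s $$ (r, j) = 0)" if "j < Suc r" for j
      using ae_or[of "\<lambda>s. B s $$ (r, j) \<noteq> 0"] that by (auto simp: T_def less_Suc_eq_le)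
    from ae_conj[OF det ae_conj[OF red[unfolded red_def] ae_all_less[OF this]]]
    have "\<exists>s. det (B s) \<noteq> 0 \<and> (\<forall>i<N. \<forall>j<N. i \<noteq> j \<longrightarrow> Suc r \<le> i \<or> Suc r \<le> j \<longrightarrow> B s $$ (i, j) = 0) \<and>
        (\<forall>j<Suc r. B s $$ (r, j) = 0)" by (rule ae_exists)
    then obtain s where s: "det (B s) \<noteq> 0" "\<And>i j. i < N \<Longrightarrow> j < N \<Longrightarrow> i \<noteq> j \<Longrightarrow> Suc r \<le> j \<Longrightarrow> B s $$ (i, j) = 0"
      "\<And>j. j < Suc r \<Longrightarrow> B s $$ (r, j) = 0" by blast
    have "B s $$ (r, j) = 0" if "j < N" for j using s(2,3) r that by (cases "j < Suc r") auto
    with det_zero_row[OF B r] s(1) show False by blast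
  qed
  ultimately have "\<exists>pq\<in>T. \<forall>ij\<in>T. integral (\<lambda>s. B s $$ ij * inverse (B s $$ pq))"
    by (rule pivot_exists[of T "\<lambda>ij s. B s $$ ij"]) (auto simp: T_def)
  then obtain p q where pq: "(p, q) \<in> T"
    "\<And>i j. (i, j) \<in> T \<Longrightarrow> integral (\<lambda>s. B s $$ (i, j) * inverse (B s $$ (p, q)))"
    by fast
  then have pq': "p \<le> r" "q \<le> r" "ae (\<lambda>s. B s $$ (p, q) \<noteq> 0)" by (auto simp: T_def)
  have piv: "integral (\<lambda>s. B s $$ (i, j) * inverse (B s $$ (p, q)))" if "i \<le> r" "j \<le> r" for i j
  proof (cases "(i, j) \<in> T")
    case False
    then have "ae (\<lambda>s. B s $$ (i, j) = 0)" using ae_or[of "\<lambda>s. B s $$ (i, j) \<noteq> 0"] that by (auto simp: T_def)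
    from ae_mono[OF this] show ?thesis by (intro null_integral) auto
  qed (rule pq)
  define B1 where "B1 = (if p = r then B else (\<lambda>s. mat N N (\<lambda>(i, j). if i = p then B s $$ (r, j) else if i = r then - B s $$ (p, j) else B s $$ (i, j))))"
  have e1: "eqv N B B1" unfolding B1_def using eqv_swap_rows[OF B, of p r] eqv_refl[OF B] pq'(1) r by auto
  have B1: "B1 s $$ (i, j) = (if p = r then B s $$ (i, j) else if i = p then B s $$ (r, j) else if i = r then - B s $$ (p, j) else B s $$ (i, j))"
    if "i < N" "j < N" for i j s using that by (auto simp: B1_def)
  note B1c = eqv_carrier(2)[OF e1]
  define B2 where "B2 = (if q = r then B1 else (\<lambda>s. transpose_mat (mat N N (\<lambda>(i, j).
    if i = q then transpose_mat (B1 s) $$ (r, j) else if i = r then - transpose_mat (B1 s) $$ (q, j) else transpose_mat (B1 s) $$ (i, j)))))"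
  have e2: "eqv N B1 B2"
  proof (cases "q = r")
    case True then show ?thesis using eqv_refl[OF B1c] by (simp add: B2_def)
  next
    case False
    have "eqv N (\<lambda>s. transpose_mat (B1 s)) (\<lambda>s. mat N N (\<lambda>(i, j).
      if i = q then transpose_mat (B1 s) $$ (r, j) else if i = r then - transpose_mat (B1 s) $$ (q, j) else transpose_mat (B1 s) $$ (i, j)))"
      by (rule eqv_swap_rows) (use False pq' r B1c in auto)
    from eqv_transpose[OF this] show ?thesis using False by (simp add: B2_def)
  qed
  have d1: "dim_row (B1 s) = N" "dim_col (B1 s) = N" for s using B1c[of s] by auto
  have B2: "B2 s $$ (i, j) = (if q = r then B1 s $$ (i, j) else if j = q then B1 s $$ (i, r) else if j = r then - B1 s $$ (i, q) else B1 s $$ (i, j))"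
    if "i < N" "j < N" for i j s using that r pq' by (auto simp: B2_def d1)
  note B2c = eqv_carrier(2)[OF e2]
  \<comment> \<open>The sign that the pivot picks up in the two signed swaps; it is its own
    inverse.\<close>
  define sg where "sg = (if p = r then 1 else - 1) * (if q = r then 1 else - 1 :: complex)"
  have B2rr: "B2 s $$ (r, r) = sg * B s $$ (p, q)" for s
    using r pq' by (auto simp: B2 B1 sg_def)
  have sg: "sg * sg = 1" "inverse sg = sg" by (auto simp: sg_def)
  \<comment> \<open>Up to sign the swaps only permute the entries of the block, so its common
    divisors stay the same.\<close>
  have B2_form: "\<exists>c i' j'. c * c = 1 \<and> i' \<le> r \<and> j' \<le> r \<and> (\<forall>s. B2 s $$ (i, j) = c * B s $$ (i', j'))"
    if "i \<le> r" "j \<le> r" for i j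
  proof -
    have 1: "\<exists>c i'. c * c = (1::complex) \<and> i' \<le> r \<and> (\<forall>s. \<forall>j<N. B1 s $$ (i, j) = c * B s $$ (i', j))" if "i \<le> r" for i
    proof (cases "p \<noteq> r \<and> i = r")
      case True
      then show ?thesis using pq' r by (intro exI[of _ "- 1"] exI[of _ p]) (auto simp: B1)
    next
      case False
      then show ?thesis using pq' r that
        by (intro exI[of _ 1] exI[of _ "if p \<noteq> r \<and> i = p then r else i"]) (auto simp: B1)
    qed
    have 2: "\<exists>c j'. c * c = (1::complex) \<and> j' \<le> r \<and> (\<forall>s. B2 s $$ (i, j) = c * B1 s $$ (i, j'))"
    proof (cases "q \<noteq> r \<and> j = r")
      case True
      then show ?thesis using pq' r that by (intro exI[of _ "- 1"] exI[of _ q]) (auto simp: B2)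
    next
      case False
      then show ?thesis using pq' r that
        by (intro exI[of _ 1] exI[of _ "if q \<noteq> r \<and> j = q then r else j"]) (auto simp: B2)
    qed
    from 1[OF \<open>i \<le> r\<close>] 2 obtain c i' c' j' where *: "c * c = 1" "i' \<le> r" "\<And>s j. j < N \<Longrightarrow> B1 s $$ (i, j) = c * B s $$ (i', j)"
      "c' * c' = 1" "j' \<le> r" "\<And>s. B2 s $$ (i, j) = c' * B1 s $$ (i, j')" by blast
    have "(c' * c) * (c' * c) = (c' * c') * (c * c)" by simp
    then show ?thesis using * r by (intro exI[of _ "c' * c"] exI[of _ i'] exI[of _ j']) auto
  qed
  have B2_div: "integral (\<lambda>s. B2 s $$ (i, j) * inverse (x s))"
    if x: "\<forall>i\<le>r. \<forall>j\<le>r. integral (\<lambda>s. B s $$ (i, j) * inverse (x s))" and ij: "i \<le> r" "j \<le> r" for x i j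
  proof -
    from B2_form[OF ij] obtain c i' j' where "i' \<le> r" "j' \<le> r" "\<And>s. B2 s $$ (i, j) = c * B s $$ (i', j')" by blast
    then show ?thesis using integral_mult[OF integral_const[of c]] x by (simp add: mult.assoc)
  qed
  have B2_piv: "integral (\<lambda>s. B2 s $$ (i, j) * inverse (B2 s $$ (r, r)))" if "i \<le> r" "j \<le> r" for i j
  proof (rule B2_div[OF _ that], intro allI impI)
    fix i j assume "i \<le> r" "j \<le> r"
    from integral_mult[OF integral_const[of sg] piv[OF this]]
    show "integral (\<lambda>s. B s $$ (i, j) * inverse (B2 s $$ (r, r)))" by (simp add: B2rr sg mult_ac)
  qed
  have B2_nz: "ae (\<lambda>s. B2 s $$ (r, r) \<noteq> 0)"
    by (rule ae_mono[OF pq'(3)]) (use sg in \<open>auto simp: B2rr\<close>)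
  have B2_red: "red N (Suc r) B2" unfolding red_def
  proof (rule ae_mono[OF red[unfolded red_def]], intro allI impI)
    fix s i j assume *: "\<forall>i<N. \<forall>j<N. i \<noteq> j \<longrightarrow> Suc r \<le> i \<or> Suc r \<le> j \<longrightarrow> B s $$ (i, j) = 0"
      and ij: "i < N" "j < N" "i \<noteq> j" "Suc r \<le> i \<or> Suc r \<le> j"
    have "B1 s $$ (i, j) = 0" if "i < N" "j < N" "i \<noteq> j" "Suc r \<le> i \<or> Suc r \<le> j" for i j
      using that * pq' r by (auto simp: B1)
    then show "B2 s $$ (i, j) = 0" using ij pq' r by (auto simp: B2)
  qed
  \<comment> \<open>Only indices below \<open>r\<close> have to be cleared, as row and column
    \<open>r\<close> already vanish beyond the pivot by \<open>red N (Suc r)\<close>.\<close>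
  define c where "c s i = (if i < r then - (B2 s $$ (i, r) * inverse (B2 s $$ (r, r))) else 0)" for s i
  define B3 where "B3 s = mat N N (\<lambda>(i, j). B2 s $$ (i, j) + (if i = r then 0 else c s i * B2 s $$ (r, j)))" for s
  have ci: "integral (\<lambda>s. c s i)" for i
    using integral_mult[OF integral_const[of "- 1"] B2_piv[of i r]] by (cases "i < r") (simp_all add: c_def integral_const)
  have e3: "eqv N B2 B3" unfolding B3_def
    by (rule eqv_row_op[OF B2c r ci]) (auto simp: c_def)
  have B3: "B3 s $$ (i, j) = B2 s $$ (i, j) + (if i = r then 0 else c s i * B2 s $$ (r, j))" if "i < N" "j < N" for s i j
    using that by (simp add: B3_def)
  note B3c = eqv_carrier(2)[OF e3]
  define c' where "c' s j = (if j < r then - (B2 s $$ (r, j) * inverse (B2 s $$ (r, r))) else 0)" for s j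
  have ci': "integral (\<lambda>s. c' s i)" for i
    using integral_mult[OF integral_const[of "- 1"] B2_piv[of r i]] by (cases "i < r") (simp_all add: c'_def integral_const)
  define C where "C s = transpose_mat (mat N N (\<lambda>(i, j). transpose_mat (B3 s) $$ (i, j) + (if i = r then 0 else c' s i * transpose_mat (B3 s) $$ (r, j))))" for s
  have e4: "eqv N B3 C"
  proof -
    have "eqv N (\<lambda>s. transpose_mat (B3 s)) (\<lambda>s. mat N N (\<lambda>(i, j). transpose_mat (B3 s) $$ (i, j) + (if i = r then 0 else c' s i * transpose_mat (B3 s) $$ (r, j))))"
      by (rule eqv_row_op[OF _ r ci']) (use B3c in \<open>auto simp: c'_def\<close>)
    from eqv_transpose[OF this] show ?thesis by (simp add: C_def[abs_def])
  qed
  have d3: "dim_row (B3 s) = N" "dim_col (B3 s) = N" for s using B3c[of s] by auto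
  have C: "C s $$ (i, j) = B3 s $$ (i, j) + (if j = r then 0 else c' s j * B3 s $$ (i, r))" if "i < N" "j < N" for s i j
    using that r by (simp add: C_def d3)
  have Crr: "C s $$ (r, r) = B2 s $$ (r, r)" for s using r by (simp add: C B3)
  have Cred: "red N r C" unfolding red_def
  proof (rule ae_mono[OF ae_conj[OF B2_nz B2_red[unfolded red_def]]], intro allI impI)
    fix s i j
    assume *: "B2 s $$ (r, r) \<noteq> 0 \<and> (\<forall>i<N. \<forall>j<N. i \<noteq> j \<longrightarrow> Suc r \<le> i \<or> Suc r \<le> j \<longrightarrow> B2 s $$ (i, j) = 0)"
      and ij: "i < N" "j < N" "i \<noteq> j" "r \<le> i \<or> r \<le> j"
    have z: "B2 s $$ (i, j) = 0" if "i < N" "j < N" "i \<noteq> j" "r < i \<or> r < j" for i j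
      using *[THEN conjunct2, rule_format, of i j] that by (auto simp: Suc_le_eq)
    have B3r: "B3 s $$ (i, r) = 0" if "i < N" "i \<noteq> r" for i
      using that r * z[of i r] by (cases "i < r") (auto simp: B3 c_def)
    have B3z: "B3 s $$ (i, j) = 0" if "i < N" "j < N" "i \<noteq> j" "r < i \<or> r < j" for i j
      using that r z by (cases "r < i") (auto simp: B3 c_def)
    consider "i = r" "j < r" | "i = r" "r < j" | "j = r" | "r < i" | "j > r" using ij by linarith
    then show "C s $$ (i, j) = 0"
    proof cases
      case 1 then show ?thesis using r ij * by (simp add: C B3 c'_def)
    next
      case 2 then show ?thesis using r ij z by (simp add: C B3 c'_def)
    next
      case 3 then show ?thesis using ij B3r by (simp add: C)
    next
      case 4 then show ?thesis using ij B3z B3r by (simp add: C)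
    next
      case 5 then show ?thesis using ij B3z by (simp add: C c'_def)
    qed
  qed
  have C_div: "integral (\<lambda>s. C s $$ (i, j) * inverse (x s))"
    if x: "\<And>i j. i \<le> r \<Longrightarrow> j \<le> r \<Longrightarrow> integral (\<lambda>s. B2 s $$ (i, j) * inverse (x s))" and ij: "i \<le> r" "j \<le> r" for x i j
  proof -
    have 3: "integral (\<lambda>s. B3 s $$ (i, j) * inverse (x s))" if "j \<le> r" for j
    proof (cases "i = r")
      case True then show ?thesis using x[OF ij(1) that] r that by (simp add: B3)
    next
      case False
      have "integral (\<lambda>s. B2 s $$ (i, j) * inverse (x s) + c s i * (B2 s $$ (r, j) * inverse (x s)))"
        by (intro integral_add integral_mult x ci ij that) simp
      then show ?thesis using False r that ij by (simp add: B3 algebra_simps)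
    qed
    show ?thesis
    proof (cases "j = r")
      case True then show ?thesis using 3[OF ij(2)] r ij by (simp add: C)
    next
      case False
      have "integral (\<lambda>s. B3 s $$ (i, j) * inverse (x s) + c' s j * (B3 s $$ (i, r) * inverse (x s)))"
        by (intro integral_add integral_mult 3 ci' ij) simp
      then show ?thesis using False r ij by (simp add: C algebra_simps)
    qed
  qed
  have "eqv N B C" using e1 e2 e3 e4 eqv_trans by blast
  moreover have "integral (\<lambda>s. C s $$ (i, j) * inverse (C s $$ (r, r)))" if "i \<le> r" "j \<le> r" for i j
    unfolding Crr by (rule C_div[OF B2_piv that])
  moreover have "\<forall>x. (\<forall>i\<le>r. \<forall>j\<le>r. integral (\<lambda>s. B s $$ (i, j) * inverse (x s))) \<longrightarrow>
       (\<forall>i\<le>r. \<forall>j\<le>r. integral (\<lambda>s. C s $$ (i, j) * inverse (x s)))"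
    using C_div B2_div by blast
  moreover have "C s $$ (i, i) = B s $$ (i, i)" if "r < i" "i < N" for i s
    using that pq' r by (simp add: C B3 B2 B1 c_def c'_def)
  ultimately show ?thesis using Cred by (intro exI[of _ C]) auto
qed

lemma eqv_det:
  assumes "eqv N A B"
  shows "det (B s) = det (A s)"
proof -
  from assms obtain a b where *: "imat N a" "imat N b" "B s = a s * A s * b s" "A s \<in> carrier_mat N N"
    unfolding eqv_def by blast
  then have "a s \<in> carrier_mat N N" "det (a s) = 1" "b s \<in> carrier_mat N N" "det (b s) = 1"
    by (auto simp: imat_def SL_def)
  then show ?thesis using det_mult[of "a s * A s" N "b s"] det_mult[of "a s" N "A s"] * by simp
qed

text \<open>The clause on \<open>x\<close> strengthens the induction: with \<open>x\<close> the
  pivot just found, it shows that the diagonal entries of smaller index, which are determined later,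
  are divisible by that pivot.\<close>

lemma red_diagonal:
  assumes "r \<le> N" "\<And>s. B s \<in> carrier_mat N N" "red N r B" "ae (\<lambda>s. det (B s) \<noteq> 0)"
  shows "\<exists>C. eqv N B C \<and> red N 0 C \<and>
    (\<forall>i<r. \<forall>j<r. i < j \<longrightarrow> integral (\<lambda>s. C s $$ (i, i) * inverse (C s $$ (j, j)))) \<and>
    (\<forall>i. r \<le> i \<longrightarrow> i < N \<longrightarrow> ae (\<lambda>s. C s $$ (i, i) = B s $$ (i, i))) \<and>
    (\<forall>x. (\<forall>i<r. \<forall>j<r. integral (\<lambda>s. B s $$ (i, j) * inverse (x s))) \<longrightarrow>
       (\<forall>i<r. integral (\<lambda>s. C s $$ (i, i) * inverse (x s))))"
  using assms
proof (induction r arbitrary: B)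
  case 0
  have "ae (\<lambda>_. True)" using ae_ball[of "{}" "\<lambda>_ _. True"] by simp
  then show ?case using 0 eqv_refl[OF 0(2)] by (intro exI[of _ B]) simp
next
  case (Suc r)
  then have r: "r < N" by simp
  from red_step[OF Suc.prems(2,3) r Suc.prems(4)] obtain B' where
    B': "eqv N B B'" "red N r B'" "\<forall>i s. r < i \<longrightarrow> i < N \<longrightarrow> B' s $$ (i, i) = B s $$ (i, i)"
    "\<forall>i<r. \<forall>j<r. integral (\<lambda>s. B' s $$ (i, j) * inverse (B' s $$ (r, r)))"
    "\<forall>x. (\<forall>i\<le>r. \<forall>j\<le>r. integral (\<lambda>s. B s $$ (i, j) * inverse (x s))) \<longrightarrow>
       (\<forall>i\<le>r. \<forall>j\<le>r. integral (\<lambda>s. B' s $$ (i, j) * inverse (x s)))"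
    by (elim exE conjE) (rule that)
  have "ae (\<lambda>s. det (B' s) \<noteq> 0)" using Suc.prems(4) by (simp add: eqv_det[OF B'(1)])
  from Suc.IH[OF less_imp_le[OF r] eqv_carrier(2)[OF B'(1)] B'(2) this] obtain C where
    C: "eqv N B' C" "red N 0 C"
    "\<forall>i<r. \<forall>j<r. i < j \<longrightarrow> integral (\<lambda>s. C s $$ (i, i) * inverse (C s $$ (j, j)))"
    "\<forall>i. r \<le> i \<longrightarrow> i < N \<longrightarrow> ae (\<lambda>s. C s $$ (i, i) = B' s $$ (i, i))"
    "\<forall>x. (\<forall>i<r. \<forall>j<r. integral (\<lambda>s. B' s $$ (i, j) * inverse (x s))) \<longrightarrow>
       (\<forall>i<r. integral (\<lambda>s. C s $$ (i, i) * inverse (x s)))"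
    by (elim exE conjE) (rule that)
  have Cr: "ae (\<lambda>s. C s $$ (r, r) = B' s $$ (r, r))" by (rule C(4)[rule_format]) (use r in auto)
  have "integral (\<lambda>s. C s $$ (i, i) * inverse (C s $$ (j, j)))" if "i < Suc r" "j < Suc r" "i < j" for i j
  proof (cases "j = r")
    case True
    have "integral (\<lambda>s. C s $$ (i, i) * inverse (B' s $$ (r, r)))"
      by (rule C(5)[rule_format]) (use B'(4) that True in auto)
    from ae_integral_cong[OF Cr this] show ?thesis unfolding True by simp
  next
    case False then show ?thesis by (intro C(3)[rule_format]) (use that in auto)
  qed
  moreover have "ae (\<lambda>s. C s $$ (i, i) = B s $$ (i, i))" if "Suc r \<le> i" "i < N" for i
    using C(4)[rule_format, of i] B'(3)[rule_format, of i] that by simp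
  moreover have "integral (\<lambda>s. C s $$ (i, i) * inverse (x s))"
    if x: "\<forall>i<Suc r. \<forall>j<Suc r. integral (\<lambda>s. B s $$ (i, j) * inverse (x s))" and i: "i < Suc r" for x i
  proof -
    have x': "integral (\<lambda>s. B' s $$ (i, j) * inverse (x s))" if "i \<le> r" "j \<le> r" for i j
      by (rule B'(5)[rule_format, OF _ that]) (use x in \<open>simp add: less_Suc_eq_le\<close>)
    show ?thesis
    proof (cases "i = r")
      case True
      show ?thesis unfolding True by (rule ae_integral_cong[OF Cr x'[of r r]]) simp_all
    next
      case False
      show ?thesis by (rule C(5)[rule_format]) (use x' i False in auto)
    qed
  qed
  ultimately show ?case using C(2) eqv_trans[OF B'(1) C(1)]
    by (intro exI[of _ C] conjI allI impI) assumption+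
qed

text \<open>The Cartan decomposition over a valuation ring of any rank. The integrality of
  \<open>d i / d j\<close> for \<open>i < j\<close> places the orders of the divisors in the
  dominant Weyl chamber.\<close>

lemma elementary_divisors:
  assumes A: "\<And>s. A s \<in> carrier_mat N N" and det: "ae (\<lambda>s. det (A s) = 1)"
  shows "\<exists>a b d. imat N a \<and> imat N b \<and> ae (\<lambda>s. A s = a s * mat_diag N (d s) * b s) \<and>
    (\<forall>i<N. ae (\<lambda>s. d s i \<noteq> 0)) \<and> (\<forall>i<N. \<forall>j<N. i < j \<longrightarrow> integral (\<lambda>s. d s i * inverse (d s j))) \<and>
    ae (\<lambda>s. (\<Prod>i<N. d s i) = 1)"
proof -
  have "red N N A" unfolding red_def
    using ae_ball[of "{}" "\<lambda>_ _. True"] by (auto elim: ae_mono)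
  moreover have "ae (\<lambda>s. det (A s) \<noteq> 0)" by (rule ae_mono[OF det]) simp
  ultimately have "\<exists>C. eqv N A C \<and> red N 0 C \<and>
    (\<forall>i<N. \<forall>j<N. i < j \<longrightarrow> integral (\<lambda>s. C s $$ (i, i) * inverse (C s $$ (j, j))))"
    using red_diagonal[of N N A] A by (elim meta_impE exE conjE) (simp_all, metis)
  then obtain C where C: "eqv N A C" "red N 0 C"
    "\<forall>i<N. \<forall>j<N. i < j \<longrightarrow> integral (\<lambda>s. C s $$ (i, i) * inverse (C s $$ (j, j)))"
    by (elim exE conjE) (rule that)
  from C(1) obtain a b where ab: "imat N a" "imat N b" "\<And>s. C s = a s * A s * b s"
    unfolding eqv_def by blast
  define d where "d s i = C s $$ (i, i)" for s i
  have diag: "ae (\<lambda>s. C s = mat_diag N (d s))"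
  proof (rule ae_mono[OF C(2)[unfolded red_def]])
    fix s assume *: "\<forall>i<N. \<forall>j<N. i \<noteq> j \<longrightarrow> 0 \<le> i \<or> 0 \<le> j \<longrightarrow> C s $$ (i, j) = 0"
    show "C s = mat_diag N (d s)"
      by (rule eq_matI) (use eqv_carrier(2)[OF C(1), of s] * in \<open>auto simp: mat_diag_def d_def\<close>)
  qed
  have prod: "ae (\<lambda>s. (\<Prod>i<N. d s i) = 1)"
    by (rule ae_mono[OF ae_conj[OF diag det]]) (metis det_mat_diag eqv_det[OF C(1)])
  have "ae (\<lambda>s. A s = adj_mat (a s) * mat_diag N (d s) * adj_mat (b s))"
  proof (rule ae_mono[OF diag])
    fix s assume *: "C s = mat_diag N (d s)"
    have SL: "a s \<in> SL N" "b s \<in> SL N" using ab by (auto simp: imat_def)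
    note c = SL_carrier[OF SL(1)] SL_carrier[OF SL(2)] SL_carrier[OF SL_adj(1)[OF SL(1)]] SL_carrier[OF SL_adj(1)[OF SL(2)]]
    have "adj_mat (a s) * C s * adj_mat (b s) = adj_mat (a s) * (a s * (A s * b s)) * adj_mat (b s)"
      by (simp add: ab assoc_mult_mat[OF c(1) A c(2)])
    also have "adj_mat (a s) * (a s * (A s * b s)) = adj_mat (a s) * a s * (A s * b s)"
      by (rule assoc_mult_mat[symmetric]) (use c A[of s] in auto)
    also have "\<dots> = A s * b s" unfolding SL_adj(3)[OF SL(1)]
      by (rule left_mult_one_mat) (use c A[of s] in auto)
    also have "A s * b s * adj_mat (b s) = A s * (b s * adj_mat (b s))"
      by (rule assoc_mult_mat[OF A c(2,4)])
    also have "\<dots> = A s" unfolding SL_adj(2)[OF SL(2)] by (rule right_mult_one_mat[OF A])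
    finally show "A s = adj_mat (a s) * mat_diag N (d s) * adj_mat (b s)" by (simp add: *)
  qed
  moreover have "ae (\<lambda>s. d s i \<noteq> 0)" if "i < N" for i
    by (rule ae_mono[OF prod]) (metis that finite_lessThan lessThan_iff prod_zero zero_neq_one)
  moreover have "integral (\<lambda>s. d s i * inverse (d s j))" if "i < N" "j < N" "i < j" for i j
    using C(3)[rule_format, OF that] by (simp add: d_def)
  ultimately show ?thesis using imat_adj[OF ab(1)] imat_adj[OF ab(2)] prod
    by (intro exI[of _ "\<lambda>s. adj_mat (a s)"] exI[of _ "\<lambda>s. adj_mat (b s)"] exI[of _ d] conjI allI impI) assumption+
qed

end

section \<open>Total preorders on integer vectors\<close>

text \<open>
  \<open>P w\<close> is to be read as \<open>0 \<le> w\<close> in a totally preordered group that contains the integer vectors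
  with \<open>N\<close> coordinates.
\<close>

locale total_cone =
  fixes N :: nat and P :: "(nat \<Rightarrow> int) \<Rightarrow> bool"
  assumes P_cong: "(\<And>i. i < N \<Longrightarrow> w i = w' i) \<Longrightarrow> P w \<Longrightarrow> P w'"
    and P_add: "P w \<Longrightarrow> P w' \<Longrightarrow> P (\<lambda>i. w i + w' i)"
    and P_total: "P w \<or> P (\<lambda>i. - w i)"
begin

lemma P_zero: "P (\<lambda>_. 0)" using P_total[of "\<lambda>_. 0"] by simp

lemma P_smult: "P w \<Longrightarrow> P (\<lambda>i. int n * w i)"
proof (induction n)
  case (Suc n)
  then show ?case using P_add[of w "\<lambda>i. int n * w i"] by (simp add: algebra_simps)
qed (simp add: P_zero)

lemma P_smult': "a \<ge> 0 \<Longrightarrow> P w \<Longrightarrow> P (\<lambda>i. a * w i)"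
  using P_smult[of w "nat a"] by simp

lemma P_smult_iff: "a > 0 \<Longrightarrow> P (\<lambda>i. a * w i) \<longleftrightarrow> P w"
proof
  assume a: "a > 0" "P (\<lambda>i. a * w i)"
  show "P w"
  proof (rule ccontr)
    assume "\<not> P w"
    then have "P (\<lambda>i. - w i)" using P_total[of w] by simp
    then have "P (\<lambda>i. (a - 1) * - w i)" using a by (intro P_smult') auto
    from P_add[OF a(2) this] show False using \<open>\<not> P w\<close> by (simp add: algebra_simps)
  qed
qed (simp add: P_smult')

end

text \<open>The restriction of the preorder to vectors with last coordinate 0, on which the
  elimination recurses.\<close>

lemma total_cone_pred: "total_cone (Suc N) P \<Longrightarrow> total_cone N (\<lambda>w. P (w(N := 0)))"
proof
  assume "total_cone (Suc N) P"
  then interpret total_cone "Suc N" P .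
  show "P (w'(N := 0))" if "\<And>i. i < N \<Longrightarrow> w i = w' i" "P (w(N := 0))" for w w'
    by (rule P_cong[OF _ that(2)]) (use that(1) in \<open>auto simp: less_Suc_eq\<close>)
  show "P ((\<lambda>i. w i + w' i)(N := 0))" if "P (w(N := 0))" "P (w'(N := 0))" for w w'
    by (rule P_cong[OF _ P_add[OF that]]) auto
  have "(\<lambda>i. - (w(N := 0)) i) = (\<lambda>i. - w i)(N := 0)" for w :: "nat \<Rightarrow> int" by auto
  then show "P (w(N := 0)) \<or> P ((\<lambda>i. - w i)(N := 0))" for w
    using P_total[of "w(N := 0)"] by simp
qed

lemma rat_gap:
  fixes A B :: "rat set"
  assumes "finite A" "finite B" "\<And>a b. a \<in> A \<Longrightarrow> b \<in> B \<Longrightarrow> a < b"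
  shows "\<exists>x. (\<forall>a\<in>A. a < x) \<and> (\<forall>b\<in>B. x < b)"
proof (cases "A = {} \<or> B = {}")
  case True
  show ?thesis
  proof (cases "A = {}")
    case True
    have "\<exists>x. \<forall>b\<in>B. x < b"
    proof (cases "B = {}")
      case False
      then have "\<forall>b\<in>B. Min B - 1 < b"
        using assms(2) by (metis Min_le diff_less_eq less_add_one order_le_less_trans)
      then show ?thesis ..
    qed simp
    with True show ?thesis by simp
  next
    case False
    with True have "B = {}" by simp
    have "\<forall>a\<in>A. a < Max A + 1"
      using assms(1) by (metis Max_ge less_add_one order_le_less_trans)
    with \<open>B = {}\<close> show ?thesis by blast
  qed
next
  case False
  then have "Max A < Min B" using assms by auto
  then obtain x where "Max A < x" "x < Min B" using dense by blast
  then have "\<forall>a\<in>A. a < x" "\<forall>b\<in>B. x < b" using assms False by auto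
  then show ?thesis by blast
qed

definition dotp :: "nat \<Rightarrow> (nat \<Rightarrow> int) \<Rightarrow> (nat \<Rightarrow> rat) \<Rightarrow> rat" where
  "dotp N w x = (\<Sum>i<N. of_int (w i) * x i)"

lemma dotp_diff: "dotp N (\<lambda>i. w i - w' i) x = dotp N w x - dotp N w' x"
  by (simp add: dotp_def algebra_simps sum_subtractf)
lemma dotp_uminus: "dotp N (\<lambda>i. - w i) x = - dotp N w x"
  by (simp add: dotp_def sum_negf)
lemma dotp_smult: "dotp N (\<lambda>i. a * w i) x = of_int a * dotp N w x"
  by (simp add: dotp_def sum_distrib_left mult.assoc)

text \<open>
  Fourier--Motzkin elimination: the last coordinate of \<open>x\<close> has to lie in the same position relative
  to the roots of the linear conditions as the last basis vector does for the preorder.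
\<close>

lemma total_cone_weights:
  assumes "total_cone N P" "finite D"
  shows "\<exists>x. \<forall>w\<in>D. P w \<longleftrightarrow> dotp N w x \<ge> 0"
  using assms
proof (induction N arbitrary: P D)
  case 0
  then interpret total_cone 0 P by simp
  have "P w" for w by (rule P_cong[OF _ P_zero]) simp
  then show ?case by (simp add: dotp_def)
next
  case (Suc N)
  interpret total_cone "Suc N" P by fact
  note cong = P_cong
  define sgn_norm where "sgn_norm w = (if w N < 0 then (\<lambda>i. - w i) else w)" for w :: "nat \<Rightarrow> int"
  \<comment> \<open>Closing under negation makes it enough to treat vectors whose last coordinate is
    positive or zero.\<close>
  define D1 where "D1 = D \<union> (\<lambda>w i. - w i) ` D"
  define E where "E = {w \<in> D1. w N > 0}"
  \<comment> \<open>The combination of \<open>w\<close> and \<open>u\<close> in which the last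
    coordinate cancels; its sign compares the roots \<open>r w\<close> and \<open>r u\<close>
    below.\<close>
  define Q where "Q w u i = u N * w i - w N * u i" for w u :: "nat \<Rightarrow> int" and i
  define D' where "D' = D1 \<union> (\<lambda>(w, u). Q w u) ` (E \<times> E)"
  have fin: "finite D'" "finite E" using Suc.prems(2) by (auto simp: D'_def D1_def E_def)
  from Suc.IH[OF total_cone_pred[OF Suc.prems(1)] fin(1)] obtain x where
    x: "\<And>w. w \<in> D' \<Longrightarrow> P (w(N := 0)) \<longleftrightarrow> dotp N w x \<ge> 0" by blast
  \<comment> \<open>The value of the new coordinate at which the pairing with \<open>w\<close>
    becomes 0. For positive \<open>w N\<close> the pairing is nonnegative exactly from there
    upwards.\<close>
  define r where "r w = - dotp N w x / of_int (w N)" for w :: "nat \<Rightarrow> int"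
  have Q: "P (Q w u) \<longleftrightarrow> r w \<le> r u" if "w \<in> E" "u \<in> E" for w u
  proof -
    have pos: "w N > 0" "u N > 0" using that by (auto simp: E_def)
    have "(Q w u)(N := 0) = Q w u" by (rule ext) (simp add: Q_def)
    then have "P (Q w u) \<longleftrightarrow> dotp N (Q w u) x \<ge> 0"
      using x[of "Q w u"] that by (auto simp: D'_def)
    also have "dotp N (Q w u) x = of_int (u N) * dotp N w x - of_int (w N) * dotp N u x"
      unfolding Q_def by (simp add: dotp_diff dotp_smult)
    also have "\<dots> \<ge> 0 \<longleftrightarrow> r w \<le> r u"
      using pos by (simp add: r_def field_simps)
    finally show ?thesis .
  qed
  have Q_wu: "P (Q w u)" if "w \<in> E" "u \<in> E" "P w" "P (\<lambda>i. - u i)" for w u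
  proof -
    have pos: "w N > 0" "u N > 0" using that by (auto simp: E_def)
    have "P (\<lambda>i. u N * w i + w N * - u i)" by (intro P_add P_smult') (use pos that in auto)
    then show ?thesis by (auto simp: Q_def algebra_simps elim: P_cong[rotated])
  qed
  have Q_strict: "r w < r u" if "w \<in> E" "u \<in> E" "P w" "\<not> P u" for w u
  proof -
    have pos: "w N > 0" "u N > 0" using that by (auto simp: E_def)
    have "\<not> P (Q u w)"
    proof
      assume "P (Q u w)"
      moreover have "P (\<lambda>i. u N * w i)" by (rule P_smult') (use pos that in auto)
      ultimately have "P (\<lambda>i. Q u w i + u N * w i)" by (rule P_add)
      then have "P (\<lambda>i. w N * u i)" by (simp add: Q_def)
      then show False using pos that P_smult_iff by blast
    qed
    then show ?thesis using Q[OF that(2,1)] by simp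
  qed
  have Q_strict': "r w < r u" if "w \<in> E" "u \<in> E" "\<not> P (\<lambda>i. - w i)" "P (\<lambda>i. - u i)" for w u
  proof -
    have pos: "w N > 0" "u N > 0" using that by (auto simp: E_def)
    have "\<not> P (Q u w)"
    proof
      assume "P (Q u w)"
      moreover have "P (\<lambda>i. w N * - u i)" by (rule P_smult') (use pos that in auto)
      ultimately have "P (\<lambda>i. Q u w i + w N * - u i)" by (rule P_add)
      then have "P (\<lambda>i. u N * - w i)" by (simp add: Q_def algebra_simps)
      then show False using pos that P_smult_iff[of "u N" "\<lambda>i. - w i"] by simp
    qed
    then show ?thesis using Q[OF that(2,1)] by simp
  qed
  \<comment> \<open>If some \<open>w\<close> in \<open>E\<close> is equivalent to 0, its root is the
    only choice for \<open>y\<close>. Otherwise the roots of the nonnegative vectors lie strictly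
    below those of the remaining ones, and any rational in the gap will do.\<close>
  have "\<exists>y. \<forall>w\<in>E. (P w \<longleftrightarrow> r w \<le> y) \<and> (P (\<lambda>i. - w i) \<longleftrightarrow> y \<le> r w)"
  proof (cases "\<exists>w\<in>E. P w \<and> P (\<lambda>i. - w i)")
    case True
    then obtain w where w: "w \<in> E" "P w" "P (\<lambda>i. - w i)" by blast
    have "(P u \<longleftrightarrow> r u \<le> r w) \<and> (P (\<lambda>i. - u i) \<longleftrightarrow> r w \<le> r u)" if u: "u \<in> E" for u
      using Q_wu[OF u w(1) _ w(3)] Q_wu[OF w(1) u w(2)] Q[OF w(1) u] Q[OF u w(1)]
        Q_strict[OF w(1) u w(2)] Q_strict'[OF u w(1) _ w(3)] by (meson leD)
    then show ?thesis by blast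
  next
    case False
    have "\<exists>y. (\<forall>a\<in>r ` {w \<in> E. P w}. a < y) \<and> (\<forall>b\<in>r ` {w \<in> E. \<not> P w}. y < b)"
      by (rule rat_gap) (use fin Q_strict in auto)
    then obtain y where y: "\<And>w. w \<in> E \<Longrightarrow> P w \<Longrightarrow> r w < y" "\<And>w. w \<in> E \<Longrightarrow> \<not> P w \<Longrightarrow> y < r w"
      by auto
    have "(P w \<longleftrightarrow> r w \<le> y) \<and> (P (\<lambda>i. - w i) \<longleftrightarrow> y \<le> r w)" if "w \<in> E" for w
      using y(1)[OF that] y(2)[OF that] False that P_total[of w] by force
    then show ?thesis by blast
  qed
  then obtain y where y: "\<And>w. w \<in> E \<Longrightarrow> P w \<longleftrightarrow> r w \<le> y" "\<And>w. w \<in> E \<Longrightarrow> P (\<lambda>i. - w i) \<longleftrightarrow> y \<le> r w"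
    by blast
  have d: "dotp (Suc N) w (x(N := y)) = dotp N w x + of_int (w N) * y" for w
    by (simp add: dotp_def)
  have "P w \<longleftrightarrow> dotp (Suc N) w (x(N := y)) \<ge> 0" if w: "w \<in> D" for w
  proof (cases "w N" "0 :: int" rule: linorder_cases)
    case equal
    then have "w(N := 0) = w" by auto
    then show ?thesis using x[of w] w by (simp add: D'_def D1_def d equal)
  next
    case greater
    with w have "w \<in> E" by (simp add: E_def D1_def)
    from y(1)[OF this] greater show ?thesis by (simp add: d r_def field_simps) linarith
  next
    case less
    with w have e: "(\<lambda>i. - w i) \<in> E" by (simp add: E_def D1_def)
    have "r (\<lambda>i. - w i) = r w" by (simp add: r_def dotp_uminus)
    with y(2)[OF e] less show ?thesis by (simp add: d r_def field_simps) linarith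
  qed
  then show ?case by blast
qed

section \<open>Extreme rays and the fundamental set\<close>

definition lin_fun :: "(('i \<Rightarrow> rat) \<Rightarrow> rat) \<Rightarrow> bool" where
  "lin_fun \<phi> \<longleftrightarrow> (\<forall>x y t. \<phi> (\<lambda>i. x i + t * y i) = \<phi> x + t * \<phi> y)"

lemma lin_funD: "lin_fun \<phi> \<Longrightarrow> \<phi> (\<lambda>i. x i + t * y i) = \<phi> x + t * \<phi> y"
  by (simp add: lin_fun_def)

lemma lin_fun_0: "lin_fun \<phi> \<Longrightarrow> \<phi> (\<lambda>_. 0) = 0"
  using lin_funD[of \<phi> "\<lambda>_. 0" 1 "\<lambda>_. 0"] by simp

lemma lin_fun_scale: "lin_fun \<phi> \<Longrightarrow> \<phi> (\<lambda>i. t * y i) = t * \<phi> y"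
  using lin_funD[of \<phi> "\<lambda>_. 0" t y] by (simp add: lin_fun_0)

lemma lin_fun_uminus: "lin_fun \<phi> \<Longrightarrow> \<phi> (\<lambda>i. - y i) = - \<phi> y"
  using lin_fun_scale[of \<phi> "-1" y] by simp

lemma lin_fun_sum: "lin_fun \<phi> \<Longrightarrow> \<phi> (\<lambda>i. \<Sum>j\<in>S. t j * b j i) = (\<Sum>j\<in>S. t j * \<phi> (b j))"
proof (induction S rule: infinite_finite_induct)
  case (insert j S)
  then show ?case using lin_funD[of \<phi> "\<lambda>i. \<Sum>j\<in>S. t j * b j i" "t j" "b j"] by (simp add: add.commute)
qed (simp_all add: lin_fun_0)

text \<open>
  Among the admissible points take one with as many active constraints as possible.  Inside the slice
  on which \<open>l\<close> is constant the cone is bounded, so a direction that keeps the active constraints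
  would lead to a further active one.
\<close>

lemma extreme_ray:
  fixes X :: "('i \<Rightarrow> rat) set" and S :: "rat set"
  assumes X: "\<And>x y t. x \<in> X \<Longrightarrow> y \<in> X \<Longrightarrow> (\<lambda>i. x i + t * y i) \<in> X"
    and A: "finite A" "\<And>c. c \<in> A \<Longrightarrow> lin_fun c" and g: "lin_fun g" and l: "lin_fun l"
    and l_pos: "\<And>x. x \<in> X \<Longrightarrow> (\<And>c. c \<in> A \<Longrightarrow> c x \<ge> 0) \<Longrightarrow> x \<noteq> (\<lambda>_. 0) \<Longrightarrow> l x > 0"
    and S: "\<And>a b. a \<in> S \<Longrightarrow> a \<le> b \<Longrightarrow> b \<in> S"
    and x: "x \<in> X" "\<And>c. c \<in> A \<Longrightarrow> c x \<ge> 0" "x \<noteq> (\<lambda>_. 0)" "g x \<in> S"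
  shows "\<exists>y. y \<in> X \<and> (\<forall>c\<in>A. c y \<ge> 0) \<and> y \<noteq> (\<lambda>_. 0) \<and> g y \<in> S \<and>
    (\<forall>z\<in>X. (\<forall>c\<in>A. c y = 0 \<longrightarrow> c z = 0) \<longrightarrow> (\<exists>t. z = (\<lambda>i. t * y i)))"
proof -
  define adm where "adm y \<longleftrightarrow> y \<in> X \<and> (\<forall>c\<in>A. c y \<ge> 0) \<and> y \<noteq> (\<lambda>_. 0) \<and> g y \<in> S" for y
  define active where "active y = {c \<in> A. c y = 0}" for y
  have "adm x" using x by (simp add: adm_def)
  moreover have bound: "card (active y) < Suc (card A)" for y
    using A(1) by (auto simp: active_def less_Suc_eq_le intro: card_mono)
  ultimately obtain y where y: "adm y" and max: "\<And>y'. adm y' \<Longrightarrow> card (active y') \<le> card (active y)"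
    using ex_has_greatest_nat[of adm x "\<lambda>y. card (active y)" "Suc (card A)"] by (meson less_imp_le)
  have yX: "y \<in> X" "\<And>c. c \<in> A \<Longrightarrow> c y \<ge> 0" "y \<noteq> (\<lambda>_. 0)" "g y \<in> S" using y by (auto simp: adm_def)
  have ly: "l y > 0" using yX by (intro l_pos) auto
  have "\<exists>t. z = (\<lambda>i. t * y i)" if z: "z \<in> X" "\<forall>c\<in>A. c y = 0 \<longrightarrow> c z = 0" for z
  proof (rule ccontr)
    assume no: "\<nexists>t. z = (\<lambda>i. t * y i)"
    \<comment> \<open>Moving \<open>z\<close> along \<open>y\<close> into the slice
      \<open>l = 0\<close> keeps the constraints active at \<open>y\<close> equal to 0.\<close>
    define z0 where "z0 i = z i + (- (l z / l y)) * y i" for i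
    have ev0: "c z0 = c z + (- (l z / l y)) * c y" if "lin_fun c" for c
      unfolding z0_def by (rule lin_funD[OF that])
    have z0: "z0 \<in> X" "l z0 = 0" "\<And>c. c \<in> active y \<Longrightarrow> c z0 = 0"
    proof -
      show "z0 \<in> X" unfolding z0_def by (rule X[OF z(1) yX(1)])
      show "l z0 = 0" using ev0[OF l] ly by simp
      show "c z0 = 0" if "c \<in> active y" for c
      proof -
        have "c \<in> A" "c y = 0" "c z = 0" using that z(2) unfolding active_def by blast+
        then show ?thesis using ev0[OF A(2)[OF \<open>c \<in> A\<close>]] by simp
      qed
    qed
    have z0_ne: "z0 \<noteq> (\<lambda>_. 0)"
    proof
      assume *: "z0 = (\<lambda>_. 0)"
      have "z i = (l z / l y) * y i" for i
        using fun_cong[OF *, of i] by (simp add: z0_def)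
      then show False using no by blast
    qed
    \<comment> \<open>One of the two opposite directions does not decrease \<open>g\<close>, so that
      moving along it stays within the upward closed set \<open>S\<close>.\<close>
    have "\<exists>z1\<in>X. l z1 = 0 \<and> (\<forall>c\<in>active y. c z1 = 0) \<and> z1 \<noteq> (\<lambda>_. 0) \<and> g z1 \<ge> 0"
    proof (cases "g z0 \<ge> 0")
      case True
      then show ?thesis using z0 z0_ne by blast
    next
      case False
      have "(\<lambda>i. z0 i + (- 2) * z0 i) \<in> X" by (rule X) fact+
      then have "(\<lambda>i. - z0 i) \<in> X" by (simp add: algebra_simps)
      moreover have "(\<lambda>i. - z0 i) \<noteq> (\<lambda>_. 0)" using z0_ne by (auto simp: fun_eq_iff)
      ultimately show ?thesis using False z0 A g l
        by (intro bexI[of _ "\<lambda>i. - z0 i"]) (auto simp: lin_fun_uminus active_def)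
    qed
    then obtain z1 where z1: "z1 \<in> X" "l z1 = 0" "\<And>c. c \<in> active y \<Longrightarrow> c z1 = 0" "z1 \<noteq> (\<lambda>_. 0)" "g z1 \<ge> 0"
      by blast
    define B where "B = {c \<in> A. c z1 < 0}"
    \<comment> \<open>A direction along which no constraint decreases would lie in the cone itself,
      where \<open>l_pos\<close> excludes \<open>l z1 = 0\<close>.\<close>
    have "B \<noteq> {}"
    proof
      assume "B = {}"
      then have "l z1 > 0" using z1 by (intro l_pos) (auto simp: B_def not_less)
      then show False using z1 by simp
    qed
    moreover have "finite B" using A(1) by (simp add: B_def)
    ultimately obtain c0 where c0: "c0 \<in> B" "\<And>c. c \<in> B \<Longrightarrow> c0 y / (- c0 z1) \<le> c y / (- c z1)"
      using ex_min_if_finite[of "(\<lambda>c. c y / (- c z1)) ` B"] by (auto simp: not_less)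
    \<comment> \<open>The first parameter at which a further constraint becomes active.\<close>
    define t where "t = c0 y / (- c0 z1)"
    have c0A: "c0 \<in> A" "c0 z1 < 0" "c0 y > 0"
      using c0(1) z1(3)[of c0] yX(2)[of c0] by (auto simp: B_def active_def order_le_less)
    then have t: "t > 0" by (simp add: t_def divide_pos_neg)
    define y' where "y' i = y i + t * z1 i" for i
    have ev: "c y' = c y + t * c z1" if "lin_fun c" for c unfolding y'_def by (rule lin_funD[OF that])
    have "c y' \<ge> 0" if c: "c \<in> A" for c
    proof (cases "c \<in> B")
      case True
      then have "t * (- c z1) \<le> c y" using c0(2)[OF True] by (simp add: t_def B_def field_simps)
      then show ?thesis by (simp add: ev A c)
    next
      case False
      then have "c z1 \<ge> 0" using c by (simp add: B_def)
      then show ?thesis using t yX(2)[OF c] by (simp add: ev A c)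
    qed
    moreover have "y' \<noteq> (\<lambda>_. 0)"
      using ev[OF l] ly z1(2) lin_fun_0[OF l] by auto
    moreover have "g y' \<in> S" using ev[OF g] z1(5) t by (auto intro: S[OF yX(4)])
    moreover have "y' \<in> X" unfolding y'_def by (rule X) fact+
    ultimately have "adm y'" by (simp add: adm_def)
    from max[OF this] have "card (active y') \<le> card (active y)" .
    moreover have "active y \<subseteq> active y'"
      using z1(3) by (auto simp: active_def ev A)
    moreover have "c0 \<in> active y'" "c0 \<notin> active y"
      using c0A by (auto simp: active_def ev A t_def field_simps)
    moreover have "finite (active y')" using A by (simp add: active_def)
    ultimately show False using psubset_card_mono[of "active y'" "active y"] by (metis leD psubsetI)
  qed
  then show ?thesis using yX by blast
qed

text \<open>Gaussian elimination on functionals: one that does not vanish on the span of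
  \<open>b\<close> lowers its dimension by 1, and the others are chosen on its kernel. The exact
  count matters, because the fundamental set prescribes the number of equations.\<close>

lemma independent_equations:
  fixes b :: "'j \<Rightarrow> 'i \<Rightarrow> rat"
  assumes "finite S" "finite A" "\<And>c. c \<in> A \<Longrightarrow> lin_fun c"
    and "\<And>t. (\<lambda>i. \<Sum>j\<in>S. t j * b j i) = (\<lambda>_. 0) \<Longrightarrow> \<forall>j\<in>S. t j = 0"
    and "y = (\<lambda>i. \<Sum>j\<in>S. t0 j * b j i)" "y \<noteq> (\<lambda>_. 0)" "\<And>c. c \<in> A \<Longrightarrow> c y = 0"
    and "\<And>t. (\<And>c. c \<in> A \<Longrightarrow> c (\<lambda>i. \<Sum>j\<in>S. t j * b j i) = 0) \<Longrightarrow> \<exists>r. (\<lambda>i. \<Sum>j\<in>S. t j * b j i) = (\<lambda>i. r * y i)"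
  shows "\<exists>E\<subseteq>A. card E = card S - 1 \<and>
    (\<forall>t. (\<forall>c\<in>E. c (\<lambda>i. \<Sum>j\<in>S. t j * b j i) = 0) \<longrightarrow> (\<exists>r. (\<lambda>i. \<Sum>j\<in>S. t j * b j i) = (\<lambda>i. r * y i)))"
  using assms
proof (induction "card S" arbitrary: S A b t0)
  case 0
  then have "S = {}" by simp
  with 0 show ?case by simp
next
  case (Suc d)
  note fin = \<open>finite S\<close> \<open>finite A\<close> and lin = Suc.prems(3) and indep = Suc.prems(4)
    and yS = Suc.prems(5) and y0 = Suc.prems(6) and Ay = Suc.prems(7) and ker = Suc.prems(8)
  show ?case
  proof (cases "d = 0")
    case True
    then obtain j where S: "S = {j}" using Suc.hyps(2) by (metis One_nat_def card_1_singletonE)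
    have "t0 j \<noteq> 0" using y0 yS by (auto simp: S)
    then have "(\<lambda>i. t j * b j i) = (\<lambda>i. (t j / t0 j) * y i)" for t
      using yS by (simp add: S)
    then have "\<exists>r. (\<lambda>i. \<Sum>j\<in>S. t j * b j i) = (\<lambda>i. r * y i)" for t
      by (simp only: S) (auto intro!: exI[of _ "t j / t0 j"])
    then show ?thesis using S by (intro exI[of _ "{}"]) auto
  next
    case False
    \<comment> \<open>Otherwise the common kernel is the whole span, of dimension at least 2,
      although it consists of multiples of \<open>y\<close>.\<close>
    have "\<exists>c\<in>A. \<exists>i\<in>S. c (b i) \<noteq> 0"
    proof (rule ccontr)
      assume *: "\<not> ?thesis"
      have all: "\<exists>r. (\<lambda>i. \<Sum>j\<in>S. t j * b j i) = (\<lambda>i. r * y i)" for t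
        by (rule ker) (use * in \<open>auto simp: lin_fun_sum[OF lin] intro!: sum.neutral\<close>)
      obtain j1 j2 where j: "j1 \<in> S" "j2 \<in> S" "j1 \<noteq> j2"
      proof -
        obtain j1 where "j1 \<in> S" using Suc.hyps(2) by (metis card.empty ex_in_conv nat.distinct(1))
        moreover have "S - {j1} \<noteq> {}" using False Suc.hyps(2) \<open>j1 \<in> S\<close> fin
          by (metis card_Diff_singleton card.empty diff_Suc_1)
        ultimately show ?thesis using that by blast
      qed
      have d: "(\<Sum>j\<in>S. (if j = a then 1 else 0) * b j i) = b a i" if "a \<in> S" for a i
        using that fin by (simp add: if_distrib[of "\<lambda>x. x * _"] cong: if_cong)
      obtain r1 where r1: "b j1 = (\<lambda>i. r1 * y i)"
        using all[of "\<lambda>j. if j = j1 then 1 else 0"] by (auto simp: d j)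
      obtain r2 where r2: "b j2 = (\<lambda>i. r2 * y i)"
        using all[of "\<lambda>j. if j = j2 then 1 else 0"] by (auto simp: d j)
      let ?t = "\<lambda>j. r2 * (if j = j1 then 1 else 0) - r1 * (if j = j2 then 1 else 0)"
      have "(\<lambda>i. \<Sum>j\<in>S. ?t j * b j i) = (\<lambda>_. 0)"
      proof
        fix i
        have "(\<Sum>j\<in>S. ?t j * b j i) = r2 * (\<Sum>j\<in>S. (if j = j1 then 1 else 0) * b j i)
            - r1 * (\<Sum>j\<in>S. (if j = j2 then 1 else 0) * b j i)"
          by (simp only: left_diff_distrib sum_subtractf mult.assoc sum_distrib_left)
        then show "(\<Sum>j\<in>S. ?t j * b j i) = 0" by (simp add: d j r1 r2)
      qed
      from indep[OF this] j have "r1 = 0" by force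
      with r1 have "(\<lambda>i. \<Sum>j\<in>S. (if j = j1 then 1 else 0) * b j i) = (\<lambda>_. 0)" by (simp add: d j)
      from indep[OF this] j show False by auto
    qed
    then obtain c i0 where c: "c \<in> A" "i0 \<in> S" "c (b i0) \<noteq> 0" by blast
    define S' where "S' = S - {i0}"
    \<comment> \<open>A basis of the kernel of \<open>c\<close>, each vector being corrected by a
      multiple of \<open>b i0\<close>.\<close>
    define b' where "b' j i = b j i - (c (b j) / c (b i0)) * b i0 i" for j i
    have cS: "card S' = d" using Suc.hyps(2) c fin by (simp add: S'_def)
    \<comment> \<open>Coordinates for \<open>b'\<close> rewritten as coordinates for
      \<open>b\<close>; the coefficient of \<open>b i0\<close> is the one forced by the vanishing of
      \<open>c\<close>.\<close>
    define ext where "ext t j = (if j = i0 then - (\<Sum>j\<in>S'. t j * c (b j)) / c (b i0) else t j)" for t j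
    have ext: "(\<Sum>j\<in>S'. t j * b' j i) = (\<Sum>j\<in>S. ext t j * b j i)" for t i
    proof -
      have "(\<Sum>j\<in>S. ext t j * b j i) = ext t i0 * b i0 i + (\<Sum>j\<in>S'. ext t j * b j i)"
        unfolding S'_def by (rule sum.remove) (use fin c in auto)
      also have "(\<Sum>j\<in>S'. ext t j * b j i) = (\<Sum>j\<in>S'. t j * b j i)"
        by (rule sum.cong) (auto simp: ext_def S'_def)
      also have "ext t i0 * b i0 i = - (\<Sum>j\<in>S'. t j * (c (b j) / c (b i0)) * b i0 i)"
        by (simp add: ext_def sum_divide_distrib sum_distrib_right)
      finally show ?thesis by (simp add: b'_def right_diff_distrib sum_subtractf mult.assoc)
    qed
    have res: "(\<Sum>j\<in>S. t j * b j i) = (\<Sum>j\<in>S'. t j * b' j i)" if "c (\<lambda>i. \<Sum>j\<in>S. t j * b j i) = 0" for t i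
    proof -
      have "(\<Sum>j\<in>S. t j * c (b j)) = 0" using that by (simp add: lin_fun_sum[OF lin[OF c(1)]])
      also have "(\<Sum>j\<in>S. t j * c (b j)) = t i0 * c (b i0) + (\<Sum>j\<in>S'. t j * c (b j))"
        unfolding S'_def by (rule sum.remove) (use fin c in auto)
      finally have "t i0 = - (\<Sum>j\<in>S'. t j * c (b j)) / c (b i0)" using c by (simp add: field_simps)
      then have "ext t = t" by (auto simp: ext_def)
      with ext[of t i] show ?thesis by simp
    qed
    have c_ext: "c (\<lambda>i. \<Sum>j\<in>S'. t j * b' j i) = 0" for t
    proof -
      have "c (b' j) = 0" for j
        using lin_funD[OF lin[OF c(1)], of "b j" "- (c (b j) / c (b i0))" "b i0"] c
        by (simp add: b'_def[abs_def])
      then show ?thesis by (simp add: lin_fun_sum[OF lin[OF c(1)]])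
    qed
    have "\<exists>E\<subseteq>A - {c}. card E = card S' - 1 \<and>
      (\<forall>t. (\<forall>c\<in>E. c (\<lambda>i. \<Sum>j\<in>S'. t j * b' j i) = 0) \<longrightarrow> (\<exists>r. (\<lambda>i. \<Sum>j\<in>S'. t j * b' j i) = (\<lambda>i. r * y i)))"
    proof (rule Suc.hyps(1))
      show "d = card S'" "finite S'" "finite (A - {c})" using cS fin by (auto simp: S'_def)
      show "lin_fun c'" if "c' \<in> A - {c}" for c' using that lin by simp
      show "\<forall>j\<in>S'. t j = 0" if "(\<lambda>i. \<Sum>j\<in>S'. t j * b' j i) = (\<lambda>_. 0)" for t
      proof -
        have "\<forall>j\<in>S. ext t j = 0" by (rule indep) (use that in \<open>simp add: ext\<close>)
        then show ?thesis by (auto simp: ext_def S'_def split: if_splits)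
      qed
      show "y = (\<lambda>i. \<Sum>j\<in>S'. t0 j * b' j i)"
        using res[of t0] Ay[OF c(1)] unfolding yS by auto
      show "y \<noteq> (\<lambda>_. 0)" by fact
      show "c' y = 0" if "c' \<in> A - {c}" for c' using that Ay by simp
      show "\<exists>r. (\<lambda>i. \<Sum>j\<in>S'. t j * b' j i) = (\<lambda>i. r * y i)"
        if "\<And>c'. c' \<in> A - {c} \<Longrightarrow> c' (\<lambda>i. \<Sum>j\<in>S'. t j * b' j i) = 0" for t
        using ker[of "ext t"] that c_ext[of t] unfolding ext by blast
    qed
    then obtain E where E: "E \<subseteq> A - {c}" "card E = card S' - 1"
      and EE: "\<forall>t. (\<forall>c\<in>E. c (\<lambda>i. \<Sum>j\<in>S'. t j * b' j i) = 0) \<longrightarrow> (\<exists>r. (\<lambda>i. \<Sum>j\<in>S'. t j * b' j i) = (\<lambda>i. r * y i))"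
      by (elim exE conjE) (rule that)
    have "finite E" using E fin by (meson finite_Diff finite_subset)
    moreover have "c \<notin> E" using E by blast
    ultimately have card: "card (insert c E) = card S - 1" using E cS False Suc.hyps(2) by simp
    have "\<exists>r. (\<lambda>i. \<Sum>j\<in>S. t j * b j i) = (\<lambda>i. r * y i)"
      if t: "\<forall>c'\<in>insert c E. c' (\<lambda>i. \<Sum>j\<in>S. t j * b j i) = 0" for t
    proof -
      have e: "(\<lambda>i. \<Sum>j\<in>S. t j * b j i) = (\<lambda>i. \<Sum>j\<in>S'. t j * b' j i)"
        using res[of t] t by auto
      show ?thesis unfolding e by (rule EE[rule_format]) (use t e in auto)
    qed
    with card show ?thesis using E c by (intro exI[of _ "insert c E"]) auto
  qed
qed


section \<open>Dominant weights and the equations of the fundamental set\<close>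

lemma decreasing_chain:
  fixes f :: "nat \<Rightarrow> rat"
  assumes "\<forall>i<m. f i \<ge> f (i + 1)" "i \<le> j" "j \<le> m"
  shows "f j \<le> f i"
  using assms(2,3)
proof (induction j rule: dec_induct)
  case (step j)
  then show ?case using assms(1) by (metis Suc_eq_plus1 Suc_le_lessD order.trans less_imp_le)
qed simp

text \<open>The first entry dominates the others while their sum is 0, so it is positive unless the
  vector vanishes. This is what permits the normalisation of a first entry to 1.\<close>

lemma decreasing_sum_zero:
  fixes f :: "nat \<Rightarrow> rat"
  assumes dec: "\<forall>i<m. f i \<ge> f (i + 1)" and sum: "(\<Sum>i\<le>m. f i) = 0"
  shows "f 0 \<ge> 0" "f m \<le> 0" "f 0 = 0 \<or> f m = f 0 \<Longrightarrow> i \<le> m \<Longrightarrow> f i = 0"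
proof -
  note ch = decreasing_chain[OF dec]
  have "(\<Sum>i\<le>m. f i) \<le> (\<Sum>i\<le>m. f 0)" by (rule sum_mono) (simp add: ch)
  then show 1: "f 0 \<ge> 0" using sum by (simp add: zero_le_mult_iff)
  have "(\<Sum>i\<le>m. f m) \<le> (\<Sum>i\<le>m. f i)" by (rule sum_mono) (simp add: ch)
  then have "of_nat (Suc m) * f m \<le> 0" using sum by simp
  then show 2: "f m \<le> 0" by (simp add: mult_le_0_iff)
  assume *: "f 0 = 0 \<or> f m = f 0" "i \<le> m"
  then have f0: "f 0 = 0" using 1 2 by auto
  have "(\<Sum>i\<le>m. - f i) = 0" using sum by (simp add: sum_negf)
  then have "\<forall>i\<in>{..m}. - f i = 0"
    using ch[of 0] f0 by (subst (asm) sum_nonneg_eq_0_iff) auto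
  then show "f i = 0" using * by simp
qed

definition rat_pairing :: "nat \<Rightarrow> nat \<Rightarrow> (coord \<Rightarrow> int) \<Rightarrow> (coord \<Rightarrow> rat) \<Rightarrow> rat" where
  "rat_pairing m n w x = (\<Sum>v\<in>coords m n. of_int (w v) * x v)"

lemma lin_rat_pairing: "lin_fun (rat_pairing m n w)"
  by (simp add: lin_fun_def rat_pairing_def algebra_simps sum.distrib sum_distrib_left)

lemma rat_pairing_diff: "rat_pairing m n (\<lambda>v. w v - w' v) x = rat_pairing m n w x - rat_pairing m n w' x"
  by (simp add: rat_pairing_def algebra_simps sum_subtractf)

text \<open>Vanishing off \<open>coords\<close> turns functions on the infinite type of coordinates
  into vectors, so that multiples of \<open>y\<close> can be described by equality of
  functions.\<close>

definition zero_sums :: "nat \<Rightarrow> nat \<Rightarrow> (coord \<Rightarrow> rat) set" where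
  "zero_sums m n = {x. (\<forall>v. v \<notin> coords m n \<longrightarrow> x v = 0) \<and>
     (\<Sum>i\<le>m. x (Inl i)) = 0 \<and> (\<Sum>j\<le>n. x (Inr j)) = 0}"

definition dominant :: "nat \<Rightarrow> nat \<Rightarrow> (coord \<Rightarrow> rat) \<Rightarrow> bool" where
  "dominant m n x \<longleftrightarrow> (\<forall>i<m. x (Inl i) \<ge> x (Inl (i + 1))) \<and> (\<forall>j<n. x (Inr j) \<ge> x (Inr (j + 1)))"

definition root_vec :: "coord \<Rightarrow> coord \<Rightarrow> coord \<Rightarrow> int" where
  "root_vec a b v = (if v = a then 1 else 0) - (if v = b then 1 else 0)"

lemma rat_pairing_root_vec: "a \<in> coords m n \<Longrightarrow> b \<in> coords m n \<Longrightarrow> rat_pairing m n (root_vec a b) x = x a - x b"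
  unfolding root_vec_def rat_pairing_diff by (simp add: rat_pairing_def if_distrib[of "\<lambda>y. y * _"] if_distrib[of of_int] cong: if_cong)

definition bounded_coeffs :: "nat \<Rightarrow> nat \<Rightarrow> nat \<Rightarrow> nat \<Rightarrow> (coord \<Rightarrow> int) \<Rightarrow> bool" where
  "bounded_coeffs m n k l w \<longleftrightarrow>
     (\<forall>i\<le>m. \<bar>w (Inl i)\<bar> \<le> int k) \<and> (\<Sum>i\<le>m. w (Inl i)) = 0 \<and>
     (\<forall>j\<le>n. \<bar>w (Inr j)\<bar> \<le> int l) \<and> (\<Sum>j\<le>n. w (Inr j)) = 0"

definition vecs :: "nat \<Rightarrow> nat \<Rightarrow> (coord \<Rightarrow> 'a) \<Rightarrow> 'a vec \<times> 'a vec" where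
  "vecs m n w = (vec (m + 1) (\<lambda>i. w (Inl i)), vec (n + 1) (\<lambda>j. w (Inr j)))"

lemma vecs_Eqs: "bounded_coeffs m n k l w \<Longrightarrow> vecs m n w \<in> Eqs m n k l"
  by (auto simp: bounded_coeffs_def vecs_def Eqs_def abs_le_iff minus_le_iff)

lemma vecs_rat_pairing:
  assumes "vecs m n w = (a, b)" "dim_vec \<rho> = m + 1" "dim_vec \<sigma> = n + 1"
  shows "(\<Sum>i\<le>m. of_int (a $ i) * \<rho> $ i) + (\<Sum>j\<le>n. of_int (b $ j) * \<sigma> $ j) =
    rat_pairing m n w (case_sum (vec_index \<rho>) (vec_index \<sigma>))"
  using assms by (auto simp: vecs_def rat_pairing_def sum_coords)

lemma common_denominator_nonzero: "common_denominator m n (\<rho>, \<sigma>) \<noteq> 0"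
proof -
  define D where "D = (\<lambda>i. snd (quotient_of (\<rho> $ i))) ` {..m} \<union> (\<lambda>j. snd (quotient_of (\<sigma> $ j))) ` {..n}"
  have "0 \<notin> D"
    using quotient_of_denom_pos'[THEN less_imp_neq] unfolding D_def by (metis (no_types, lifting) UnE imageE)
  moreover have "finite D" by (simp add: D_def)
  ultimately show ?thesis unfolding common_denominator_def by (simp add: D_def[symmetric] Lcm_0_iff)
qed

text \<open>Zero-sum vectors form a space of dimension \<open>m + n\<close>, so
  \<open>m + n - 1\<close> of the equations in \<open>W\<close> already cut out the ray through
  \<open>y\<close>. Normalising a first entry to 1 and clearing denominators rescale
  \<open>y\<close> by the positive factor \<open>c\<close> only, which preserves the signs of all
  weights.\<close>

lemma fundamental_ray:
  assumes pos: "m > 0" "n > 0" "k > 0" "l > 0"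
    and W: "finite W" "\<And>w. w \<in> W \<Longrightarrow> bounded_coeffs m n k l w"
    and y: "y \<in> zero_sums m n" "dominant m n y" "y \<noteq> (\<lambda>_. 0)"
    and Wy: "\<And>w. w \<in> W \<Longrightarrow> rat_pairing m n w y = 0"
    and ker: "\<And>z. z \<in> zero_sums m n \<Longrightarrow> (\<And>w. w \<in> W \<Longrightarrow> rat_pairing m n w z = 0) \<Longrightarrow> \<exists>t. z = (\<lambda>v. t * y v)"
  shows "\<exists>u\<in>fundamental_set m n k l. \<exists>c>0. \<forall>I. of_int (pairing m n I u) = c * rat_pairing m n (\<lambda>v. int (lk I v)) y"
proof -
  \<comment> \<open>Unit vectors at \<open>S\<close>, each minus the last unit vector of its block,
    form a basis of the zero-sum vectors; the coordinates of a vector are its own entries at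
    \<open>S\<close>.\<close>
  define S where "S = Inl ` {..<m} \<union> (Inr ` {..<n} :: coord set)"
  define b :: "coord \<Rightarrow> coord \<Rightarrow> rat" where
    "b v u = of_int (root_vec v (case v of Inl _ \<Rightarrow> Inl m | Inr _ \<Rightarrow> Inr n) u)" for v u
  have finS: "finite S" and cardS: "card S = m + n"
    unfolding S_def by (simp, subst card_Un_disjoint) (auto simp: card_image)
  have sumS: "(\<Sum>v\<in>S. f v) = (\<Sum>i<m. f (Inl i)) + (\<Sum>j<n. f (Inr j))" for f :: "coord \<Rightarrow> rat"
    unfolding S_def by (subst sum.union_disjoint) (auto simp: sum.reindex)
  have bl: "b (Inl i) u = (if u = Inl i then 1 else 0) - (if u = Inl m then 1 else 0)" for i u
    by (simp add: b_def root_vec_def)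
  have br: "b (Inr i) u = (if u = Inr i then 1 else 0) - (if u = Inr n then 1 else 0)" for i u
    by (simp add: b_def root_vec_def)
  have comb: "(\<Sum>v\<in>S. t v * b v u) = (case u of
      Inl i \<Rightarrow> if i < m then t (Inl i) else if i = m then - (\<Sum>i<m. t (Inl i)) else 0
    | Inr j \<Rightarrow> if j < n then t (Inr j) else if j = n then - (\<Sum>j<n. t (Inr j)) else 0)" for t u
  proof (cases u)
    case (Inl i)
    have "(\<Sum>v\<in>S. t v * b v u) = (\<Sum>i'<m. t (Inl i') * ((if Inl i = (Inl i' :: coord) then 1 else 0) - (if Inl i = (Inl m :: coord) then 1 else 0)))"
      unfolding sumS bl br Inl by simp
    also have "\<dots> = (\<Sum>i'<m. (if i' = i then t (Inl i') else 0) - (if i = m then t (Inl i') else 0))"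
      by (rule sum.cong) auto
    finally have "(\<Sum>v\<in>S. t v * b v u) = (\<Sum>i'<m. (if i' = i then t (Inl i') else 0) - (if i = m then t (Inl i') else 0))" .
    then show ?thesis by (simp add: Inl sum_subtractf sum.delta)
  next
    case (Inr i)
    have "(\<Sum>v\<in>S. t v * b v u) = (\<Sum>i'<n. t (Inr i') * ((if Inr i = (Inr i' :: coord) then 1 else 0) - (if Inr i = (Inr n :: coord) then 1 else 0)))"
      unfolding sumS bl br Inr by simp
    also have "\<dots> = (\<Sum>i'<n. (if i' = i then t (Inr i') else 0) - (if i = n then t (Inr i') else 0))"
      by (rule sum.cong) auto
    finally have "(\<Sum>v\<in>S. t v * b v u) = (\<Sum>i'<n. (if i' = i then t (Inr i') else 0) - (if i = n then t (Inr i') else 0))" .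
    then show ?thesis by (simp add: Inr sum_subtractf sum.delta)
  qed
  have Xcomb: "(\<lambda>u. \<Sum>v\<in>S. t v * b v u) \<in> zero_sums m n" for t
    by (auto simp: zero_sums_def comb coords_def lessThan_Suc_atMost[symmetric] split: sum.split)
  have combX: "z = (\<lambda>u. \<Sum>v\<in>S. z v * b v u)" if "z \<in> zero_sums m n" for z
  proof
    fix u
    have "z (Inl i) = 0" if "\<not> i \<le> m" for i using \<open>z \<in> zero_sums m n\<close> that by (auto simp: zero_sums_def coords_def)
    moreover have "z (Inr i) = 0" if "\<not> i \<le> n" for i using \<open>z \<in> zero_sums m n\<close> that by (auto simp: zero_sums_def coords_def)
    moreover have "z (Inl m) = - (\<Sum>i<m. z (Inl i))" "z (Inr n) = - (\<Sum>j<n. z (Inr j))"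
      using that by (auto simp: zero_sums_def lessThan_Suc_atMost[symmetric] add_eq_0_iff)
    ultimately show "z u = (\<Sum>v\<in>S. z v * b v u)" unfolding comb by (auto split: sum.split)
  qed
  have "\<exists>E\<subseteq>rat_pairing m n ` W. card E = card S - 1 \<and>
    (\<forall>t. (\<forall>c\<in>E. c (\<lambda>i. \<Sum>j\<in>S. t j * b j i) = 0) \<longrightarrow> (\<exists>r. (\<lambda>i. \<Sum>j\<in>S. t j * b j i) = (\<lambda>i. r * y i)))"
  proof (rule independent_equations)
    show "finite S" "finite (rat_pairing m n ` W)" using finS W by auto
    show "lin_fun c" if "c \<in> rat_pairing m n ` W" for c using that lin_rat_pairing by auto
    show "\<forall>j\<in>S. t j = 0" if "(\<lambda>i. \<Sum>j\<in>S. t j * b j i) = (\<lambda>_. 0)" for t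
    proof
      fix v assume v: "v \<in> S"
      from fun_cong[OF that, of v] v show "t v = 0" unfolding comb by (auto simp: S_def)
    qed
    show "y = (\<lambda>i. \<Sum>j\<in>S. y j * b j i)" by (rule combX) fact
    show "y \<noteq> (\<lambda>_. 0)" by fact
    show "c y = 0" if "c \<in> rat_pairing m n ` W" for c using that Wy by auto
    show "\<exists>r. (\<lambda>i. \<Sum>j\<in>S. t j * b j i) = (\<lambda>i. r * y i)"
      if "\<And>c. c \<in> rat_pairing m n ` W \<Longrightarrow> c (\<lambda>i. \<Sum>j\<in>S. t j * b j i) = 0" for t
      by (rule ker[OF Xcomb]) (use that in auto)
  qed
  then obtain E where E: "E \<subseteq> rat_pairing m n ` W" "card E = m + n - 1"
    and kerE': "\<forall>t. (\<forall>c\<in>E. c (\<lambda>i. \<Sum>j\<in>S. t j * b j i) = 0) \<longrightarrow> (\<exists>r. (\<lambda>i. \<Sum>j\<in>S. t j * b j i) = (\<lambda>i. r * y i))"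
    unfolding cardS by (elim exE conjE) (rule that)
  have kerE: "\<exists>r. z = (\<lambda>i. r * y i)" if "z \<in> zero_sums m n" "\<forall>c\<in>E. c z = 0" for z
    using kerE'[THEN spec, of z] that(2) unfolding combX[OF that(1), symmetric] by (rule mp)
  \<comment> \<open>One coefficient function for each functional, so that passing to pairs of
    vectors keeps the cardinality exactly \<open>m + n - 1\<close>.\<close>
  obtain W0 where W0: "W0 \<subseteq> W" "inj_on (rat_pairing m n) W0" "E = rat_pairing m n ` W0"
    using E(1) by (meson subset_image_inj)
  have finW0: "finite W0" using W0 W finite_subset by blast
  have inj: "inj_on (vecs m n) W0"
  proof (rule inj_onI)
    fix w w' assume w: "w \<in> W0" "w' \<in> W0" and e: "vecs m n w = vecs m n w'"
    have "w v = w' v" if "v \<in> coords m n" for v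
    proof (cases v)
      case (Inl i)
      then have "vec (m + 1) (\<lambda>i. w (Inl i)) $ i = vec (m + 1) (\<lambda>i. w' (Inl i)) $ i" using e by (simp add: vecs_def)
      then show ?thesis using that Inl by (auto simp: coords_def)
    next
      case (Inr i)
      then have "vec (n + 1) (\<lambda>i. w (Inr i)) $ i = vec (n + 1) (\<lambda>i. w' (Inr i)) $ i" using e by (simp add: vecs_def)
      then show ?thesis using that Inr by (auto simp: coords_def)
    qed
    then have "rat_pairing m n w = rat_pairing m n w'" by (intro ext) (simp add: rat_pairing_def)
    then show "w = w'" using W0(2) w by (meson inj_onD)
  qed
  define EE where "EE = vecs m n ` W0"
  have EE: "EE \<subseteq> Eqs m n k l" "finite EE" "card EE = m + n - 1"
    using W0 W(2) vecs_Eqs finW0 E(2) by (auto simp: EE_def card_image[OF inj] card_image[OF W0(2)])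
  have solE: "z \<in> zero_sums m n \<and> (\<forall>c\<in>E. c z = 0)"
    if "(\<rho>, \<sigma>) \<in> solutions m n EE" and zdef: "z = (\<lambda>v. if v \<in> coords m n then case_sum (vec_index \<rho>) (vec_index \<sigma>) v else 0)"
    for \<rho> \<sigma> z
  proof -
    have c: "dim_vec \<rho> = m + 1" "dim_vec \<sigma> = n + 1" using that by (auto simp: solutions_def)
    have "rat_pairing m n w z = 0" if w: "w \<in> W0" for w
    proof -
      obtain a b where ab: "vecs m n w = (a, b)" by fastforce
      then have "(a, b) \<in> EE" using w by (metis EE_def image_eqI)
      then have "(\<Sum>i\<le>m. of_int (a $ i) * \<rho> $ i) + (\<Sum>j\<le>n. of_int (b $ j) * \<sigma> $ j) = 0"
        using \<open>(\<rho>, \<sigma>) \<in> solutions m n EE\<close> by (auto simp: solutions_def)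
      then have "rat_pairing m n w (case_sum (vec_index \<rho>) (vec_index \<sigma>)) = 0" by (simp only: vecs_rat_pairing[OF ab c])
      then show ?thesis unfolding zdef by (simp add: rat_pairing_def)
    qed
    moreover have "z \<in> zero_sums m n"
      using that by (auto simp: zero_sums_def solutions_def coords_def image_iff)
    ultimately show ?thesis using W0(3) by auto
  qed
  \<comment> \<open>The entry to be normalised: the first one of the first block, or of the second
    block if the first block vanishes.\<close>
  define c0 where "c0 = (if y (Inl 0) \<noteq> 0 then y (Inl 0) else y (Inr 0))"
  have decl: "\<forall>i<m. y (Inl i) \<ge> y (Inl (i + 1))" and decr: "\<forall>j<n. y (Inr j) \<ge> y (Inr (j + 1))"
    using y(2) by (auto simp: dominant_def)
  have suml: "(\<Sum>i\<le>m. y (Inl i)) = 0" and sumr: "(\<Sum>j\<le>n. y (Inr j)) = 0" using y(1) by (auto simp: zero_sums_def)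
  note dl = decreasing_sum_zero[OF decl suml] and dr = decreasing_sum_zero[OF decr sumr]
  have "\<not> (y (Inl 0) = 0 \<and> y (Inr 0) = 0)"
  proof
    assume *: "y (Inl 0) = 0 \<and> y (Inr 0) = 0"
    then have "y (Inl i) = 0" if "i \<le> m" for i using that by (intro dl(3)) simp_all
    moreover have "y (Inr i) = 0" if "i \<le> n" for i using * that by (intro dr(3)) simp_all
    ultimately have "y v = 0" for v using y(1) by (cases "v \<in> coords m n") (auto simp: zero_sums_def coords_def)
    then show False using y(3) by auto
  qed
  then have c0: "c0 > 0" using dl(1) dr(1) by (auto simp: c0_def)
  define x where "x v = y v / c0" for v
  define \<rho> \<sigma> where "\<rho> = fst (vecs m n x)" and "\<sigma> = snd (vecs m n x)"
  have comp: "i \<le> m \<Longrightarrow> \<rho> $ i = x (Inl i)" "j \<le> n \<Longrightarrow> \<sigma> $ j = x (Inr j)" for i j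
    by (auto simp: \<rho>_def \<sigma>_def vecs_def)
  have car: "\<rho> \<in> carrier_vec (m + 1)" "\<sigma> \<in> carrier_vec (n + 1)" by (auto simp: \<rho>_def \<sigma>_def vecs_def)
  have sums: "(\<Sum>i\<le>m. \<rho> $ i) = 0" "(\<Sum>j\<le>n. \<sigma> $ j) = 0"
    using suml sumr by (simp_all add: comp x_def sum_divide_distrib[symmetric])
  have in_sol: "(\<rho>, \<sigma>) \<in> solutions m n EE"
  proof -
    have "(\<Sum>i\<le>m. of_int (a $ i) * \<rho> $ i) + (\<Sum>j\<le>n. of_int (b $ j) * \<sigma> $ j) = 0" if "(a, b) \<in> EE" for a b
    proof -
      obtain w where w: "w \<in> W0" "vecs m n w = (a, b)" using \<open>(a, b) \<in> EE\<close> by (auto simp: EE_def)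
      have "rat_pairing m n w (case_sum (vec_index \<rho>) (vec_index \<sigma>)) = rat_pairing m n w y / c0"
        by (auto simp: rat_pairing_def sum_coords comp x_def sum_divide_distrib add_divide_distrib)
      also have "\<dots> = 0" using w W0 Wy by auto
      finally show ?thesis using vecs_rat_pairing[OF w(2), of \<rho> \<sigma>] car by simp
    qed
    then show ?thesis using car sums by (auto simp: solutions_def)
  qed
  have uniq: "\<rho>' = \<rho> \<and> \<sigma>' = \<sigma>" if s: "(\<rho>', \<sigma>') \<in> solutions m n EE"
    and nz: "(\<rho>' $ 0 = 1 \<and> y (Inl 0) \<noteq> 0) \<or> (\<sigma>' $ 0 = 1 \<and> y (Inl 0) = 0)" for \<rho>' \<sigma>'
  proof -
    define z where "z = (\<lambda>v. if v \<in> coords m n then case_sum (vec_index \<rho>') (vec_index \<sigma>') v else 0)"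
    from solE[OF s z_def] kerE[of z] obtain r where r: "z = (\<lambda>i. r * y i)" by auto
    have zl: "z (Inl i) = \<rho>' $ i" if "i \<le> m" for i using that by (simp add: z_def coords_def)
    have zr: "z (Inr i) = \<sigma>' $ i" if "i \<le> n" for i using that by (simp add: z_def coords_def)
    have "r * c0 = 1" using nz zl[of 0] zr[of 0] by (auto simp: c0_def r)
    then have "r = 1 / c0" using c0 by (simp add: field_simps)
    then have e: "z = x" by (simp add: r x_def[abs_def])
    have "dim_vec \<rho>' = m + 1" "dim_vec \<sigma>' = n + 1" using s by (auto simp: solutions_def)
    with car zl zr e comp show ?thesis by (intro conjI eq_vecI) (auto simp: less_Suc_eq_le)
  qed
  have norm: "(\<rho>, \<sigma>) \<in> normalised_weights m n k l"
  proof -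
    have "{(\<rho>', \<sigma>') \<in> solutions m n EE. \<rho>' $ 0 = 1} = {(\<rho>, \<sigma>)} \<or>
         {(\<rho>', \<sigma>') \<in> solutions m n EE. \<sigma>' $ 0 = 1} = {(\<rho>, \<sigma>)}"
    proof (cases "y (Inl 0) = 0")
      case True
      then have "\<sigma> $ 0 = 1" using c0 by (simp add: comp x_def c0_def)
      with True in_sol uniq show ?thesis by blast
    next
      case False
      then have "\<rho> $ 0 = 1" by (simp add: comp x_def c0_def)
      with False in_sol uniq show ?thesis by blast
    qed
    moreover have "\<forall>i<m. \<rho> $ i \<ge> \<rho> $ (i + 1)" "\<forall>j<n. \<sigma> $ j \<ge> \<sigma> $ (j + 1)"
      using decl decr c0 by (auto simp: comp x_def divide_right_mono)
    ultimately show ?thesis using car sums EE unfolding normalised_weights_def by blast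
  qed
  define c where "c = common_denominator m n (\<rho>, \<sigma>)"
  define Dn where "Dn = (\<lambda>i. snd (quotient_of (\<rho> $ i))) ` {..m} \<union> (\<lambda>j. snd (quotient_of (\<sigma> $ j))) ` {..n}"
  have c_Dn: "c = Lcm Dn" by (simp add: c_def common_denominator_def Dn_def)
  have "c \<noteq> 0" unfolding c_def by (rule common_denominator_nonzero)
  moreover have "c \<ge> 0" unfolding c_Dn by simp
  ultimately have c: "c > 0" by simp
  have int: "\<exists>z. of_int z = of_int c * q" if "snd (quotient_of q) \<in> Dn" for q :: rat
  proof -
    obtain a d where q: "quotient_of q = (a, d)" by fastforce
    then have "d dvd c" using that unfolding c_Dn by (auto intro: dvd_Lcm)
    then obtain e where "c = d * e" ..
    moreover have "d > 0" "q = of_int a / of_int d" using q quotient_of_denom_pos quotient_of_div by auto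
    ultimately have "of_int (a * e) = of_int c * q" by simp
    then show ?thesis ..
  qed
  have "\<forall>i. \<exists>z. i \<le> m \<longrightarrow> of_int z = of_int c * \<rho> $ i" using int by (auto simp: Dn_def)
  then obtain r where r: "\<And>i. i \<le> m \<Longrightarrow> of_int (r i) = of_int c * \<rho> $ i" by metis
  have "\<forall>j. \<exists>z. j \<le> n \<longrightarrow> of_int z = of_int c * \<sigma> $ j" using int by (auto simp: Dn_def)
  then obtain s where s: "\<And>j. j \<le> n \<Longrightarrow> of_int (s j) = of_int c * \<sigma> $ j" by metis
  define u where "u = (vec (m + 1) r, vec (n + 1) s)"
  have "u \<in> fundamental_set m n k l"
    unfolding fundamental_set_def u_def
    using norm r s by (auto simp: c_def intro!: bexI[of _ "(\<rho>, \<sigma>)"])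
  moreover have "of_int (pairing m n I u) = (of_int c / c0) * rat_pairing m n (\<lambda>v. int (lk I v)) y" for I
  proof -
    have "of_int (pairing m n I u) = (\<Sum>i\<le>m. of_int (r i) * of_nat (lk I (Inl i))) +
        (\<Sum>j\<le>n. of_int (s j) * (of_nat (lk I (Inr j)) :: rat))" by (simp add: u_def)
    also have "\<dots> = (of_int c / c0) * rat_pairing m n (\<lambda>v. int (lk I v)) y"
      by (simp add: r s comp x_def rat_pairing_def sum_coords distrib_left sum_distrib_left mult_ac)
    finally show ?thesis .
  qed
  moreover have "of_int c / c0 > (0 :: rat)" using c c0 by simp
  ultimately show ?thesis by blast
qed

text \<open>With \<open>S\<close> an upward closed set stable under positive scaling, strict and
  weak positivity are treated together. It is enough to control a monomial \<open>I0\<close> of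
  least weight at \<open>x\<close>: the constraints \<open>wt I - wt I0\<close> keep it least on the
  whole cone, hence on the extreme ray that is found.\<close>

lemma fundamental_weights:
  assumes pos: "m > 0" "n > 0" "k > 0" "l > 0"
    and Is: "finite Is" "Is \<noteq> {}" "Is \<subseteq> Xi m n k l"
    and x: "x \<in> zero_sums m n" "dominant m n x" "x \<noteq> (\<lambda>_. 0)"
    and S: "\<And>a b. a \<in> S \<Longrightarrow> a \<le> b \<Longrightarrow> b \<in> S" "\<And>a c. a \<in> S \<Longrightarrow> c > 0 \<Longrightarrow> c * a \<in> S"
    and xI: "\<And>I. I \<in> Is \<Longrightarrow> rat_pairing m n (\<lambda>v. int (lk I v)) x \<in> S"
  shows "\<exists>u\<in>fundamental_set m n k l. \<forall>I\<in>Is. of_int (pairing m n I u) \<in> S"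
proof -
  define wt where "wt I v = int (lk I v)" for I :: "coord monom" and v
  obtain I0 where I0: "I0 \<in> Is" "\<And>I. I \<in> Is \<Longrightarrow> rat_pairing m n (wt I0) x \<le> rat_pairing m n (wt I) x"
    using ex_min_if_finite[of "(\<lambda>I. rat_pairing m n (wt I) x) ` Is"] Is by (auto simp: not_less)
  \<comment> \<open>Both kinds of constraint obey the coefficient bounds: roots have entries 1, -1
    and 0, and exponents lie between 0 and \<open>k\<close> or \<open>l\<close>. So the constraints
    active on a ray are equations of the prescribed kind.\<close>
  define W where "W = (\<lambda>i. root_vec (Inl i) (Inl (i + 1))) ` {..<m} \<union> (\<lambda>j. root_vec (Inr j) (Inr (j + 1))) ` {..<n} \<union>
    (\<lambda>I v. wt I v - wt I0 v) ` Is"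
  have finW: "finite W" using Is by (simp add: W_def)
  have bnd: "bounded_coeffs m n k l w" if w: "w \<in> W" for w
  proof -
    have diff: "bounded_coeffs m n k l (\<lambda>v. wt I v - wt I0 v)" if "I \<in> Is" for I
    proof -
      have II: "I \<in> Xi m n k l" "I0 \<in> Xi m n k l" using that I0 Is by auto
      have 1: "wt J (Inl i) \<le> int k" if "i \<le> m" "J \<in> Xi m n k l" for i J
        using that member_le_sum[of i "{..m}" "\<lambda>i. lk J (Inl i)"] by (auto simp: Xi_def wt_def)
      have 2: "wt J (Inr i) \<le> int l" if "i \<le> n" "J \<in> Xi m n k l" for i J
        using that member_le_sum[of i "{..n}" "\<lambda>i. lk J (Inr i)"] by (auto simp: Xi_def wt_def)
      have 3: "wt J v \<ge> 0" for J v by (simp add: wt_def)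
      have 4: "\<bar>a - b\<bar> \<le> c" if "0 \<le> a" "0 \<le> b" "a \<le> c" "b \<le> c" for a b c :: int using that by linarith
      have "(\<Sum>i\<le>m. wt J (Inl i)) = int k" "(\<Sum>i\<le>n. wt J (Inr i)) = int l" if "J \<in> Xi m n k l" for J
        using that by (auto simp: Xi_def wt_def simp flip: of_nat_sum)
      then show ?thesis
        using II by (auto simp: bounded_coeffs_def sum_subtractf intro!: 4 1 2 3)
    qed
    have rt: "(\<Sum>i\<le>N. (if i = a then 1 else 0) - (if i = b then 1 else (0::int))) = 0" if "a \<le> N" "b \<le> N" for N a b :: nat
      using that by (simp add: sum_subtractf)
    from w consider i where "i < m" "w = root_vec (Inl i) (Inl (i + 1))" | j where "j < n" "w = root_vec (Inr j) (Inr (j + 1))"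
      | I where "I \<in> Is" "w = (\<lambda>v. wt I v - wt I0 v)" by (auto simp: W_def)
    then show ?thesis
    proof cases
      case 1
      then show ?thesis using pos rt[of i m "i + 1"] by (auto simp: bounded_coeffs_def root_vec_def)
    next
      case 2
      then show ?thesis using pos rt[of j n "j + 1"] by (auto simp: bounded_coeffs_def root_vec_def)
    next
      case 3 then show ?thesis using diff by simp
    qed
  qed
  have dom: "dominant m n z" if "\<And>w. w \<in> W \<Longrightarrow> rat_pairing m n w z \<ge> 0" for z
  proof -
    have "z (Inl (i + 1)) \<le> z (Inl i)" if "i < m" for i
      using \<open>\<And>w. w \<in> W \<Longrightarrow> rat_pairing m n w z \<ge> 0\<close>[of "root_vec (Inl i) (Inl (i + 1))"] that
      by (auto simp: W_def rat_pairing_root_vec coords_def)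
    moreover have "z (Inr (i + 1)) \<le> z (Inr i)" if "i < n" for i
      using \<open>\<And>w. w \<in> W \<Longrightarrow> rat_pairing m n w z \<ge> 0\<close>[of "root_vec (Inr i) (Inr (i + 1))"] that
      by (auto simp: W_def rat_pairing_root_vec coords_def)
    ultimately show ?thesis by (simp add: dominant_def)
  qed
  \<comment> \<open>The total drop from the first to the last entry in both blocks. On dominant
    zero-sum vectors it is nonnegative and vanishes only at 0, so it supplies the functional that
    \<open>extreme_ray\<close> asks for.\<close>
  define ll where "ll z = z (Inl 0) - z (Inl m) + (z (Inr 0) - z (Inr n))" for z :: "coord \<Rightarrow> rat"
  have "\<exists>y. y \<in> zero_sums m n \<and> (\<forall>c\<in>rat_pairing m n ` W. c y \<ge> 0) \<and> y \<noteq> (\<lambda>_. 0) \<and> rat_pairing m n (wt I0) y \<in> S \<and>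
    (\<forall>z\<in>zero_sums m n. (\<forall>c\<in>rat_pairing m n ` W. c y = 0 \<longrightarrow> c z = 0) \<longrightarrow> (\<exists>t. z = (\<lambda>i. t * y i)))"
  proof (rule extreme_ray)
    show "(\<lambda>i. x i + t * y i) \<in> zero_sums m n" if "x \<in> zero_sums m n" "y \<in> zero_sums m n" for x y t
      using that by (auto simp: zero_sums_def sum.distrib sum_distrib_left[symmetric])
    show "finite (rat_pairing m n ` W)" using finW by simp
    show "lin_fun c" if "c \<in> rat_pairing m n ` W" for c using that lin_rat_pairing by auto
    show "lin_fun (rat_pairing m n (wt I0))" by (rule lin_rat_pairing)
    show "lin_fun ll" by (simp add: lin_fun_def ll_def algebra_simps)
    show "ll z > 0" if z: "z \<in> zero_sums m n" "\<And>c. c \<in> rat_pairing m n ` W \<Longrightarrow> c z \<ge> 0" "z \<noteq> (\<lambda>_. 0)" for z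
    proof -
      have "dominant m n z" by (rule dom) (use z in auto)
      then have d: "\<forall>i<m. z (Inl i) \<ge> z (Inl (i + 1))" "\<forall>j<n. z (Inr j) \<ge> z (Inr (j + 1))"
        by (auto simp: dominant_def)
      have s: "(\<Sum>i\<le>m. z (Inl i)) = 0" "(\<Sum>j\<le>n. z (Inr j)) = 0" using z by (auto simp: zero_sums_def)
      note dl = decreasing_sum_zero[OF d(1) s(1)] and dr = decreasing_sum_zero[OF d(2) s(2)]
      have "ll z \<noteq> 0"
      proof
        assume "ll z = 0"
        then have "z (Inl m) = z (Inl 0)" "z (Inr n) = z (Inr 0)"
          using dl(1,2) dr(1,2) unfolding ll_def by linarith+
        then have "z (Inl i) = 0" if "i \<le> m" for i using that by (intro dl(3)) simp_all
        moreover have "z (Inr i) = 0" if "i \<le> n" for i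
          using that \<open>z (Inr n) = z (Inr 0)\<close> by (intro dr(3)) simp_all
        ultimately have "z v = 0" for v using z(1) by (cases "v \<in> coords m n") (auto simp: zero_sums_def coords_def)
        then show False using z(3) by auto
      qed
      then show ?thesis using dl(1,2) dr(1,2) by (simp add: ll_def)
    qed
    show "b \<in> S" if "a \<in> S" "a \<le> b" for a b using that S by blast
    show "x \<in> zero_sums m n" "x \<noteq> (\<lambda>_. 0)" by fact+
    show "rat_pairing m n (wt I0) x \<in> S" using xI[OF I0(1)] by (simp add: wt_def[abs_def])
    show "c x \<ge> 0" if "c \<in> rat_pairing m n ` W" for c
      using that x(2) I0(2) by (auto simp: W_def rat_pairing_root_vec coords_def dominant_def rat_pairing_diff)
  qed
  then obtain y where y: "y \<in> zero_sums m n" "\<forall>w\<in>W. rat_pairing m n w y \<ge> 0" "y \<noteq> (\<lambda>_. 0)" "rat_pairing m n (wt I0) y \<in> S"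
    and ker': "\<forall>z\<in>zero_sums m n. (\<forall>w\<in>W. rat_pairing m n w y = 0 \<longrightarrow> rat_pairing m n w z = 0) \<longrightarrow> (\<exists>t. z = (\<lambda>i. t * y i))"
    unfolding ball_simps by (elim exE conjE) (rule that)
  have "\<exists>u\<in>fundamental_set m n k l. \<exists>c>0. \<forall>I. of_int (pairing m n I u) = c * rat_pairing m n (\<lambda>v. int (lk I v)) y"
  proof (rule fundamental_ray[OF pos, of "{w \<in> W. rat_pairing m n w y = 0}"])
    show "\<exists>t. z = (\<lambda>v. t * y v)"
      if "z \<in> zero_sums m n" "\<And>w. w \<in> {w \<in> W. rat_pairing m n w y = 0} \<Longrightarrow> rat_pairing m n w z = 0" for z
      using ker'[THEN bspec, OF that(1)] that(2) by blast
    show "dominant m n y" by (rule dom) (use y in blast)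
  qed (use finW bnd y in auto)
  then obtain u c where u: "u \<in> fundamental_set m n k l" "c > 0"
    "\<And>I. of_int (pairing m n I u) = c * rat_pairing m n (wt I) y" unfolding wt_def by blast
  have "of_int (pairing m n I u) \<in> S" if I: "I \<in> Is" for I
  proof -
    have "rat_pairing m n (wt I) y - rat_pairing m n (wt I0) y \<ge> 0"
      using y(2)[THEN bspec, of "\<lambda>v. wt I v - wt I0 v"] I by (auto simp: W_def rat_pairing_diff)
    then have "rat_pairing m n (wt I) y \<in> S" using S(1)[OF y(4)] by simp
    then show ?thesis using S(2) u(2,3) by simp
  qed
  then show ?thesis using u by blast
qed

section \<open>From places to one-parameter subgroups\<close>

lemma sum_lessThan_add: "(\<Sum>i<a + b. f i) = (\<Sum>i<a. f i) + (\<Sum>j<b. f (a + j) :: 'b::comm_monoid_add)" for a b :: nat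
  by (induction b) (simp_all add: add.assoc)

lemma prod_lessThan_add: "(\<Prod>i<a + b. f i) = (\<Prod>i<a. f i) * (\<Prod>j<b. f (a + j) :: 'b::comm_monoid_mult)" for a b :: nat
  by (induction b) (simp_all add: mult.assoc)

text \<open>Numbers the coordinates consecutively, because \<open>total_cone\<close> works with
  initial segments of the natural numbers.\<close>

definition enc :: "nat \<Rightarrow> (coord \<Rightarrow> 'b) \<Rightarrow> nat \<Rightarrow> 'b" where
  "enc m w i = (if i < m + 1 then w (Inl i) else w (Inr (i - (m + 1))))"

definition dec :: "nat \<Rightarrow> nat \<Rightarrow> (nat \<Rightarrow> rat) \<Rightarrow> coord \<Rightarrow> rat" where
  "dec m n x v = (if v \<in> coords m n then case v of Inl i \<Rightarrow> x i | Inr j \<Rightarrow> x (m + 1 + j) else 0)"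

lemma dotp_enc: "dotp (m + 1 + (n + 1)) (enc m w) x = rat_pairing m n w (dec m n x)"
proof -
  have "dotp (m + 1 + (n + 1)) (enc m w) x =
      (\<Sum>i<m + 1. of_int (w (Inl i)) * x i) + (\<Sum>j<n + 1. of_int (w (Inr j)) * x (m + 1 + j))"
    unfolding dotp_def sum_lessThan_add by (intro arg_cong2[where f="(+)"] sum.cong) (auto simp: enc_def)
  also have "\<dots> = rat_pairing m n w (dec m n x)"
    unfolding rat_pairing_def sum_coords by (intro arg_cong2[where f="(+)"] sum.cong) (auto simp: dec_def coords_def)
  finally show ?thesis .
qed

lemma prod_enc: "(\<Prod>i<m + 1 + (n + 1). enc m E i powi enc m w i) = (\<Prod>v\<in>coords m n. E v powi w v :: complex)"
proof -
  have "(\<Prod>i<m + 1 + (n + 1). enc m E i powi enc m w i) =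
      (\<Prod>i<m + 1. E (Inl i) powi w (Inl i)) * (\<Prod>j<n + 1. E (Inr j) powi w (Inr j))"
    unfolding prod_lessThan_add by (intro arg_cong2[where f="(*)"] prod.cong) (auto simp: enc_def)
  also have "\<dots> = (\<Prod>v\<in>coords m n. E v powi w v)"
    unfolding prod_coords by (intro arg_cong2[where f="(*)"] prod.cong) auto
  finally show ?thesis .
qed

lemma prod_powi_root_vec:
  assumes "a \<in> coords m n" "b \<in> coords m n" "a \<noteq> b"
  shows "(\<Prod>v\<in>coords m n. E v powi root_vec a b v) = E a * inverse (E b :: complex)"
proof -
  have "(\<Prod>v\<in>coords m n. E v powi root_vec a b v) =
      (\<Prod>v\<in>coords m n. (if v = a then E a else 1) * (if v = b then inverse (E b) else 1))"
    by (rule prod.cong) (use assms in \<open>auto simp: root_vec_def power_int_minus\<close>)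
  then show ?thesis using assms by (simp add: prod.distrib)
qed

lemma mon_val_coords:
  assumes "ks I \<subseteq> coords m n"
  shows "mon_val E I = (\<Prod>v\<in>coords m n. E v powi int (lk I v))"
  using mon_val_superset[OF finite_coords assms, of E] by simp

lemma sbst_nonzero:
  assumes A: "A \<in> SL (m + 1)" "B \<in> SL (n + 1)" and F: "F \<in> bihom_forms m n k l" "F \<noteq> 0"
  shows "sbst A B F \<noteq> 0"
proof
  assume *: "sbst A B F = 0"
  have "F = sbst (1\<^sub>m (m + 1)) (1\<^sub>m (n + 1)) F" using sbst_one[OF F(1)] by simp
  also have "\<dots> = sbst (adj_mat A) (adj_mat B) (sbst A B F)"
    using sbst_comp[OF SL_carrier[OF SL_adj(1)[OF A(1)]] SL_carrier[OF SL_adj(1)[OF A(2)]] SL_carrier[OF A(1)] SL_carrier[OF A(2)] F(1)]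
    by (simp add: SL_adj(2)[OF A(1)] SL_adj(2)[OF A(2)])
  also have "\<dots> = 0" by (simp only: *) (simp add: sbst_def)
  finally show False using F(2) by simp
qed

context place
begin

lemma integral_sum: "(\<And>i. i \<in> S \<Longrightarrow> integral (x i)) \<Longrightarrow> integral (\<lambda>s. \<Sum>i\<in>S. x i s)"
  by (rule integralI, rule R_sum, rule pl_residue)

lemma integral_power: "integral x \<Longrightarrow> integral (\<lambda>s. x s ^ n)"
  by (rule integralI, rule R_power, rule pl_residue)

text \<open>Integrality of a Laurent monomial says that its order in the value group is nonnegative,
  and \<open>integral_or_inverse\<close> is the totality of that order. In this way the value group
  is used without being constructed.\<close>

lemma total_cone_monomials:
  assumes D: "\<And>i. i < N \<Longrightarrow> ae (\<lambda>s. D s i \<noteq> 0)"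
  shows "total_cone N (\<lambda>w. integral (\<lambda>s. \<Prod>i<N. D s i powi w i))"
proof
  show "integral (\<lambda>s. \<Prod>i<N. D s i powi w' i)"
    if "\<And>i. i < N \<Longrightarrow> w i = w' i" "integral (\<lambda>s. \<Prod>i<N. D s i powi w i)" for w w' :: "nat \<Rightarrow> int"
    using that by simp
  show "integral (\<lambda>s. \<Prod>i<N. D s i powi (w i + w' i))"
    if "integral (\<lambda>s. \<Prod>i<N. D s i powi w i)" "integral (\<lambda>s. \<Prod>i<N. D s i powi w' i)" for w w' :: "nat \<Rightarrow> int"
    by (rule ae_integral_cong[OF ae_all_less[OF D] integral_mult[OF that]])
       (auto simp: power_int_add prod.distrib[symmetric] intro!: prod.cong)
  have e: "(\<Prod>i<N. D s i powi - w i) = inverse (\<Prod>i<N. D s i powi w i)" for s and w :: "nat \<Rightarrow> int"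
    by (simp add: power_int_minus prod_inversef[symmetric] o_def)
  show "integral (\<lambda>s. \<Prod>i<N. D s i powi w i) \<or> integral (\<lambda>s. \<Prod>i<N. D s i powi - w i)" for w :: "nat \<Rightarrow> int"
    unfolding e by (rule integral_or_inverse)
qed

lemma monom_coeff_pl:
  assumes "imat (m + 1) a" "imat (n + 1) b" "F \<in> bihom_forms m n k l"
  shows "pl (\<lambda>s. lk (sbst (a s) (b s) F) I) (lk (sbst (rmat (m + 1) a) (rmat (n + 1) b) F) I)"
  using frel_sbst[of a m "rmat (m + 1) a" b n "rmat (n + 1) b" F k l "\<lambda>_. F"] assms imat_carrier imat_pl
  by (simp add: frel_const frel_def del: One_nat_def Suc_eq_plus1 add_Suc_right)

text \<open>
  A diagonalisation \<open>A = a d b\<close> with \<open>a\<close>, \<open>b\<close> integral turns integrality of the form into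
  inequalities for the orders of the entries of \<open>d\<close>, one for each monomial of the residue of the
  form translated by \<open>a\<close>.
\<close>

lemma destabilizing_subgroup:
  assumes pos: "m > 0" "n > 0" "k > 0" "l > 0"
    and F: "F \<in> bihom_forms m n k l" "F \<noteq> 0"
    and A: "\<And>s. A s \<in> carrier_mat (m + 1) (m + 1)" "\<And>s. det (A s) = 1"
    and B: "\<And>s. B s \<in> carrier_mat (n + 1) (n + 1)" "\<And>s. det (B s) = 1"
    and int: "\<And>I. integral (\<lambda>s. lk (sbst (A s) (B s) F) I)"
    and nontriv: "\<not> (\<forall>I. pl (\<lambda>s. lk (sbst (A s) (B s) F) I) 0) \<Longrightarrow>
      \<not> ((\<forall>i<m + 1. \<forall>j<m + 1. integral (\<lambda>s. A s $$ (i, j))) \<and> (\<forall>i<n + 1. \<forall>j<n + 1. integral (\<lambda>s. B s $$ (i, j))))"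
  shows "\<exists>g\<in>grp m n. \<exists>u\<in>fundamental_set m n k l. Supp (act g F) \<subseteq>
    (if \<forall>I. pl (\<lambda>s. lk (sbst (A s) (B s) F) I) 0 then N_plus m n k l u else N_oplus m n k l u)"
proof -
  define strict where "strict \<longleftrightarrow> (\<forall>I. pl (\<lambda>s. lk (sbst (A s) (B s) F) I) 0)"
  have aeT: "ae (\<lambda>s. True)" using ae_ball[of "{}" "\<lambda>_ _. True"] by simp
  have "ae (\<lambda>s. det (A s) = 1)" "ae (\<lambda>s. det (B s) = 1)" using A B aeT by simp_all
  from elementary_divisors[OF A(1) this(1)] elementary_divisors[OF B(1) this(2)] obtain a b d a' b' d' where
    a: "imat (m + 1) a" "imat (m + 1) b" "ae (\<lambda>s. A s = a s * mat_diag (m + 1) (d s) * b s)"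
    "\<forall>i<m + 1. ae (\<lambda>s. d s i \<noteq> 0)" "\<forall>i<m + 1. \<forall>j<m + 1. i < j \<longrightarrow> integral (\<lambda>s. d s i * inverse (d s j))"
    "ae (\<lambda>s. (\<Prod>i<m + 1. d s i) = 1)" and
    a': "imat (n + 1) a'" "imat (n + 1) b'" "ae (\<lambda>s. B s = a' s * mat_diag (n + 1) (d' s) * b' s)"
    "\<forall>i<n + 1. ae (\<lambda>s. d' s i \<noteq> 0)" "\<forall>i<n + 1. \<forall>j<n + 1. i < j \<longrightarrow> integral (\<lambda>s. d' s i * inverse (d' s j))"
    "ae (\<lambda>s. (\<Prod>i<n + 1. d' s i) = 1)" by (elim exE conjE) (rule that)
  define a0 a0' where "a0 = rmat (m + 1) a" and "a0' = rmat (n + 1) a'"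
  define G where "G s = sbst (a s) (a' s) F" for s
  define G0 where "G0 = sbst a0 a0' F"
  have SL0: "a0 \<in> SL (m + 1)" "a0' \<in> SL (n + 1)" using rmat_SL a(1) a'(1) by (auto simp: a0_def a0'_def)
  have G0: "G0 \<in> bihom_forms m n k l" "G0 \<noteq> 0"
    using sbst_bihom[OF SL_carrier[OF SL0(1)] SL_carrier[OF SL0(2)] F(1)] sbst_nonzero[OF SL0 F] by (auto simp: G0_def)
  have Gpl: "pl (\<lambda>s. lk (G s) I) (lk G0 I)" for I
    unfolding G_def G0_def a0_def a0'_def by (rule monom_coeff_pl[OF a(1) a'(1) F(1)])
  define E where "E s = case_sum (d s) (d' s)" for s
  \<comment> \<open>With \<open>A = a d b\<close>, undoing \<open>b\<close> leaves the diagonal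
    matrix acting on \<open>F\<close> translated by \<open>a\<close>, and there each coefficient is
    just multiplied by a monomial in the divisors.\<close>
  have EG: "ae (\<lambda>s. lk (sbst (adj_mat (b s)) (adj_mat (b' s)) (sbst (A s) (B s) F)) I = mon_val (E s) I * lk (G s) I)" for I
  proof (rule ae_mono[OF ae_conj[OF a(3) a'(3)]])
    fix s assume s: "A s = a s * mat_diag (m + 1) (d s) * b s \<and> B s = a' s * mat_diag (n + 1) (d' s) * b' s"
    have SLs: "b s \<in> SL (m + 1)" "b' s \<in> SL (n + 1)" "a s \<in> SL (m + 1)" "a' s \<in> SL (n + 1)"
      using a a' by (auto simp: imat_def)
    note c = SLs[THEN SL_carrier]
    note ca = SL_carrier[OF SL_adj(1)[OF SLs(1)]] SL_carrier[OF SL_adj(1)[OF SLs(2)]]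
    note dd = mat_diag_dim[of "m + 1" "d s"] mat_diag_dim[of "n + 1" "d' s"]
    have e: "X * D * Y * adj_mat Y = X * D" if "X \<in> carrier_mat N N" "D \<in> carrier_mat N N" "Y \<in> SL N" for X D Y :: "complex mat" and N
    proof -
      have "X * D * Y * adj_mat Y = X * D * (Y * adj_mat Y)"
        using that SL_carrier[OF SL_adj(1)[OF that(3)]] SL_carrier[OF that(3)] by (intro assoc_mult_mat) auto
      also have "\<dots> = X * D" unfolding SL_adj(2)[OF that(3)] using that by (intro right_mult_one_mat) auto
      finally show ?thesis .
    qed
    have "sbst (adj_mat (b s)) (adj_mat (b' s)) (sbst (A s) (B s) F) =
        sbst (A s * adj_mat (b s)) (B s * adj_mat (b' s)) F" by (rule sbst_comp[OF ca A(1) B(1) F(1)])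
    also have "\<dots> = sbst (a s * mat_diag (m + 1) (d s)) (a' s * mat_diag (n + 1) (d' s)) F"
      using s e[OF c(3) dd(1) SLs(1)] e[OF c(4) dd(2) SLs(2)] by simp
    also have "\<dots> = sbst (mat_diag (m + 1) (d s)) (mat_diag (n + 1) (d' s)) (G s)"
      unfolding G_def by (rule sbst_comp[OF dd c(3,4) F(1), symmetric])
    finally show "lk (sbst (adj_mat (b s)) (adj_mat (b' s)) (sbst (A s) (B s) F)) I = mon_val (E s) I * lk (G s) I"
      using lk_sbst_diag[OF sbst_bihom[OF c(3,4) F(1)]] by (simp add: G_def E_def)
  qed
  have bwd: "lk (sbst (adj_mat (b s)) (adj_mat (b' s)) (sbst (A s) (B s) F)) I =
      (\<Sum>J\<in>Xi m n k l. lk (sbst (adj_mat (b s)) (adj_mat (b' s)) (sg J 1)) I * lk (sbst (A s) (B s) F) J)" for s I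
    unfolding lk_sbst[OF sbst_bihom[OF A(1) B(1) F(1)]] monom_coeff_def ..
  have coefs: "pl (\<lambda>s. lk (sbst (adj_mat (b s)) (adj_mat (b' s)) (sg J 1)) I)
      (lk (sbst (rmat (m + 1) (\<lambda>s. adj_mat (b s))) (rmat (n + 1) (\<lambda>s. adj_mat (b' s))) (sg J 1)) I)" if "J \<in> Xi m n k l" for I J
    by (rule monom_coeff_pl[OF imat_adj[OF a(2)] imat_adj[OF a'(2)] single_bihom[OF that]])
  \<comment> \<open>Where the residue \<open>G0\<close> has a nonzero coefficient, the coefficient
    of \<open>G s\<close> is a unit. Dividing by it leaves the monomial in the divisors, which
    inherits integrality, and residue 0 in the strict case, from the translated form.\<close>
  have unitE: "integral (\<lambda>s. mon_val (E s) I)" "strict \<Longrightarrow> pl (\<lambda>s. mon_val (E s) I) 0" if I: "lk G0 I \<noteq> 0" for I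
  proof -
    have inv: "pl (\<lambda>s. inverse (lk (G s) I)) (inverse (lk G0 I))" by (rule pl_inverse[OF Gpl I])
    have nz: "ae (\<lambda>s. lk (G s) I \<noteq> 0)" by (rule ae_nonzero[OF Gpl I])
    have i: "integral (\<lambda>s. lk (sbst (adj_mat (b s)) (adj_mat (b' s)) (sbst (A s) (B s) F)) I)"
      unfolding bwd by (intro integral_sum integral_mult integralI[OF coefs] int)
    show "integral (\<lambda>s. mon_val (E s) I)"
      by (rule ae_integral_cong[OF ae_conj[OF EG[of I] nz] integral_mult[OF i integralI[OF inv]]]) simp
    assume strict
    have p: "pl (\<lambda>s. lk (sbst (adj_mat (b s)) (adj_mat (b' s)) (sbst (A s) (B s) F)) I) (\<Sum>J\<in>Xi m n k l.
      lk (sbst (rmat (m + 1) (\<lambda>s. adj_mat (b s))) (rmat (n + 1) (\<lambda>s. adj_mat (b' s))) (sg J 1)) I * 0)"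
      unfolding bwd by (intro R_sum R_mult coefs) (use \<open>strict\<close> in \<open>auto simp: strict_def\<close>)
    have "pl (\<lambda>s. mon_val (E s) I) ((\<Sum>J\<in>Xi m n k l.
      lk (sbst (rmat (m + 1) (\<lambda>s. adj_mat (b s))) (rmat (n + 1) (\<lambda>s. adj_mat (b' s))) (sg J 1)) I * 0) * inverse (lk G0 I))"
      by (rule ae_cong[OF ae_conj[OF EG[of I] nz] R_mult[OF p inv]]) simp
    then show "pl (\<lambda>s. mon_val (E s) I) 0" by simp
  qed
  define N where "N = m + 1 + (n + 1)"
  define P where "P w = integral (\<lambda>s. \<Prod>i<N. enc m (E s) i powi w i)" for w
  have Enz: "ae (\<lambda>s. enc m (E s) i \<noteq> 0)" if "i < N" for i
    using a(4) a'(4) that by (cases "i < m + 1") (auto simp: enc_def E_def N_def)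
  interpret total_cone N P
    unfolding P_def by (rule total_cone_monomials[OF Enz])
  have P_enc: "P (enc m w) \<longleftrightarrow> integral (\<lambda>s. \<Prod>v\<in>coords m n. E s v powi w v)" for w
    unfolding P_def N_def prod_enc ..
  have Enz': "ae (\<lambda>s. \<forall>v\<in>coords m n. E s v \<noteq> 0)"
  proof (rule ae_ball[OF finite_coords])
    fix v assume "v \<in> coords m n"
    then show "ae (\<lambda>s. E s v \<noteq> 0)" using a(4) a'(4) by (auto simp: coords_def E_def)
  qed
  define wt where "wt I v = int (lk I v)" for I :: "coord monom" and v
  define un where "un a v = (if v = a then 1 else 0 :: int)" for a v :: coord
  define el where "el = case_sum (\<lambda>_ :: nat. 1) (\<lambda>_ :: nat. 0 :: int)"
  define er where "er = case_sum (\<lambda>_ :: nat. 0) (\<lambda>_ :: nat. 1 :: int)"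
  \<comment> \<open>The vectors whose sign has to be reproduced: the weights of the monomials of
    \<open>G0\<close>, the unit vectors to exclude the zero solution, the two block sums, and the
    simple roots for dominance.\<close>
  define T where "T = wt ` ks G0 \<union> un ` coords m n \<union> {el, er} \<union>
    (\<lambda>i. root_vec (Inl i) (Inl (i + 1))) ` {..<m} \<union> (\<lambda>j. root_vec (Inr j) (Inr (j + 1))) ` {..<n}"
  \<comment> \<open>With the negatives included, vanishing and strict positivity are reproduced
    too.\<close>
  define T' where "T' = enc m ` (T \<union> (\<lambda>w v. - w v) ` T)"
  have "finite T'" by (simp add: T'_def T_def)
  from total_cone_weights[OF total_cone_axioms this] obtain x where x: "\<And>w. w \<in> T' \<Longrightarrow> P w \<longleftrightarrow> dotp N w x \<ge> 0" by blast
  define y where "y = dec m n x"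
  have y: "P (enc m w) \<longleftrightarrow> rat_pairing m n w y \<ge> 0" if "w \<in> T" for w
    using x[of "enc m w"] that dotp_enc[of m n w x] by (auto simp: T'_def N_def y_def)
  have y': "P (enc m (\<lambda>v. - w v)) \<longleftrightarrow> rat_pairing m n w y \<le> 0" if "w \<in> T" for w
  proof -
    have "rat_pairing m n (\<lambda>v. - w v) y = - rat_pairing m n w y" by (simp add: rat_pairing_def sum_negf)
    moreover have "enc m (\<lambda>v. - w v) \<in> T'" using that by (auto simp: T'_def)
    ultimately show ?thesis using x[of "enc m (\<lambda>v. - w v)"] dotp_enc[of m n "\<lambda>v. - w v" x] by (simp add: N_def y_def)
  qed
  have rat_pairing_el: "rat_pairing m n el y = (\<Sum>i\<le>m. y (Inl i))" and rat_pairing_er: "rat_pairing m n er y = (\<Sum>j\<le>n. y (Inr j))"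
    by (simp_all add: rat_pairing_def sum_coords el_def er_def)
  have one: "integral x" if "ae (\<lambda>s. x s = 1)" for x
    by (rule ae_integral_cong[OF that integral_const[of 1]]) simp
  have pinv: "(\<Prod>i\<in>K. inverse (f i)) = inverse (\<Prod>i\<in>K. f i :: complex)" for f :: "nat \<Rightarrow> complex" and K
    using prod_inversef[of f K] by (simp add: o_def)
  have Pel: "P (enc m el)" "P (enc m (\<lambda>v. - el v))"
    \<comment> \<open>The product of the divisors of one block is 1 almost everywhere, so this
      vector and its negative are both nonnegative; for the rational weights this becomes the sum
      condition.\<close>
    unfolding P_enc
    by (rule one[OF ae_mono[OF a(6)]], simp add: prod_coords E_def el_def lessThan_Suc_atMost power_int_minus pinv)+
  have Per: "P (enc m er)" "P (enc m (\<lambda>v. - er v))"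
    unfolding P_enc
    by (rule one[OF ae_mono[OF a'(6)]], simp add: prod_coords E_def er_def lessThan_Suc_atMost power_int_minus pinv)+
  have zs: "y \<in> zero_sums m n"
  proof -
    have "el \<in> T" "er \<in> T" by (auto simp: T_def)
    then have "rat_pairing m n el y = 0" "rat_pairing m n er y = 0" using y[of el] y'[of el] y[of er] y'[of er] Pel Per by auto
    moreover have "y v = 0" if "v \<notin> coords m n" for v using that by (simp add: y_def dec_def)
    ultimately show ?thesis using rat_pairing_el rat_pairing_er by (simp add: zero_sums_def)
  qed
  have dom: "dominant m n y"
  proof -
    have "y (Inl (i + 1)) \<le> y (Inl i)" if "i < m" for i
    proof -
      have r: "root_vec (Inl i) (Inl (i + 1)) \<in> T" using that by (auto simp: T_def)
      have c: "Inl i \<in> coords m n" "Inl (i + 1) \<in> coords m n" using that by (auto simp: coords_def)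
      have "P (enc m (root_vec (Inl i) (Inl (i + 1))))"
        unfolding P_enc using a(5) that c by (subst prod_powi_root_vec) (auto simp: E_def)
      then show ?thesis using y[OF r] rat_pairing_root_vec[OF c] by simp
    qed
    moreover have "y (Inr (i + 1)) \<le> y (Inr i)" if "i < n" for i
    proof -
      have r: "root_vec (Inr i) (Inr (i + 1)) \<in> T" using that by (auto simp: T_def)
      have c: "Inr i \<in> coords m n" "Inr (i + 1) \<in> coords m n" using that by (auto simp: coords_def)
      have "P (enc m (root_vec (Inr i) (Inr (i + 1))))"
        unfolding P_enc using a'(5) that c by (subst prod_powi_root_vec) (auto simp: E_def)
      then show ?thesis using y[OF r] rat_pairing_root_vec[OF c] by simp
    qed
    ultimately show ?thesis by (simp add: dominant_def)
  qed
  define S where "S = (if strict then {q. q > 0} else {q. q \<ge> (0 :: rat)})"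
  have wtS: "rat_pairing m n (wt I) y \<in> S" if I: "I \<in> ks G0" for I
  proof -
    have T: "wt I \<in> T" using I by (auto simp: T_def)
    have c: "ks I \<subseteq> coords m n" by (rule bihom_coords[OF G0(1) I])
    have m: "(\<Prod>v\<in>coords m n. E s v powi wt I v) = mon_val (E s) I" for s
      unfolding mon_val_coords[OF c] wt_def ..
    have I0: "lk G0 I \<noteq> 0" using I by (simp add: in_keys_iff)
    have "P (enc m (wt I))" unfolding P_enc m by (rule unitE(1)[OF I0])
    \<comment> \<open>A function of residue 0 that is nonzero almost everywhere cannot have an
      integral inverse, since the product would have residue 0 and 1.\<close>
    moreover have "\<not> P (enc m (\<lambda>v. - wt I v))" if strict
    proof
      assume "P (enc m (\<lambda>v. - wt I v))"
      then have "integral (\<lambda>s. inverse (mon_val (E s) I))"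
        unfolding P_enc m[symmetric] by (simp add: power_int_minus prod_inversef[symmetric] o_def)
      then obtain c' where c': "pl (\<lambda>s. inverse (mon_val (E s) I)) c'" by (auto simp: integral_def)
      have "ae (\<lambda>s. mon_val (E s) I \<noteq> 0)"
        by (rule ae_mono[OF Enz']) (use c in \<open>auto simp: mon_val_def\<close>)
      from ae_cong[OF this R_mult[OF unitE(2)[OF I0 that] c'], of "\<lambda>_. 1"] have "pl (\<lambda>_. 1) (0 * c')" by simp
      from pl_unique[OF this R_const] show False by simp
    qed
    ultimately show ?thesis using y[OF T] y'[OF T] by (auto simp: S_def)
  qed
  \<comment> \<open>In the strict case a positive weight excludes \<open>y = 0\<close>. Otherwise
    \<open>y = 0\<close> would make all divisors integral, and with them \<open>A\<close> and
    \<open>B\<close>, against \<open>nontriv\<close>.\<close>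
  have y0: "y \<noteq> (\<lambda>_. 0)"
  proof
    assume y_zero: "y = (\<lambda>_. 0)"
    then have pr0: "rat_pairing m n w y = 0" for w by (simp add: rat_pairing_def)
    show False
    proof (cases strict)
      case True
      obtain I where "I \<in> ks G0" using G0(2) by (metis all_not_in_conv keys_eq_empty)
      from wtS[OF this] show False using True pr0 by (simp add: S_def)
    next
      case False
      have Ei: "integral (\<lambda>s. E s v)" if v: "v \<in> coords m n" for v
      proof -
        have "un v \<in> T" using v by (auto simp: T_def)
        from y[OF this] have "P (enc m (un v))" by (simp add: pr0)
        moreover have "(\<Prod>u\<in>coords m n. E s u powi un v u) = E s v" for s
        proof -
          have "(\<Prod>u\<in>coords m n. E s u powi un v u) = (\<Prod>u\<in>coords m n. if u = v then E s v else 1)"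
            by (rule prod.cong) (auto simp: un_def)
          then show ?thesis using v by simp
        qed
        ultimately show ?thesis by (simp add: P_enc)
      qed
      have di: "integral (\<lambda>s. d s i)" if "i < m + 1" for i
        using Ei[of "Inl i"] that by (simp add: coords_def E_def)
      have di': "integral (\<lambda>s. d' s i)" if "i < n + 1" for i
        using Ei[of "Inr i"] that by (simp add: coords_def E_def)
      have ent: "integral (\<lambda>s. M s $$ (i, j))"
        if "imat K c" "imat K c'" "ae (\<lambda>s. M s = c s * mat_diag K (f s) * c' s)" "\<And>i. i < K \<Longrightarrow> integral (\<lambda>s. f s i)"
          "i < K" "j < K" for M c c' f K i j
      proof (rule ae_integral_cong[OF that(3)])
        show "integral (\<lambda>s. \<Sum>t\<in>{..<K}. c s $$ (i, t) * f s t * c' s $$ (t, j))"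
          by (intro integral_sum integral_mult that(4)) (use that in \<open>auto simp: imat_def\<close>)
        fix s assume "M s = c s * mat_diag K (f s) * c' s"
        moreover have "c s \<in> carrier_mat K K" "c' s \<in> carrier_mat K K" using that(1,2) imat_carrier by blast+
        ultimately show "(\<Sum>t\<in>{..<K}. c s $$ (i, t) * f s t * c' s $$ (t, j)) = M s $$ (i, j)"
          using that(5,6) by (simp add: mat_diag_mult_right[of _ K] scalar_prod_def atLeast0LessThan)
      qed
      show False using nontriv False ent[OF a(1-3) di] ent[OF a'(1-3) di'] unfolding strict_def by blast
    qed
  qed
  have "\<exists>u\<in>fundamental_set m n k l. \<forall>I\<in>ks G0. of_int (pairing m n I u) \<in> S"
  proof (rule fundamental_weights[OF pos finite_keys _ _ zs dom y0])
    show "ks G0 \<noteq> {}" using G0(2) by simp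
    show "ks G0 \<subseteq> Xi m n k l" using G0(1) by (simp add: bihom_forms_def)
    show "q \<in> S" if "p \<in> S" "p \<le> q" for p q using that by (auto simp: S_def split: if_splits)
    show "c * p \<in> S" if "p \<in> S" "c > 0" for p c using that by (auto simp: S_def split: if_splits)
    show "rat_pairing m n (\<lambda>v. int (lk I v)) y \<in> S" if "I \<in> ks G0" for I using wtS[OF that] by (simp add: wt_def[abs_def])
  qed
  then obtain u where u: "u \<in> fundamental_set m n k l" "\<And>I. I \<in> ks G0 \<Longrightarrow> of_int (pairing m n I u) \<in> S" by blast
  have "Supp G0 \<subseteq> (if strict then N_plus m n k l u else N_oplus m n k l u)"
    using u(2) G0(1) by (auto simp: Supp_def S_def N_plus_def N_oplus_def in_keys_iff bihom_forms_def)
  then have "\<exists>A\<in>SL (m + 1). \<exists>B\<in>SL (n + 1). \<exists>u\<in>fundamental_set m n k l.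
      Supp (sbst A B F) \<subseteq> (if strict then N_plus m n k l u else N_oplus m n k l u)"
    using u(1) SL0 unfolding G0_def by blast
  then show ?thesis unfolding strict_def by (simp only: bex_act[symmetric, where P="\<lambda>H. \<exists>u\<in>fundamental_set m n k l. Supp H \<subseteq> _ u"])
qed

end

section \<open>Destabilising subgroups\<close>

definition pvars :: "'v set \<Rightarrow> 'v cpoly set" where
  "pvars X = {p. \<forall>M\<in>ks p. ks M \<subseteq> X}"

lemma pvars_const: "const c \<in> pvars X"
  by (auto simp: pvars_def const_def split: if_splits)

lemma pvars_var: "v \<in> X \<Longrightarrow> var v \<in> pvars X"
  by (auto simp: pvars_def var_single)

lemma pvars_add: "p \<in> pvars X \<Longrightarrow> q \<in> pvars X \<Longrightarrow> p + q \<in> pvars X"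
  using keys_add[of p q] by (auto simp: pvars_def)

lemma pvars_mult:
  assumes "p \<in> pvars X" "q \<in> pvars X"
  shows "p * q \<in> pvars X"
  unfolding pvars_def
proof safe
  fix M v assume "M \<in> ks (p * q)" "v \<in> ks M"
  with keys_mult[of p q] obtain a b where "M = a + b" "a \<in> ks p" "b \<in> ks q" by blast
  with assms \<open>v \<in> ks M\<close> show "v \<in> X" by (auto simp: pvars_def ks_add_nat)
qed

lemma poly_eval_1 [simp]: "poly_eval a 1 = 1"
  using poly_eval_const[of a 1] by simp

lemma value_homogeneous:
  assumes "f \<in> hom_forms X (\<lambda>_. 1) d"
  shows "poly_eval (\<lambda>v. z * a v) f = z ^ d * poly_eval a f"
proof -
  have "mon_val (\<lambda>v. z * a v) M = z ^ wdeg (\<lambda>_. 1) M * mon_val a M" for M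
    by (induction M rule: monom_induct) (simp_all add: mon_val_add wdeg_add power_add)
  then have "poly_eval (\<lambda>v. z * a v) f = (\<Sum>M\<in>ks f. z ^ d * (lk f M * mon_val a M))"
    unfolding poly_eval_ins evl.ins_def using assms by (intro sum.cong) (auto simp: hom_forms_def)
  then show ?thesis by (simp add: poly_eval_ins evl.ins_def sum_distrib_left)
qed

lemma value_scale:
  assumes "f \<in> hom_forms X (\<lambda>_. 1) d"
  shows "value_at f (const z * G) = z ^ d * value_at f G"
  using value_homogeneous[OF assms, of z "lk G"] by (simp add: value_at_def lk_const_mult[abs_def] cong: poly_eval_cong)

lemma value_zero:
  assumes "f \<in> hom_forms X (\<lambda>_. 1) d" "d \<ge> 1"
  shows "value_at f 0 = 0"
proof -
  have z: "(0 :: complex) ^ d = 0" using assms(2) by simp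
  have e: "value_at f 0 = 0 ^ d * value_at f 0"
    using value_scale[OF assms(1), of 0 0] by (simp only: const_0 mult_zero_left)
  show ?thesis by (subst e) (simp add: z)
qed

lemma value_inv:
  assumes "invariant_section m n k l d f" "A \<in> SL (m + 1)" "B \<in> SL (n + 1)" "F \<in> bihom_forms m n k l"
  shows "value_at f (sbst A B F) = value_at f F"
proof -
  have "\<forall>g\<in>grp m n. value_at f (act g F) = value_at f F"
    using assms(1,4) by (simp add: invariant_section_def)
  then show ?thesis using assms(2,3) unfolding ball_act[of m n "\<lambda>H. value_at f H = value_at f F"] by blast
qed

text \<open>The family is the tautological one over the whole group, and its special value is the
  zero form, legitimate by \<open>unstable_closure\<close>. All coefficients then have residue 0,
  which is the strict case.\<close>

lemma unstable_destabilized: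
  assumes pos: "m > 0" "n > 0" "k > 0" "l > 0"
    and F: "F \<in> bihom_forms m n k l" "F \<noteq> 0" and un: "git_unstable m n k l F"
  shows "\<exists>g\<in>grp m n. \<exists>u\<in>fundamental_set m n k l. Supp (act g F) \<subseteq> N_plus m n k l u"
proof -
  let ?X = "Xi m n k l"
  let ?S = "SL (m + 1) \<times> SL (n + 1)"
  have "\<exists>\<Gamma>. place \<Gamma> \<and> (\<forall>x p. p \<in> pvars ?X \<longrightarrow> (\<forall>s\<in>?S. x s = value_at p (sbst (fst s) (snd s) F)) \<longrightarrow>
      place.pl \<Gamma> x (value_at p 0)) \<and> place.ae \<Gamma> (\<lambda>s. s \<in> ?S)"
  proof (rule place_of_evaluation)
    show "\<exists>p\<in>pvars ?X. (\<forall>s\<in>?S. value_at p (sbst (fst s) (snd s) F) = c) \<and> value_at p 0 = c" for c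
      by (intro bexI[of _ "const c"] pvars_const) (simp add: value_at_def)
    show "value_at p 0 = 0" if "p \<in> pvars ?X" "\<And>s. s \<in> ?S \<Longrightarrow> value_at p (sbst (fst s) (snd s) F) = 0" for p
      by (rule unstable_closure[OF F un]) (use that in \<open>force simp: pvars_def\<close>)+
  qed (auto simp: pvars_add pvars_mult value_at_def poly_eval_add poly_eval_mult)
  then obtain \<Gamma> where \<Gamma>: "place \<Gamma>" "\<And>x p. p \<in> pvars ?X \<Longrightarrow> (\<And>s. s \<in> ?S \<Longrightarrow> x s = value_at p (sbst (fst s) (snd s) F)) \<Longrightarrow>
      place.pl \<Gamma> x (value_at p 0)" by auto
  interpret place \<Gamma> by (rule \<Gamma>(1))
  \<comment> \<open>The identity as default value keeps the determinant 1 at every parameter, as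
    \<open>destabilizing_subgroup\<close> demands.\<close>
  define A where "A s = (if fst s \<in> SL (m + 1) then fst s else 1\<^sub>m (m + 1))" for s :: "complex mat \<times> complex mat"
  define B where "B s = (if snd s \<in> SL (n + 1) then snd s else 1\<^sub>m (n + 1))" for s :: "complex mat \<times> complex mat"
  have SL: "A s \<in> SL (m + 1)" "B s \<in> SL (n + 1)" for s by (auto simp: A_def B_def SL_one simp del: One_nat_def)
  have p0: "pl (\<lambda>s. lk (sbst (A s) (B s) F) I) 0" for I
  proof (cases "I \<in> ?X")
    case True
    have "pl (\<lambda>s. lk (sbst (A s) (B s) F) I) (value_at (var I) 0)"
      by (rule \<Gamma>(2)[OF pvars_var[OF True]]) (auto simp: value_at_def A_def B_def)
    then show ?thesis by (simp add: value_at_def)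
  next
    case False
    have "lk (sbst (A s) (B s) F) I = 0" for s
      using sbst_bihom[OF SL_carrier[OF SL(1)] SL_carrier[OF SL(2)] F(1), of s s] False
      by (auto simp: bihom_forms_def in_keys_iff)
    then show ?thesis by (simp add: R_const)
  qed
  have d: "A s \<in> carrier_mat (m + 1) (m + 1)" "det (A s) = 1" "B s \<in> carrier_mat (n + 1) (n + 1)" "det (B s) = 1" for s
    using SL[of s] by (auto simp: SL_def)
  from destabilizing_subgroup[of m n k l F A B, OF pos F d] p0 show ?thesis
    using integralI[OF p0] by simp
qed

text \<open>A semistable point \<open>H\<close> in the closure of the orbit but not on it is taken
  as special value on the cone over the orbit. An invariant that is nonzero at \<open>H\<close>
  controls the scalar. If \<open>A\<close> and \<open>B\<close> were integral, their residues would
  carry \<open>F\<close> to a multiple of \<open>H\<close>, so the family has a pole.\<close>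

lemma nonclosed_destabilized:
  assumes pos: "m > 0" "n > 0" "k > 0" "l > 0"
    and F: "F \<in> bihom_forms m n k l" "F \<noteq> 0" and nc: "\<not> orbit_closed_in_semistable m n k l F"
  shows "\<exists>g\<in>grp m n. \<exists>u\<in>fundamental_set m n k l. Supp (act g F) \<subseteq> N_oplus m n k l u"
proof -
  let ?X = "Xi m n k l"
  \<comment> \<open>All homogeneous equations of the orbit. They define the smallest closed set
    containing it, so a failure of closedness shows there.\<close>
  define P where "P = {p \<in> (\<Union>d. sections m n k l d). \<forall>H\<in>proj_orbit m n F. value_at p H = 0}"
  have orb: "const z * sbst A B F \<in> proj_orbit m n F" if "z \<noteq> 0" "A \<in> SL (m + 1)" "B \<in> SL (n + 1)" for z A B
  proof -
    have "(adj_mat A, adj_mat B) \<in> grp m n" using SL_adj(1)[OF that(2)] SL_adj(1)[OF that(3)] by (simp add: grp_def)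
    then show ?thesis unfolding proj_orbit_def sbst_act[OF that(2,3)] using that(1) by blast
  qed
  obtain H where H: "git_semistable m n k l H" "H \<notin> proj_orbit m n F" "\<And>p. p \<in> P \<Longrightarrow> value_at p H = 0"
  proof -
    have "\<exists>H. git_semistable m n k l H \<and> \<not> (H \<in> proj_orbit m n F \<longleftrightarrow> (\<forall>p\<in>P. value_at p H = 0))"
    proof (rule ccontr)
      assume "\<not> ?thesis"
      moreover have "P \<subseteq> (\<Union>d. sections m n k l d)" by (auto simp: P_def)
      ultimately have "orbit_closed_in_semistable m n k l F"
        unfolding orbit_closed_in_semistable_def by (intro exI[of _ P]) blast
      then show False using nc by simp
    qed
    then obtain H where "git_semistable m n k l H" "\<not> (H \<in> proj_orbit m n F \<longleftrightarrow> (\<forall>p\<in>P. value_at p H = 0))" by blast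
    moreover have "\<forall>p\<in>P. value_at p H = 0" if "H \<in> proj_orbit m n F" using that by (auto simp: P_def)
    ultimately show ?thesis using that by blast
  qed
  then obtain d f where f: "d \<ge> 1" "invariant_section m n k l d f" "value_at f H \<noteq> 0" and Hb: "H \<in> bihom_forms m n k l"
    by (auto simp: git_semistable_def)
  have fs: "f \<in> hom_forms ?X (\<lambda>_. 1) d" using f(2) by (simp add: invariant_section_def sections_hom)
  define good where "good s \<longleftrightarrow> fst s \<noteq> 0 \<and> fst (snd s) \<in> SL (m + 1) \<and> snd (snd s) \<in> SL (n + 1)"
    for s :: "complex \<times> complex mat \<times> complex mat"
  define cone where "cone s = const (fst s) * sbst (fst (snd s)) (snd (snd s)) F" for s :: "complex \<times> complex mat \<times> complex mat"
  have "\<exists>\<Gamma>. place \<Gamma> \<and> (\<forall>x p. p \<in> pvars ?X \<longrightarrow> (\<forall>s\<in>Collect good. x s = value_at p (cone s)) \<longrightarrow>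
      place.pl \<Gamma> x (value_at p H)) \<and> place.ae \<Gamma> (\<lambda>s. s \<in> Collect good)"
  proof (rule place_of_evaluation)
    show "\<exists>p\<in>pvars ?X. (\<forall>s\<in>Collect good. value_at p (cone s) = c) \<and> value_at p H = c" for c
      by (intro bexI[of _ "const c"] pvars_const) (simp add: value_at_def)
    fix p assume p: "p \<in> pvars ?X" "\<And>s. s \<in> Collect good \<Longrightarrow> value_at p (cone s) = 0"
    let ?S = "{..Max (insert 0 (wdeg (\<lambda>_. 1) ` ks p))}"
    have sum: "p = (\<Sum>e\<in>?S. hpart e p)" by (rule hpart_sum) auto
    have hom: "hpart e p \<in> hom_forms ?X (\<lambda>_. 1) e" for e
      by (rule hpart_hom) (use p(1) in \<open>auto simp: pvars_def\<close>)
    have "value_at (hpart e p) H = 0" if e: "e \<in> ?S" for e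
    proof (rule H(3))
      have "value_at (hpart e p) G = 0" if G: "G \<in> proj_orbit m n F" for G
      proof -
        obtain z g where z: "z \<noteq> 0" "g \<in> grp m n" "G = const z * act g F" using G by (auto simp: proj_orbit_def)
        then obtain A B where "A \<in> SL (m + 1)" "B \<in> SL (n + 1)" "act g F = sbst A B F"
          using bex_act[of m n "\<lambda>K. act g F = K" F] by blast
        with z have AB: "A \<in> SL (m + 1)" "B \<in> SL (n + 1)" "G = const z * sbst A B F" by auto
        \<comment> \<open>On the scalar multiples of one form, \<open>p\<close> is the univariate
          polynomial \<open>Q\<close>, whose coefficients are the values of the homogeneous
          components; vanishing at all nonzero scalars kills each of them. This passes from
          arbitrary to homogeneous equations of the cone.\<close>
        define Q where "Q = (\<Sum>e\<in>?S. monom (value_at (hpart e p) (sbst A B F)) e)"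
        have "poly Q t = 0" if "t \<noteq> 0" for t
        proof -
          have "value_at p (const t * sbst A B F) = 0" using p(2)[of "(t, A, B)"] that AB by (simp add: good_def cone_def)
          moreover have "value_at p (const t * sbst A B F) = (\<Sum>e\<in>?S. t ^ e * value_at (hpart e p) (sbst A B F))"
            by (subst sum) (simp add: value_at_def poly_eval_sum, simp add: value_at_def[symmetric] value_scale[OF hom])
          ultimately show ?thesis by (simp add: Q_def poly_sum poly_monom mult.commute)
        qed
        then have "infinite {t. poly Q t = 0}"
          using infinite_super[of "- {0}" "{t. poly Q t = 0}"] by (auto simp: infinite_UNIV_char_0 finite_Diff2 Compl_eq_Diff_UNIV)
        then have "Q = 0" using poly_roots_finite by blast
        have "coeff Q e = value_at (hpart e p) (sbst A B F)"
          using e by (simp add: Q_def coeff_sum coeff_monom)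
        then show ?thesis using \<open>Q = 0\<close> by (simp add: AB(3) value_scale[OF hom])
      qed
      then show "hpart e p \<in> P" using hom unfolding P_def sections_hom by blast
    qed
    then show "value_at p H = 0" by (subst sum) (simp add: value_at_def poly_eval_sum)
  qed (auto simp: pvars_add pvars_mult value_at_def poly_eval_add poly_eval_mult)
  then obtain \<Gamma> where \<Gamma>: "place \<Gamma>" "\<And>x p. p \<in> pvars ?X \<Longrightarrow> (\<And>s. good s \<Longrightarrow> x s = value_at p (cone s)) \<Longrightarrow>
      place.pl \<Gamma> x (value_at p H)" "place.ae \<Gamma> good" by auto
  interpret place \<Gamma> by (rule \<Gamma>(1))
  note ae_good = \<Gamma>(3)
  define A where "A s = (if good s then fst (snd s) else 1\<^sub>m (m + 1))" for s
  define B where "B s = (if good s then snd (snd s) else 1\<^sub>m (n + 1))" for s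
  have SL: "A s \<in> SL (m + 1)" "B s \<in> SL (n + 1)" for s by (auto simp: A_def B_def good_def SL_one simp del: One_nat_def)
  have plf: "pl (\<lambda>s. value_at f (cone s)) (value_at f H)"
    by (rule \<Gamma>(2)) (use fs in \<open>auto simp: pvars_def hom_forms_def\<close>)
  have f_cone: "value_at f (cone s) = fst s ^ d * value_at f F" if "good s" for s
    using value_inv[OF f(2) _ _ F(1)] that by (simp add: cone_def value_scale[OF fs] good_def)
  have fF: "value_at f F \<noteq> 0"
  proof -
    from ae_exists[OF ae_conj[OF ae_good ae_nonzero[OF plf f(3)]]]
    obtain s where "good s" "value_at f (cone s) \<noteq> 0" by blast
    then show ?thesis using f_cone by auto
  qed
  \<comment> \<open>The value of \<open>f\<close> on the cone is the \<open>d\<close>-th power of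
    the scalar times \<open>value_at f F\<close>, and its residue \<open>value_at f H\<close> is
    nonzero. A pole of the scalar would force \<open>value_at f F = 0\<close>, and residue 0 would
    force \<open>value_at f H = 0\<close>.\<close>
  have z_pl: "\<exists>c. c \<noteq> 0 \<and> pl fst c"
  proof -
    have "integral fst"
    proof (rule ccontr)
      assume "\<not> integral fst"
      then obtain c where c: "pl (\<lambda>s. inverse (fst s)) c" using integral_or_inverse[of fst] by (auto simp: integral_def)
      have "c = 0"
      proof (rule ccontr)
        assume "c \<noteq> 0"
        from pl_inverse[OF c this] \<open>\<not> integral fst\<close> show False by (auto intro: integralI)
      qed
      have "pl (\<lambda>_. value_at f F) (c ^ d * value_at f H)"
        by (rule ae_cong[OF ae_good R_mult[OF R_power[OF c] plf]])
           (simp add: f_cone, simp add: good_def power_inverse)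
      from pl_unique[OF this R_const] show False using fF f(1) \<open>c = 0\<close> by (auto simp: power_0_left)
    qed
    then obtain c where c: "pl fst c" by (auto simp: integral_def)
    have "pl (\<lambda>s. value_at f (cone s)) (c ^ d * value_at f F)"
      by (rule ae_cong[OF ae_good R_mult[OF R_power[OF c] R_const]]) (simp add: f_cone)
    from pl_unique[OF this plf] f(1,3) have "c \<noteq> 0" by (auto simp: power_0_left)
    with c show ?thesis by blast
  qed
  then obtain cz where cz: "cz \<noteq> 0" "pl fst cz" by blast
  have pl_cone: "pl (\<lambda>s. lk (cone s) I) (lk H I)" if "I \<in> ?X" for I
    using \<Gamma>(2)[OF pvars_var[OF that], of "\<lambda>s. lk (cone s) I"] by (simp add: value_at_def)
  have pl_F: "pl (\<lambda>s. lk (sbst (A s) (B s) F) I) (inverse cz * lk H I)" for I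
  proof (cases "I \<in> ?X")
    case True
    show ?thesis
      by (rule ae_cong[OF ae_good R_mult[OF pl_inverse[OF cz(2,1)] pl_cone[OF True]]])
         (simp add: cone_def A_def B_def, simp add: good_def)
  next
    case False
    have "lk (sbst (A s) (B s) F) I = 0" for s
      using sbst_bihom[OF SL_carrier[OF SL(1)] SL_carrier[OF SL(2)] F(1), of s s] False
      by (auto simp: bihom_forms_def in_keys_iff)
    moreover have "lk H I = 0" using Hb False by (auto simp: bihom_forms_def in_keys_iff)
    ultimately show ?thesis by (simp add: R_const)
  qed
  have d: "A s \<in> carrier_mat (m + 1) (m + 1)" "det (A s) = 1" "B s \<in> carrier_mat (n + 1) (n + 1)" "det (B s) = 1" for s
    using SL[of s] by (auto simp: SL_def)
  have "\<not> ((\<forall>i<m + 1. \<forall>j<m + 1. integral (\<lambda>s. A s $$ (i, j))) \<and> (\<forall>i<n + 1. \<forall>j<n + 1. integral (\<lambda>s. B s $$ (i, j))))"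
  proof
    assume *: "(\<forall>i<m + 1. \<forall>j<m + 1. integral (\<lambda>s. A s $$ (i, j))) \<and> (\<forall>i<n + 1. \<forall>j<n + 1. integral (\<lambda>s. B s $$ (i, j)))"
    then have im: "imat (m + 1) A" "imat (n + 1) B" using SL by (auto simp: imat_def)
    have "lk H I = cz * lk (sbst (rmat (m + 1) A) (rmat (n + 1) B) F) I" for I
      using pl_unique[OF pl_F[of I] monom_coeff_pl[OF im F(1), of I]] cz(1) by (simp add: field_simps)
    then have "H = const cz * sbst (rmat (m + 1) A) (rmat (n + 1) B) F" by (intro poly_mapping_eqI) simp
    then show False using H(2) orb[OF cz(1) rmat_SL[OF im(1)] rmat_SL[OF im(2)]] by simp
  qed
  from destabilizing_subgroup[of m n k l F A B, OF pos F d integralI[OF pl_F] this]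
  obtain g u where "g \<in> grp m n" "u \<in> fundamental_set m n k l"
    "Supp (act g F) \<subseteq> N_plus m n k l u \<or> Supp (act g F) \<subseteq> N_oplus m n k l u" by (auto split: if_splits)
  moreover have "N_plus m n k l u \<subseteq> N_oplus m n k l u" for u by (auto simp: N_plus_def N_oplus_def)
  ultimately show ?thesis by blast
qed

lemma infinite_entry:
  assumes "infinite S" "S \<subseteq> carrier_mat M M \<times> carrier_mat N N"
  shows "(\<exists>i<M. \<exists>j<M. infinite ((\<lambda>(A, B). A $$ (i, j)) ` S)) \<or> (\<exists>i<N. \<exists>j<N. infinite ((\<lambda>(A, B). B $$ (i, j)) ` S))"
proof (rule ccontr)
  assume *: "\<not> ?thesis"
  let ?I = "{..<M} \<times> {..<M}" and ?J = "{..<N} \<times> {..<N}"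
  let ?\<phi> = "\<lambda>(A, B). (restrict (\<lambda>ij. A $$ ij) ?I, restrict (\<lambda>ij. B $$ ij) ?J)"
  let ?T = "(\<Pi>\<^sub>E ij\<in>?I. (\<lambda>(A, B). A $$ ij) ` S) \<times> (\<Pi>\<^sub>E ij\<in>?J. (\<lambda>(A, B). B $$ ij) ` S)"
  have "finite ?T" using * by (intro finite_cartesian_product finite_PiE) auto
  moreover have "?\<phi> ` S \<subseteq> ?T" by (force simp: image_iff)
  ultimately have "finite (?\<phi> ` S)" using finite_subset by blast
  moreover have "inj_on ?\<phi> S"
  proof (rule inj_onI)
    fix s t assume st: "s \<in> S" "t \<in> S" "?\<phi> s = ?\<phi> t"
    obtain A B C D where s: "s = (A, B)" "t = (C, D)" by fastforce
    have r: "restrict (\<lambda>ij. A $$ ij) ?I = restrict (\<lambda>ij. C $$ ij) ?I" "restrict (\<lambda>ij. B $$ ij) ?J = restrict (\<lambda>ij. D $$ ij) ?J"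
      using st s by auto
    have c: "A \<in> carrier_mat M M" "C \<in> carrier_mat M M" "B \<in> carrier_mat N N" "D \<in> carrier_mat N N"
      using st s assms(2) by auto
    have "A $$ (i, j) = C $$ (i, j)" if "i < M" "j < M" for i j
      using fun_cong[OF r(1), of "(i, j)"] that by simp
    then have "A = C" using c by (intro eq_matI) auto
    moreover have "B $$ (i, j) = D $$ (i, j)" if "i < N" "j < N" for i j
      using fun_cong[OF r(2), of "(i, j)"] that by simp
    then have "B = D" using c by (intro eq_matI) auto
    ultimately show "s = t" using s by simp
  qed
  ultimately show False using assms(1) finite_imageD by blast
qed

text \<open>Some matrix entry takes infinitely many values on the stabilizer and can be sent to
  infinity by a place, while the translates of \<open>F\<close> stay multiples of \<open>F\<close>
  by roots of unity. Thus the form remains integral although the family does not.\<close>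

lemma infinite_stabilizer_destabilized:
  assumes pos: "m > 0" "n > 0" "k > 0" "l > 0"
    and F: "F \<in> bihom_forms m n k l" "F \<noteq> 0" and ss: "git_semistable m n k l F"
    and inf: "infinite (proj_stabilizer m n F)"
  shows "\<exists>g\<in>grp m n. \<exists>u\<in>fundamental_set m n k l. Supp (act g F) \<subseteq> N_oplus m n k l u"
proof -
  from ss obtain d f where f: "d \<ge> 1" "invariant_section m n k l d f" "value_at f F \<noteq> 0"
    by (auto simp: git_semistable_def)
  have fs: "f \<in> hom_forms (Xi m n k l) (\<lambda>_. 1) d" using f(2) by (simp add: invariant_section_def sections_hom)
  define S where "S = {(A, B). A \<in> SL (m + 1) \<and> B \<in> SL (n + 1) \<and> (\<exists>c. c \<noteq> 0 \<and> sbst A B F = const c * F)}"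
  have "infinite S"
  proof
    assume "finite S"
    moreover have "(\<lambda>(A, B). (adj_mat A, adj_mat B)) ` proj_stabilizer m n F \<subseteq> S"
      by (auto simp: proj_stabilizer_def S_def grp_def act_sbst SL_adj(1) simp del: act.simps One_nat_def Suc_eq_plus1 add_Suc_right)
    ultimately have "finite ((\<lambda>(A, B). (adj_mat A, adj_mat B)) ` proj_stabilizer m n F)" using finite_subset by blast
    moreover have "inj_on (\<lambda>(A, B). (adj_mat A, adj_mat B)) (proj_stabilizer m n F)"
    proof (rule inj_onI)
      fix s t assume st: "s \<in> proj_stabilizer m n F" "t \<in> proj_stabilizer m n F"
        "(\<lambda>(A, B). (adj_mat A, adj_mat B)) s = (\<lambda>(A, B). (adj_mat A, adj_mat B)) t"
      obtain A B C D where s: "s = (A, B)" "t = (C, D)" by fastforce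
      have "A \<in> SL (m + 1)" "B \<in> SL (n + 1)" "C \<in> SL (m + 1)" "D \<in> SL (n + 1)"
        using st s by (auto simp: proj_stabilizer_def grp_def)
      then show "s = t" using st(3) s SL_adj_adj by (metis case_prod_conv prod.inject)
    qed
    ultimately show False using inf finite_imageD by blast
  qed
  moreover have "S \<subseteq> carrier_mat (m + 1) (m + 1) \<times> carrier_mat (n + 1) (n + 1)"
    by (auto simp: S_def SL_def)
  ultimately have entry: "(\<exists>i<m + 1. \<exists>j<m + 1. infinite ((\<lambda>(A, B). A $$ (i, j)) ` S)) \<or>
      (\<exists>i<n + 1. \<exists>j<n + 1. infinite ((\<lambda>(A, B). B $$ (i, j)) ` S))" by (rule infinite_entry)
  then obtain e where e: "infinite (e ` S)" and e_entry: "(\<exists>i<m + 1. \<exists>j<m + 1. e = (\<lambda>(A, B). A $$ (i, j))) \<or>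
      (\<exists>i<n + 1. \<exists>j<n + 1. e = (\<lambda>(A, B). B $$ (i, j)))" by blast
  \<comment> \<open>Specialising polynomials in \<open>inverse (e s)\<close> at 0 gives
    \<open>e\<close> a pole. This is consistent: \<open>e\<close> takes infinitely many values, so a
    polynomial that vanishes at all their inverses is 0.\<close>
  let ?S = "{s \<in> S. e s \<noteq> 0}"
  have "\<exists>\<Gamma>. place \<Gamma> \<and> (\<forall>x p. p \<in> UNIV \<longrightarrow> (\<forall>s\<in>?S. x s = poly p (inverse (e s))) \<longrightarrow>
      place.pl \<Gamma> x (poly p 0)) \<and> place.ae \<Gamma> (\<lambda>s. s \<in> ?S)"
  proof (rule place_of_evaluation)
    show "\<exists>p\<in>UNIV. (\<forall>s\<in>?S. poly p (inverse (e s)) = c) \<and> poly p 0 = c" for c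
      by (intro bexI[of _ "[:c:]"]) simp_all
    fix Q :: "complex poly" assume Q: "\<And>s. s \<in> ?S \<Longrightarrow> poly Q (inverse (e s)) = 0"
    have "infinite (e ` S - {0})" using e by simp
    moreover have "inj_on inverse (e ` S - {0})" by (auto simp: inj_on_def)
    ultimately have "infinite (inverse ` (e ` S - {0}))" using finite_imageD by blast
    moreover have "inverse ` (e ` S - {0}) \<subseteq> {t. poly Q t = 0}" using Q by auto
    ultimately have "infinite {t. poly Q t = 0}" using infinite_super by blast
    then have "Q = 0" using poly_roots_finite by blast
    then show "poly Q 0 = 0" by simp
  qed simp_all
  then obtain \<Gamma> where \<Gamma>: "place \<Gamma>" "\<And>x p. (\<And>s. s \<in> S \<Longrightarrow> e s \<noteq> 0 \<Longrightarrow> x s = poly p (inverse (e s))) \<Longrightarrow>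
      place.pl \<Gamma> x (poly p 0)" "place.ae \<Gamma> (\<lambda>s. s \<in> S \<and> e s \<noteq> 0)" by auto
  interpret place \<Gamma> by (rule \<Gamma>(1))
  note ae_S = \<Gamma>(3)
  have inv_e: "pl (\<lambda>s. inverse (e s)) 0" using \<Gamma>(2)[of "\<lambda>s. inverse (e s)" "[:0, 1:]"] by simp
  have e_non: "\<not> integral e"
  proof
    assume "integral e"
    then obtain c where "pl e c" by (auto simp: integral_def)
    have "pl (\<lambda>_. 1) (c * 0)"
      by (rule ae_cong[OF ae_S R_mult[OF \<open>pl e c\<close> inv_e]]) auto
    from pl_unique[OF this R_const] show False by simp
  qed
  define A where "A s = (if s \<in> S then fst s else 1\<^sub>m (m + 1))" for s
  define B where "B s = (if s \<in> S then snd s else 1\<^sub>m (n + 1))" for s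
  have SL: "A s \<in> SL (m + 1)" "B s \<in> SL (n + 1)" for s by (auto simp: A_def B_def S_def SL_one simp del: One_nat_def)
  have "\<exists>c. s \<in> S \<longrightarrow> c \<noteq> 0 \<and> sbst (A s) (B s) F = const c * F" for s
    by (cases s) (auto simp: A_def B_def S_def)
  then obtain cc where cc: "\<And>s. s \<in> S \<Longrightarrow> cc s \<noteq> 0 \<and> sbst (A s) (B s) F = const (cc s) * F" by metis
  \<comment> \<open>The invariant \<open>f\<close> of degree \<open>d\<close> has the same nonzero
    value at \<open>F\<close> and at \<open>cc s\<close> times \<open>F\<close>.\<close>
  have cc_d: "cc s ^ d = 1" if "s \<in> S" for s
  proof -
    have "cc s ^ d * value_at f F = value_at f F"
      using value_inv[OF f(2) SL F(1), of s s] cc[OF that] value_scale[OF fs] by simp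
    then show ?thesis using f(3) by simp
  qed
  \<comment> \<open>From \<open>cc ^ d = 1\<close> it follows that \<open>cc\<close> is the power
    \<open>d - 1\<close> of its inverse; so \<open>cc\<close> is integral whichever of the two
    is.\<close>
  have "integral cc"
  proof (rule ccontr)
    assume n: "\<not> integral cc"
    then have i: "integral (\<lambda>s. inverse (cc s))" using integral_or_inverse by blast
    have "integral cc"
      by (rule ae_integral_cong[OF ae_S integral_power[OF i, of "d - 1"]])
         (use cc cc_d f(1) in \<open>auto simp: power_inverse power_diff field_simps\<close>)
    then show False using n by simp
  qed
  have int: "integral (\<lambda>s. lk (sbst (A s) (B s) F) I)" for I
    by (rule ae_integral_cong[OF ae_S integral_mult[OF \<open>integral cc\<close> integral_const[of "lk F I"]]])
       (use cc in auto)
  have d: "A s \<in> carrier_mat (m + 1) (m + 1)" "det (A s) = 1" "B s \<in> carrier_mat (n + 1) (n + 1)" "det (B s) = 1" for s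
    using SL[of s] by (auto simp: SL_def)
  have "\<not> ((\<forall>i<m + 1. \<forall>j<m + 1. integral (\<lambda>s. A s $$ (i, j))) \<and> (\<forall>i<n + 1. \<forall>j<n + 1. integral (\<lambda>s. B s $$ (i, j))))"
  proof
    assume *: "(\<forall>i<m + 1. \<forall>j<m + 1. integral (\<lambda>s. A s $$ (i, j))) \<and> (\<forall>i<n + 1. \<forall>j<n + 1. integral (\<lambda>s. B s $$ (i, j)))"
    from e_entry show False
    proof (elim disjE exE conjE)
      fix i j assume ij: "i < m + 1" "j < m + 1" "e = (\<lambda>(A, B). A $$ (i, j))"
      have "integral e" by (rule ae_integral_cong[OF ae_S *[THEN conjunct1, rule_format, OF ij(1,2)]]) (auto simp: ij(3) A_def)
      then show False using e_non by simp
    next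
      fix i j assume ij: "i < n + 1" "j < n + 1" "e = (\<lambda>(A, B). B $$ (i, j))"
      have "integral e" by (rule ae_integral_cong[OF ae_S *[THEN conjunct2, rule_format, OF ij(1,2)]]) (auto simp: ij(3) B_def)
      then show False using e_non by simp
    qed
  qed
  from destabilizing_subgroup[of m n k l F A B, OF pos F d int this]
  obtain g u where "g \<in> grp m n" "u \<in> fundamental_set m n k l"
    "Supp (act g F) \<subseteq> N_plus m n k l u \<or> Supp (act g F) \<subseteq> N_oplus m n k l u" by (auto split: if_splits)
  moreover have "N_plus m n k l u \<subseteq> N_oplus m n k l u" for u by (auto simp: N_plus_def N_oplus_def)
  ultimately show ?thesis by blast
qed


section \<open>Limits along one-parameter subgroups\<close>

interpretation lim: ring_rel "\<lambda>x c. (x \<longlongrightarrow> c) (at (0 :: complex))"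
  by unfold_locales (auto intro: tendsto_add tendsto_mult)

lemma fundamental_set_props:
  assumes "(r, s) \<in> fundamental_set m n k l"
  shows "(\<Sum>i\<le>m. r $ i) = 0" "(\<Sum>j\<le>n. s $ j) = 0" "r $ 0 \<noteq> 0 \<or> s $ 0 \<noteq> 0"
proof -
  from assms obtain \<rho> \<sigma> where N: "(\<rho>, \<sigma>) \<in> normalised_weights m n k l"
    and r: "\<And>i. i \<le> m \<Longrightarrow> of_int (r $ i) = of_int (common_denominator m n (\<rho>, \<sigma>)) * \<rho> $ i"
    and s: "\<And>j. j \<le> n \<Longrightarrow> of_int (s $ j) = of_int (common_denominator m n (\<rho>, \<sigma>)) * \<sigma> $ j"
    by (auto simp: fundamental_set_def)
  let ?c = "common_denominator m n (\<rho>, \<sigma>)"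
  have sums: "(\<Sum>i\<le>m. \<rho> $ i) = 0" "(\<Sum>j\<le>n. \<sigma> $ j) = 0" using N by (auto simp: normalised_weights_def)
  have "of_int (\<Sum>i\<le>m. r $ i) = of_int ?c * (\<Sum>i\<le>m. \<rho> $ i)" by (simp add: r sum_distrib_left)
  then show "(\<Sum>i\<le>m. r $ i) = 0" by (simp only: sums mult_zero_right of_int_eq_0_iff)
  have "of_int (\<Sum>j\<le>n. s $ j) = of_int ?c * (\<Sum>j\<le>n. \<sigma> $ j)" by (simp add: s sum_distrib_left)
  then show "(\<Sum>j\<le>n. s $ j) = 0" by (simp only: sums mult_zero_right of_int_eq_0_iff)
  from N obtain E where "{(\<rho>', \<sigma>') \<in> solutions m n E. \<rho>' $ 0 = 1} = {(\<rho>, \<sigma>)} \<or>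
         {(\<rho>', \<sigma>') \<in> solutions m n E. \<sigma>' $ 0 = 1} = {(\<rho>, \<sigma>)}" by (auto simp: normalised_weights_def)
  then have "\<rho> $ 0 = 1 \<or> \<sigma> $ 0 = 1" by blast
  then have "(of_int (r $ 0) :: rat) = of_int ?c \<or> (of_int (s $ 0) :: rat) = of_int ?c" using r[of 0] s[of 0] by auto
  then show "r $ 0 \<noteq> 0 \<or> s $ 0 \<noteq> 0" using common_denominator_nonzero by auto
qed

definition torus :: "nat \<Rightarrow> int vec \<Rightarrow> complex \<Rightarrow> complex mat" where
  "torus N r t = mat_diag N (\<lambda>i. t powi (r $ i))"

lemma powi_sum: "t \<noteq> 0 \<Longrightarrow> (\<Prod>i\<in>S. t powi f i) = (t :: complex) powi (\<Sum>i\<in>S. f i)"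
  by (induction S rule: infinite_finite_induct) (simp_all add: power_int_add)

lemma torus_SL: "t \<noteq> 0 \<Longrightarrow> (\<Sum>i\<le>m. r $ i) = 0 \<Longrightarrow> torus (m + 1) r t \<in> SL (m + 1)"
  using powi_sum[of t "\<lambda>i. r $ i" "{..m}"]
  by (simp add: SL_def torus_def det_mat_diag lessThan_Suc_atMost)

lemma lk_torus:
  assumes F: "F \<in> bihom_forms m n k l" and t: "t \<noteq> 0"
  shows "lk (sbst (torus (m + 1) r t) (torus (n + 1) s t) F) I = t powi pairing m n I (r, s) * lk F I"
proof (cases "I \<in> ks F")
  case True
  let ?E = "case_sum (\<lambda>i. t powi (r $ i)) (\<lambda>i. t powi (s $ i))"
  have "mon_val ?E I = (\<Prod>v\<in>coords m n. ?E v powi int (lk I v))"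
    by (rule mon_val_coords[OF bihom_coords[OF F True]])
  also have "\<dots> = t powi pairing m n I (r, s)"
    using t by (simp add: prod_coords power_int_mult[symmetric] powi_sum power_int_add del: power_int_of_nat)
  finally show ?thesis unfolding torus_def lk_sbst_diag[OF F] by simp
next
  case False
  then show ?thesis unfolding torus_def lk_sbst_diag[OF F] by (simp add: in_keys_iff)
qed

text \<open>The limit of \<open>\<lambda>(t\<^sup>-\<^sup>1) \<cdot> F\<close> as \<open>t\<close> tends to 0.\<close>

definition limit_form :: "nat \<Rightarrow> nat \<Rightarrow> one_ps \<Rightarrow> form \<Rightarrow> form" where
  "limit_form m n u F = (\<Sum>I\<in>{I \<in> ks F. pairing m n I u = 0}. sg I (lk F I))"

lemma lk_limit_form: "lk (limit_form m n u F) I = (if pairing m n I u = 0 then lk F I else 0)"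
proof -
  have "lk (limit_form m n u F) I = (\<Sum>J\<in>{I \<in> ks F. pairing m n I u = 0}. if J = I then lk F I else 0)"
    unfolding limit_form_def lookup_sum by (rule sum.cong) (auto simp: lookup_single when_def)
  then show ?thesis by (auto simp: in_keys_iff)
qed

text \<open>Nonnegative weights make the coefficients of the translates polynomial in
  \<open>t\<close>, so they extend continuously to \<open>t = 0\<close>, where only the monomials of
  weight 0 remain.\<close>

lemma limit_form_value:
  assumes F: "F \<in> bihom_forms m n k l" and Supp: "Supp F \<subseteq> N_oplus m n k l (r, s)"
    and v: "\<And>t. t \<noteq> 0 \<Longrightarrow> value_at f (sbst (torus (m + 1) r t) (torus (n + 1) s t) F) = c"
  shows "value_at f (limit_form m n (r, s) F) = c"
proof -
  let ?G = "\<lambda>t. sbst (torus (m + 1) r t) (torus (n + 1) s t) F"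
  have "((\<lambda>t. lk (?G t) I) \<longlongrightarrow> lk (limit_form m n (r, s) F) I) (at 0)" for I
  proof -
    define e where "e = nat (pairing m n I (r, s))"
    have "lk (?G t) I = t ^ e * lk F I" if "t \<noteq> 0" for t
    proof (cases "lk F I = 0")
      case False
      then have "pairing m n I (r, s) \<ge> 0" using Supp by (auto simp: Supp_def N_oplus_def)
      then show ?thesis using lk_torus[OF F that, of r s I] by (simp add: e_def power_int_def)
    qed (simp only: lk_torus[OF F that] mult_zero_right)
    then have ev: "eventually (\<lambda>t. t ^ e * lk F I = lk (?G t) I) (at 0)"
      by (auto simp: eventually_at_filter)
    have "((\<lambda>t. t ^ e * lk F I) \<longlongrightarrow> 0 ^ e * lk F I) (at (0 :: complex))" by (intro tendsto_intros)
    also have "0 ^ e * lk F I = lk (limit_form m n (r, s) F) I"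
    proof (cases "lk F I = 0")
      case False
      then have "pairing m n I (r, s) \<ge> 0" using Supp by (auto simp: Supp_def N_oplus_def)
      then show ?thesis by (auto simp: lk_limit_form e_def power_0_left simp del: pairing.simps)
    qed (simp add: lk_limit_form)
    finally show ?thesis by (rule Lim_transform_eventually[OF _ ev])
  qed
  then have "((\<lambda>t. value_at f (?G t)) \<longlongrightarrow> value_at f (limit_form m n (r, s) F)) (at 0)"
    unfolding value_at_def by (intro lim.R_eval)
  moreover have "((\<lambda>t. value_at f (?G t)) \<longlongrightarrow> c) (at 0)"
  proof (rule Lim_transform_eventually[OF tendsto_const])
    show "eventually (\<lambda>t. c = value_at f (?G t)) (at 0)"
      unfolding eventually_at_filter by (rule always_eventually) (use v in metis)
  qed
  ultimately show ?thesis by (intro tendsto_unique[of "at (0 :: complex)"]) simp_all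
qed

text \<open>When all weights are positive the limit is the zero form, where invariants of positive
  degree vanish; but an invariant keeps its value along the translates and in the limit.\<close>

lemma destabilized_unstable:
  assumes F: "F \<in> bihom_forms m n k l" and g: "g \<in> grp m n" and u: "u \<in> fundamental_set m n k l"
    and Supp: "Supp (act g F) \<subseteq> N_plus m n k l u"
  shows "git_unstable m n k l F"
  unfolding git_unstable_def
proof
  assume "git_semistable m n k l F"
  then obtain d f where f: "d \<ge> 1" "invariant_section m n k l d f" "value_at f F \<noteq> 0"
    by (auto simp: git_semistable_def)
  obtain r s where rs: "u = (r, s)" by fastforce
  note fp = fundamental_set_props[OF u[unfolded rs]]
  let ?G = "act g F"
  have G: "?G \<in> bihom_forms m n k l" by (rule act_bihom[OF g F])
  have "limit_form m n (r, s) ?G = 0"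
    using Supp by (intro poly_mapping_eqI) (auto simp: lk_limit_form Supp_def N_plus_def rs simp del: pairing.simps)
  moreover have "value_at f (limit_form m n (r, s) ?G) = value_at f ?G"
  proof (rule limit_form_value[OF G])
    show "Supp ?G \<subseteq> N_oplus m n k l (r, s)" using Supp by (auto simp: N_plus_def N_oplus_def rs simp del: pairing.simps)
    show "value_at f (sbst (torus (m + 1) r t) (torus (n + 1) s t) ?G) = value_at f ?G" if "t \<noteq> 0" for t
      by (rule value_inv[OF f(2) torus_SL[OF that fp(1)] torus_SL[OF that fp(2)] G])
  qed
  moreover have "value_at f ?G = value_at f F" using f(2) g F by (simp add: invariant_section_def)
  moreover have "value_at f 0 = 0"
    by (rule value_zero[where X = "Xi m n k l", OF _ f(1)]) (use f(2) in \<open>simp add: invariant_section_def sections_hom\<close>)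
  ultimately show False using f(3) by simp
qed

lemma infinite_powi:
  assumes "(a :: int) \<noteq> 0"
  shows "infinite ((\<lambda>t :: complex. t powi a) ` (- {0}))"
proof
  assume fin: "finite ((\<lambda>t :: complex. t powi a) ` (- {0}))"
  \<comment> \<open>The values at positive integers already differ, because their absolute values
    do.\<close>
  define p where "p n = (of_nat (Suc n) :: complex) powi a" for n
  have "inj p"
  proof (rule injI)
    fix x y assume "p x = p y"
    then have "norm (p x) = norm (p y)" by simp
    then have "real (Suc x) powi a = real (Suc y) powi a" by (simp only: p_def norm_power_int norm_of_nat)
    then have "real (Suc x) ^ nat \<bar>a\<bar> = real (Suc y) ^ nat \<bar>a\<bar>"
      by (cases "a \<ge> 0") (auto simp: power_int_def power_inverse)
    moreover have "0 < nat \<bar>a\<bar>" using assms by simp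
    ultimately have "real (Suc x) = real (Suc y)" using power_eq_imp_eq_base of_nat_0_le_iff by blast
    then show "x = y" by simp
  qed
  moreover have "range p \<subseteq> (\<lambda>t :: complex. t powi a) ` (- {0})" by (auto simp: p_def simp del: of_nat_Suc intro!: imageI)
  ultimately show False using fin by (meson finite_subset infinite_UNIV_nat range_inj_infinite)
qed

lemma conj_cancel:
  assumes C: "C \<in> SL N" and T: "T \<in> carrier_mat N N"
  shows "adj_mat C * (C * T * adj_mat C) * C = T"
proof -
  note c = SL_carrier[OF C] SL_carrier[OF SL_adj(1)[OF C]]
  have "adj_mat C * (C * T * adj_mat C) * C = adj_mat C * (C * T * adj_mat C * C)"
    by (rule assoc_mult_mat[of _ N N _ N _ N]) (use c T in auto)
  also have "C * T * adj_mat C * C = C * T * (adj_mat C * C)"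
    by (rule assoc_mult_mat[of _ N N _ N _ N]) (use c T in auto)
  also have "\<dots> = C * T" unfolding SL_adj(3)[OF C] by (rule right_mult_one_mat) (use c T in auto)
  also have "adj_mat C * (C * T) = adj_mat C * C * T"
    by (rule assoc_mult_mat[of _ N N _ N _ N, symmetric]) (use c T in auto)
  also have "\<dots> = T" unfolding SL_adj(3)[OF C] by (rule left_mult_one_mat[OF T])
  finally show ?thesis .
qed

text \<open>The limit \<open>H\<close> is semistable, so a closed orbit must contain it up to a
  scalar. As \<open>H\<close> is fixed by the one-parameter subgroup, a conjugate of that subgroup
  fixes \<open>F\<close>, and the stabilizer is infinite.\<close>

lemma destabilized_nonstable:
  assumes F: "F \<in> bihom_forms m n k l" and g: "g \<in> grp m n" and u: "u \<in> fundamental_set m n k l"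
    and Supp: "Supp (act g F) \<subseteq> N_oplus m n k l u"
  shows "\<not> git_stable m n k l F"
proof
  assume st: "git_stable m n k l F"
  then obtain d f where f: "d \<ge> 1" "invariant_section m n k l d f" "value_at f F \<noteq> 0"
    by (auto simp: git_stable_def git_semistable_def)
  obtain P where P: "P \<subseteq> (\<Union>d. sections m n k l d)"
    "\<And>H. git_semistable m n k l H \<Longrightarrow> H \<in> proj_orbit m n F \<longleftrightarrow> (\<forall>p\<in>P. value_at p H = 0)"
    using st by (auto simp: git_stable_def orbit_closed_in_semistable_def)
  obtain r s where rs: "u = (r, s)" by fastforce
  note fp = fundamental_set_props[OF u[unfolded rs]]
  obtain A B where AB: "A \<in> SL (m + 1)" "B \<in> SL (n + 1)" "act g F = sbst A B F"
    using g bex_act[of m n "\<lambda>K. act g F = K" F] by blast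
  let ?G = "act g F" and ?T = "torus (m + 1) r" and ?T' = "torus (n + 1) s"
  have G: "?G \<in> bihom_forms m n k l" by (rule act_bihom[OF g F])
  have T: "?T t \<in> SL (m + 1)" "?T' t \<in> SL (n + 1)" if "t \<noteq> 0" for t
    using torus_SL[OF that fp(1)] torus_SL[OF that fp(2)] by auto
  have fG: "value_at f ?G = value_at f F" using f(2) g F by (simp add: invariant_section_def)
  have ss: "git_semistable m n k l H" if "H \<in> bihom_forms m n k l" "value_at f H = value_at f F" for H
  proof -
    have "value_at f 0 = 0"
      by (rule value_zero[where X = "Xi m n k l", OF _ f(1)]) (use f(2) in \<open>simp add: invariant_section_def sections_hom\<close>)
    then have "H \<noteq> 0" "value_at f H \<noteq> 0" using that f(3) by auto
    then show ?thesis unfolding git_semistable_def using that(1) f(1,2) by blast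
  qed
  define H where "H = limit_form m n (r, s) ?G"
  have Hb: "H \<in> bihom_forms m n k l"
    using G by (auto simp: bihom_forms_def H_def in_keys_iff lk_limit_form split: if_splits)
  have lim: "value_at p H = c" if "\<And>t. t \<noteq> 0 \<Longrightarrow> value_at p (sbst (?T t) (?T' t) ?G) = c" for p c
    unfolding H_def by (rule limit_form_value[OF G Supp[unfolded rs] that])
  have fT: "value_at f (sbst (?T t) (?T' t) ?G) = value_at f F" if "t \<noteq> 0" for t
    using value_inv[OF f(2) T[OF that] G] fG by simp
  have fH: "value_at f H = value_at f F" by (rule lim) (rule fT)
  \<comment> \<open>The equations \<open>P\<close> vanish along the translates and hence at their
    limit; \<open>H\<close> is semistable because \<open>f\<close> keeps its value.\<close>
  have "H \<in> proj_orbit m n F"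
    unfolding P(2)[OF ss[OF Hb fH]]
  proof
    fix p assume p: "p \<in> P"
    show "value_at p H = 0"
    proof (rule lim)
      fix t :: complex assume t: "t \<noteq> 0"
      note AT = SL_mult[OF AB(1) T(1)[OF t]] SL_mult[OF AB(2) T(2)[OF t]]
      have e: "sbst (?T t) (?T' t) ?G = sbst (A * ?T t) (B * ?T' t) F"
        unfolding AB(3) by (rule sbst_comp) (use T[OF t] AB F SL_carrier in blast)+
      have "sbst (?T t) (?T' t) ?G = const 1 * act (adj_mat (A * ?T t), adj_mat (B * ?T' t)) F"
        unfolding e sbst_act[OF AT] by simp
      moreover have "(adj_mat (A * ?T t), adj_mat (B * ?T' t)) \<in> grp m n"
        using SL_adj(1)[OF AT(1)] SL_adj(1)[OF AT(2)] by (simp add: grp_def)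
      ultimately have "sbst (?T t) (?T' t) ?G \<in> proj_orbit m n F"
        unfolding proj_orbit_def by (intro CollectI exI conjI) (assumption, simp, assumption)
      moreover have "sbst (?T t) (?T' t) ?G \<in> bihom_forms m n k l"
        using sbst_bihom[OF SL_carrier[OF T(1)[OF t]] SL_carrier[OF T(2)[OF t]] G] .
      ultimately show "value_at p (sbst (?T t) (?T' t) ?G) = 0" using P(2)[OF ss] fT[OF t] p by blast
    qed
  qed
  then obtain c h where h: "c \<noteq> 0" "h \<in> grp m n" "H = const c * act h F" by (auto simp: proj_orbit_def)
  then obtain C E where CE: "C \<in> SL (m + 1)" "E \<in> SL (n + 1)" "H = const c * sbst C E F"
    using bex_act[of m n "\<lambda>K. act h F = K" F] by metis
  note cC = SL_carrier[OF CE(1)] SL_carrier[OF SL_adj(1)[OF CE(1)]]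
  note cE = SL_carrier[OF CE(2)] SL_carrier[OF SL_adj(1)[OF CE(2)]]
  have HF: "sbst C E F = const (1 / c) * H"
    using h(1) by (simp add: CE(3) mult.assoc[symmetric] const_mult[symmetric])
  define X where "X t = C * ?T t * adj_mat C" for t
  define Y where "Y t = E * ?T' t * adj_mat E" for t
  have XY: "X t \<in> SL (m + 1)" "Y t \<in> SL (n + 1)" if "t \<noteq> 0" for t
    using T[OF that] CE SL_adj(1) by (auto simp: X_def Y_def intro!: SL_mult)
  have fix_F: "sbst (X t) (Y t) F = F" if t: "t \<noteq> 0" for t
  proof -
    note cT = SL_carrier[OF T(1)[OF t]] SL_carrier[OF T(2)[OF t]]
    have fix_H: "sbst (?T t) (?T' t) H = H"
    proof (rule poly_mapping_eqI)
      fix I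
      show "lk (sbst (?T t) (?T' t) H) I = lk H I"
        unfolding lk_torus[OF Hb t] by (simp add: H_def lk_limit_form del: pairing.simps)
    qed
    have "sbst (X t) (Y t) F = sbst (adj_mat C) (adj_mat E) (sbst (C * ?T t) (E * ?T' t) F)"
      unfolding X_def Y_def by (rule sbst_comp[symmetric]) (use cC cE cT F in auto)
    also have "sbst (C * ?T t) (E * ?T' t) F = sbst (?T t) (?T' t) (sbst C E F)"
      by (rule sbst_comp[OF cT cC(1) cE(1) F, symmetric])
    also have "\<dots> = sbst C E F" by (simp only: HF sbst_const_mult fix_H)
    also have "sbst (adj_mat C) (adj_mat E) (sbst C E F) = sbst (C * adj_mat C) (E * adj_mat E) F"
      by (rule sbst_comp[OF cC(2) cE(2) cC(1) cE(1) F])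
    also have "\<dots> = F" unfolding SL_adj(2)[OF CE(1)] SL_adj(2)[OF CE(2)] by (rule sbst_one[OF F])
    finally show ?thesis .
  qed
  have stab: "(adj_mat (X t), adj_mat (Y t)) \<in> proj_stabilizer m n F" if t: "t \<noteq> 0" for t
  proof -
    have "act (adj_mat (X t), adj_mat (Y t)) F = const 1 * F"
      using fix_F[OF t] sbst_act[OF XY[OF t], of F] by simp
    then show ?thesis
      unfolding proj_stabilizer_def grp_def using SL_adj(1)[OF XY(1)[OF t]] SL_adj(1)[OF XY(2)[OF t]]
      by (intro CollectI conjI exI[of _ 1] SigmaI) (assumption, assumption, rule one_neq_zero, assumption)
  qed
  \<comment> \<open>Undoes the inversion and the conjugation and reads off the first diagonal entry
    of each block. One of the two entries takes infinitely many values, since \<open>r $ 0\<close>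
    or \<open>s $ 0\<close> is nonzero.\<close>
  define \<phi> where "\<phi> = (\<lambda>(X, Y). ((adj_mat C * adj_mat X * C) $$ (0, 0), (adj_mat E * adj_mat Y * E) $$ (0, 0)))"
  have phi: "\<phi> (adj_mat (X t), adj_mat (Y t)) = (t powi (r $ 0), t powi (s $ 0))" if t: "t \<noteq> 0" for t
  proof -
    have "adj_mat C * adj_mat (adj_mat (X t)) * C = ?T t"
      unfolding SL_adj_adj[OF XY(1)[OF t]] unfolding X_def by (rule conj_cancel[OF CE(1) SL_carrier[OF T(1)[OF t]]])
    moreover have "adj_mat E * adj_mat (adj_mat (Y t)) * E = ?T' t"
      unfolding SL_adj_adj[OF XY(2)[OF t]] unfolding Y_def by (rule conj_cancel[OF CE(2) SL_carrier[OF T(2)[OF t]]])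
    ultimately show ?thesis by (simp add: \<phi>_def torus_def mat_diag_def)
  qed
  have "finite (proj_stabilizer m n F)" using st by (simp add: git_stable_def)
  then have "finite (\<phi> ` proj_stabilizer m n F)" by simp
  moreover have "(\<lambda>t. (t powi (r $ 0), t powi (s $ 0))) ` (- {0}) \<subseteq> \<phi> ` proj_stabilizer m n F"
  proof (rule image_subsetI)
    fix t :: complex assume "t \<in> - {0}"
    then have "t \<noteq> 0" by simp
    then show "(t powi (r $ 0), t powi (s $ 0)) \<in> \<phi> ` proj_stabilizer m n F"
      using phi stab by (metis image_eqI)
  qed
  ultimately have fin: "finite ((\<lambda>t :: complex. (t powi (r $ 0), t powi (s $ 0))) ` (- {0}))" using finite_subset by blast
  have "finite ((\<lambda>t :: complex. t powi (r $ 0)) ` (- {0}))" "finite ((\<lambda>t :: complex. t powi (s $ 0)) ` (- {0}))"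
    using finite_imageI[OF fin, of fst] finite_imageI[OF fin, of snd] by (simp_all add: image_image)
  then show False using fp(3) infinite_powi by blast
qed

theorem theorem1p2:
  fixes m n k l :: nat and F :: form
  assumes "m > 0" and "n > 0" and "k > 0" and "l > 0"
    and "F \<in> bihom_forms m n k l" and "F \<noteq> 0"
  shows "(\<not> git_stable m n k l F \<longleftrightarrow>
           (\<exists>g\<in>grp m n. \<exists>u\<in>fundamental_set m n k l. Supp (act g F) \<subseteq> N_oplus m n k l u))
       \<and> (git_unstable m n k l F \<longleftrightarrow>
           (\<exists>g\<in>grp m n. \<exists>u\<in>fundamental_set m n k l. Supp (act g F) \<subseteq> N_plus m n k l u))"
proof -
  have un: "git_unstable m n k l F \<longleftrightarrow>
      (\<exists>g\<in>grp m n. \<exists>u\<in>fundamental_set m n k l. Supp (act g F) \<subseteq> N_plus m n k l u)"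
    using unstable_destabilized[OF assms] destabilized_unstable[OF assms(5)] by blast
  have "\<exists>g\<in>grp m n. \<exists>u\<in>fundamental_set m n k l. Supp (act g F) \<subseteq> N_oplus m n k l u"
    if ns: "\<not> git_stable m n k l F"
  proof -
    \<comment> \<open>The three ways in which stability can fail; the first leads even to
      \<open>N_plus\<close>, a subset of \<open>N_oplus\<close>.\<close>
    consider "git_unstable m n k l F" | "git_semistable m n k l F" "infinite (proj_stabilizer m n F)"
      | "\<not> orbit_closed_in_semistable m n k l F"
      using ns by (auto simp: git_stable_def git_unstable_def)
    then show ?thesis
    proof cases
      case 1
      moreover have "N_plus m n k l u \<subseteq> N_oplus m n k l u" for u by (auto simp: N_plus_def N_oplus_def)
      ultimately show ?thesis using un by blast
    next
      case 2 then show ?thesis by (rule infinite_stabilizer_destabilized[OF assms])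
    next
      case 3 then show ?thesis by (rule nonclosed_destabilized[OF assms])
    qed
  qed
  with un show ?thesis using destabilized_nonstable[OF assms(5)] by blast
qed

end
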